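(* Suppose that Assumptions (A) and (B) of the context hold in a neighbourhood of a local minimizer $x_*$ of $\min_{x\in X}f(x)$ s.t. $c(x)=y_*$, and assume that the composite step method described in the context yields a sequence $x_k\in X$ that converges to $x_*$. Then convergence is quadratic: denoting $\mathbf x_k:=R_{x_*}^{-1}(x_k)$ (defined for all sufficiently large $k$), there is a constant $\beta_*$ such that for all sufficiently large $k$ $$\|\mathbf x_{k+1}-0_{x_*}\|_{x_*}\le\beta_*\|\mathbf x_k-0_{x_*}\|_{x_*}^2 .$$
   Context: **Setting.** $X,Y$ are Hilbert manifolds of class $C^2$ (modelled over Hilbert spaces), $f:X\to\mathbb R$ and $c:X\to Y$ are twice continuously differentiable, $y_*\in Y$. Each $T_xX$ carries a scalar product $\langle\cdot,\cdot\rangle_x$ making it a Hilbert space whose topology is compatible with that of $X$ (it need not come from a Riemannian metric); $\|\cdot\|_x$ is the induced norm, $\|\ell\|_{x,*}=\sup_{v\ne0}\ell(v)/\|v\|_x$ the dual norm, $B^x_\rho=\{w\in T_xX:\|w\|_x<\rho\}$, $0_x$ the zero of $T_xX$. **Retractions and stratifications.** A local retraction at $x$ is a $C^2$-map $R_x:V_x\to X$ on a neighbourhood $V_x$ of $0_x$ in $T_xX$ with $R_x(0_x)=x$, $T_{0_x}R_x=\mathrm{id}_{T_xX}$. A local stratification at $y$ is a $C^2$-map $S_y:U_y\to T_yY$ on a neighbourhood $U_y$ of $y$ in $Y$ with $S_y(y)=0_y$, $T_yS_y=\mathrm{id}_{T_yY}$; it is globally defined if $U_y=Y$. For each $x\in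 X$ local retractions $R_x^\circ$, $R_x$ (domain of $R_x$: $V_x$, assumed closed), a local stratification $S^\circ_{c(x)}$ and a globally defined stratification $S_{c(x)}$ are given. For each $x$, $V_x^i\subset V_x$ is a neighbourhood of $0_x$ such that $R_x:V_x^i\to R_x(V_x^i)$ is a diffeomorphism onto a neighbourhood of $x$; $R_x^{-1}$ denotes the inverse of this restriction. **Pullbacks.** $\mathbf f:=f\circ R_x$, $\mathbf c(\delta x):=S_{c(x)}(c(R_x(\delta x)))-S_{c(x)}(y_* )$, $\mathbf L(\delta x,p):=\mathbf f(\delta x)+p\,\mathbf c(\delta x)$ for $p\in T_{c(x)}Y^*$. $\mathbf L^\circ$ is defined in the same way with $R_x^\circ,S_{c(x)}^\circ$ (only its derivatives are used). Primes denote derivatives with respect to $\delta x$. First derivatives at $0_x$ do not depend on the chosen retraction/stratification and are written $f'(0_x)$, $c'(0_x)$, $L'(0_x,p)=f'(0_x)+p\,c'(0_x)$; also $f(0_x):=\mathbf f(0_x)$. Transition mappings (with local inverses, $y=c(x)$): $\Phi_x:=(R_x^\circ)^{-1}\circ R_x$ near $0_x$, $\Psi_y:=S_y\circ(S_y^\circ)^{-1}$ near $0_y$. The pair $(S^\circ_{y},S_{y})$ is second order consistent if $\Psi_y''(0_y)=0$. **Pseudo-inverse and multiplier.** For a surjective bounded linear $A:T_xX\to T_{c(x)}Y$, $A^-:T_{c(x)}Y\to(\ker A)^\perp$ is the right inverse of $A$ with range $(\ker A)^\perp$. If $c'(0_x)$ is surjective, $p_x:=-f'(0_x)c'(0_x)^-\in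 T_{c(x)}Y^*$. **Non-degeneracy.** The family $R_x$ is invertible over $M\subset X$ if $M\subset R_x(V_x^i)$ for all $x\in M$; then for $x_1,x_2\in M$ put $\Theta_{x_1\to x_2}:=R_{x_2}^{-1}\circ R_{x_1}$ on $R_{x_1}^{-1}(M)$. The family $(R_x,\|\cdot\|_x)$ is non-degenerate in a neighbourhood $U_{x_*}$ of $x_*$ if $R_x$ is invertible over an open set $O\supset U_{x_*}$, there is $\rho>0$ with $R_x(B_\rho^x)\subset O$ for all $x\in U_{x_*}$, and there is $\gamma$ with $\|\Theta_{x_1\to x_2}(v)-\Theta_{x_1\to x_2}(w)\|_{x_2}\le\gamma\|v-w\|_{x_1}$ for all $x_1,x_2\in U_{x_*}$, $v,w\in B_\rho^{x_1}$. **Assumption (A).** $(R_x,\|\cdot\|_x)$ is non-degenerate on a neighbourhood $U_{x_*}$ of $x_*$ and there are constants $\rho_0>0$, $\omega_{\mathbf f'},\omega_{\mathbf c},\omega^*_{\mathbf c}$, independent of $x$, such that for all $x\in U_{x_*}$ and all $v,\delta x\in T_xX$ with $\|\delta x\|_x\le\rho_0$ (such $\delta x$ being understood to lie in the domain of the pullbacks): - $\|\mathbf f'(\delta x)-f'(0_x)\|_{x,*}\le\omega_{\mathbf f'}\|\delta x\|_x$; - $c'(0_x)$ is surjective and $\|c'(0_x)^-(\mathbf c'(\delta x)-c'(0_x))v\|_x\le\omega_{\mathbf c}\|\delta x\|_x\|v\|_x$; - with $\mathbf x_*:=R_x^{-1}(x_* )$, $\mathbf c'(\mathbf x_* )$ is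 surjective and $\|\mathbf c'(\mathbf x_* )^-(\mathbf c'(\mathbf x_* )-c'(0_x))v\|_x\le\omega_{\mathbf c}^*\|\mathbf x_*-0_x\|_x\|v\|_x$. **Assumption (B).** $(R_x,\|\cdot\|_x)$ is non-degenerate on $U_{x_*}$ and there are constants $\rho_0>0$, $\omega_{\mathbf L}$, $\alpha>0$, $M_{L}$, $M_\Phi$ such that for all $x\in U_{x_*}$: - $|(\mathbf L''(\delta x,p_x)-\mathbf L''(0_x,p_x))(v,w)|\le\omega_{\mathbf L}\|\delta x\|_x\|v\|_x\|w\|_x$ for all $\delta x,v,w\in T_xX$, $\|\delta x\|_x\le\rho_0$; - $(\mathbf L^\circ)''(0_x,p_x)(v,v)\ge\alpha\|v\|_x^2$ for all $v\in\ker c'(0_x)$; - $|(\mathbf L^\circ)''(0_x,p_x)(v,w)|\le M_L\|v\|_x\|w\|_x$ for all $v,w\in T_xX$; - $\|\Phi_x''(0_x)(v,w)\|_x\le M_\Phi\|v\|_x\|w\|_x$ for all $v,w\in T_xX$. **Quadratic and cubic models.** For $\delta x=\delta n+\delta t$ with $\delta n\in\ker c'(0_x)^\perp$, $\delta t\in\ker c'(0_x)$: $$\mathbf q^\circ(\delta x):=f(0_x)+f'(0_x)\delta x+\tfrac12(\mathbf L^\circ)''(0_x,p_x)(\delta x,\delta x),$$ and, for $\delta n=\nu\Delta n$ ($\nu\in\,]0,1]$, $\Delta n$ below), $$\tilde{\mathbf q}(\delta n)(\delta t):=\mathbf L(\delta n,p_x)-(1-\nu)p_x\mathbf c(0_x)+\big(f'(0_x)+(\mathbf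 L^\circ)''(0_x,p_x)\delta n\big)\delta t+\tfrac12(\mathbf L^\circ)''(0_x,p_x)(\delta t,\delta t).$$ Set $\hat{\mathbf q}(\delta x):=\mathbf q^\circ(\delta x)$ if $(S^\circ_{c(x)},S_{c(x)})$ is second order consistent and $\hat{\mathbf q}(\delta x):=\tilde{\mathbf q}(\delta n)(\delta t)$ otherwise; and $\mathbf m_{[\omega_{\mathbf f}]}(v):=\hat{\mathbf q}(v)+\frac{[\omega_{\mathbf f}]}6\|v\|_x^3$. **Composite step method.** Fixed parameters: $\Theta_{\rm aim}\in\,]0,1[$, $\rho_{\rm ellbow}\in\,]0,1]$, $\Theta_{\rm acc}\in\,]\Theta_{\rm aim},1[$, $\underline\eta\in\,]0,1[$, $\hat\eta\in[\underline\eta,1[$, $0<\underline b<1<\overline b$, $\hat b\in\,]1,\overline b]$. Positive algorithmic quantities $[\omega_{\mathbf c}]$, $[\omega_{\mathbf f}]$ (with given initial values) are carried along and updated after every trial step. At the current iterate $x$ the following trial-step computation is repeated (with updated $[\omega_{\mathbf c}],[\omega_{\mathbf f}]$) until the trial step is accepted: 1. Normal step $\Delta n:=-c'(0_x)^-\mathbf c(0_x)$; Lagrange multiplier estimate $p_x:=-f'(0_x)c'(0_x)^-$; $\nu\in\,]0,1]$ maximal such that $\delta n:=\nu\Delta n$ satisfies $\frac{[\omega_{\mathbf c}]}2\|\delta n\|_x\le\rho_{\rm ellbow}\Theta_{\rm aim}$ and $\delta n\in V_x$. 2. Tangent step $\Delta t\in\ker c'(0_x)$: with some $\Delta p$ the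 solution of $(\mathbf L^\circ)''(0_x,p_x)\Delta t+c'(0_x)^*\Delta p+L'(0_x,p_x)+(\mathbf L^\circ)''(0_x,p_x)\delta n=0$, $c'(0_x)\Delta t=0$ (if $(\mathbf L^\circ)''(0_x,p_x)$ is not elliptic on $\ker c'(0_x)$, a suitably modified solution is used). 3. $\tau\in\mathbb R$ is a minimizer, over $\delta x=\nu\Delta n+\tau\Delta t$, of $f(0_x)+f'(0_x)\delta x+\frac12(\mathbf L^\circ)''(0_x,p_x)(\delta x,\delta x)+\frac{[\omega_{\mathbf f}]}6\|\delta x\|_x^3$ subject to $\nu\mathbf c(0_x)+c'(0_x)\delta x=0$, $\frac{[\omega_{\mathbf c}]}2\|\delta x\|_x\le\Theta_{\rm aim}$, $\delta x\in V_x$; set $\delta x:=\nu\Delta n+\tau\Delta t$. 4. Second order correction $\delta s:=-c'(0_x)^-(\mathbf c(\delta x)-\mathbf c(0_x)-c'(0_x)\delta x)$; $\sigma\in[0,1]$ maximal with $\delta x+\sigma\delta s\in V_x$ ($\sigma=1$ if $V_x=T_xX$). 5. The trial step is accepted iff both $\|\delta s\|_x/\|\delta x\|_x\le\Theta_{\rm acc}$ and $\eta\ge\underline\eta$, where $$\eta:=\frac{\mathbf f(\delta x+\sigma\delta s)-\mathbf m_{[\omega_{\mathbf f}]}(\delta n)}{\mathbf m_{[\omega_{\mathbf f}]}(\delta x)-\mathbf m_{[\omega_{\mathbf f}]}(\delta n)}.$$ 6. Updates: $[\omega_{\mathbf c}]^{\rm new}:=2\|\delta s\|_x/\|\delta x\|_x^2$;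 with $[\omega_{\mathbf f}]^{\rm raw}:=\frac6{\|\delta x\|_x^3}(\mathbf f(\delta x+\sigma\delta s)-\hat{\mathbf q}(\delta x))$, $[\omega_{\mathbf f}]^{\rm new}:=\min\{\overline b[\omega_{\mathbf f}]^{\rm old},\max\{\underline b[\omega_{\mathbf f}]^{\rm old},[\omega_{\mathbf f}]^{\rm raw}\}\}$, modified as follows: if $\eta<\underline\eta$, $[\omega_{\mathbf f}]$ is increased at least by the factor $\hat b$ with respect to $[\omega_{\mathbf f}]^{\rm old}$; if $\eta\ge\hat\eta$, $[\omega_{\mathbf f}]$ is not increased. After acceptance, $x$ is replaced by $R_x(\delta x+\sigma\delta s)$. The sequence $x_k$ consists of the successive accepted iterates. *)

theory Defs
  imports "HOL-Analysis.Analysis"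
begin

section \<open>Hilbert manifolds of class C2\<close>

definition C2_open :: "'a::real_normed_vector set \<Rightarrow> ('a \<Rightarrow> 'b::real_normed_vector) \<Rightarrow> bool" where
  "C2_open W g \<longleftrightarrow> open W \<and>
     (\<exists>(g' :: 'a \<Rightarrow> 'a \<Rightarrow>\<^sub>L 'b) (g'' :: 'a \<Rightarrow> 'a \<Rightarrow>\<^sub>L 'a \<Rightarrow>\<^sub>L 'b).
        (\<forall>u\<in>W. (g has_derivative blinfun_apply (g' u)) (at u)) \<and>
        (\<forall>u\<in>W. (g' has_derivative blinfun_apply (g'' u)) (at u)) \<and>
        continuous_on W g'')"

type_synonym ('m, 'e) chart = "'m set \<times> ('m \<Rightarrow> 'e)"

definition chart_inv :: "('m, 'e) chart \<Rightarrow> 'e \<Rightarrow> 'm" where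
  "chart_inv K = inv_into (fst K) (snd K)"

definition C2_atlas :: "('m::topological_space, 'e::{real_inner, banach}) chart set \<Rightarrow> bool" where
  "C2_atlas A \<longleftrightarrow>
     (\<Union>K\<in>A. fst K) = UNIV \<and>
     (\<forall>K\<in>A. open (fst K) \<and> open (snd K ` fst K) \<and>
        homeomorphism (fst K) (snd K ` fst K) (snd K) (chart_inv K)) \<and>
     (\<forall>K\<in>A. \<forall>L\<in>A. C2_open (snd K ` (fst K \<inter> fst L)) (snd L \<circ> chart_inv K))"

text \<open>A Hilbert space, regarded as a manifold with a single chart.\<close>

definition std_atlas :: "('e, 'e) chart set" where
  "std_atlas = {(UNIV, id)}"

text \<open>
  Tangent spaces: every tangent vector at \<open>x\<close> has exactly one representative in the chart
  \<open>chart_at A x\<close>.  The tangent space at \<open>x\<close> is therefore represented by the model space,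
  a vector \<open>v\<close> of the model space standing for the tangent vector with that coordinate
  vector in the chart \<open>chart_at A x\<close>.
\<close>

definition chart_at :: "('m, 'e) chart set \<Rightarrow> 'm \<Rightarrow> ('m, 'e) chart" where
  "chart_at A x = (SOME K. K \<in> A \<and> x \<in> fst K)"

text \<open>The map \<open>D\<close> between the model spaces is the tangent map of \<open>g\<close> at \<open>x\<close>.\<close>

definition has_tangent_map ::
  "('m, 'e::real_normed_vector) chart set \<Rightarrow> ('n, 'h::real_normed_vector) chart set \<Rightarrow>
   ('m \<Rightarrow> 'n) \<Rightarrow> 'm \<Rightarrow> ('e \<Rightarrow> 'h) \<Rightarrow> bool" where
  "has_tangent_map A B g x D \<longleftrightarrow>
     ((snd (chart_at B (g x)) \<circ> g \<circ> chart_inv (chart_at A x)) has_derivative D)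
       (at (snd (chart_at A x) x))"

text \<open>
  As usual, a map on a set that need not be open is of class C2 if near each point of
  the set it extends to a C2 map on an open set.
\<close>

definition C2_map ::
  "('m::topological_space, 'e::real_normed_vector) chart set \<Rightarrow>
   ('n::topological_space, 'h::real_normed_vector) chart set \<Rightarrow> 'm set \<Rightarrow> ('m \<Rightarrow> 'n) \<Rightarrow> bool" where
  "C2_map A B S g \<longleftrightarrow>
     (\<forall>x\<in>S. \<exists>W h. open W \<and> x \<in> W \<and> (\<forall>u\<in>S \<inter> W. h u = g u) \<and> continuous_on W h \<and>
        (\<forall>K\<in>A. \<forall>L\<in>B.
           C2_open (snd K ` {u \<in> W \<inter> fst K. h u \<in> fst L}) (snd L \<circ> h \<circ> chart_inv K)))"

definition local_diffeo_on ::
  "('m::topological_space, 'e::real_normed_vector) chart set \<Rightarrow>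
   ('n::topological_space, 'h::real_normed_vector) chart set \<Rightarrow>
   'm set \<Rightarrow> ('m \<Rightarrow> 'n) \<Rightarrow> 'm \<Rightarrow> bool" where
  "local_diffeo_on A B N g a \<longleftrightarrow>
     a \<in> interior N \<and> g a \<in> interior (g ` N) \<and> inj_on g N \<and>
     C2_map A B N g \<and> C2_map B A (g ` N) (inv_into N g)"

text \<open>All local inverses of \<open>g\<close> at \<open>a\<close> agree near \<open>g a\<close>.\<close>

definition local_inverse ::
  "('m::topological_space, 'e::real_normed_vector) chart set \<Rightarrow>
   ('n::topological_space, 'h::real_normed_vector) chart set \<Rightarrow>
   ('m \<Rightarrow> 'n) \<Rightarrow> 'm \<Rightarrow> ('n \<Rightarrow> 'm) \<Rightarrow> bool" where
  "local_inverse A B g a h \<longleftrightarrow> (\<exists>N. local_diffeo_on A B N g a \<and> h = inv_into N g)"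

definition local_retraction ::
  "('m::topological_space, 'e::real_normed_vector) chart set \<Rightarrow> 'm \<Rightarrow> 'e set \<Rightarrow> ('e \<Rightarrow> 'm) \<Rightarrow> bool" where
  "local_retraction A x V r \<longleftrightarrow>
     0 \<in> interior V \<and> C2_map std_atlas A V r \<and> r 0 = x \<and>
     has_tangent_map std_atlas A r 0 (\<lambda>v. v)"

definition local_stratification ::
  "('m::topological_space, 'e::real_normed_vector) chart set \<Rightarrow> 'm \<Rightarrow> 'm set \<Rightarrow> ('m \<Rightarrow> 'e) \<Rightarrow> bool" where
  "local_stratification A y U s \<longleftrightarrow>
     y \<in> interior U \<and> C2_map A std_atlas U s \<and> s y = 0 \<and>
     has_tangent_map A std_atlas s y (\<lambda>v. v)"

text \<open>
  A scalar product inducing the given topology; completeness with respect to the induced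
  norm is then inherited from the model space.
\<close>

definition compatible_inner :: "('e::{real_inner, banach} \<Rightarrow> 'e \<Rightarrow> real) \<Rightarrow> bool" where
  "compatible_inner B \<longleftrightarrow> bounded_bilinear B \<and> (\<forall>v w. B v w = B w v) \<and>
     (\<exists>a>0. \<forall>v. a * (norm v)\<^sup>2 \<le> B v v)"

text \<open>
  First and second derivative.  For C2 maps \<open>D2 g u v w\<close> is the value of the second
  derivative at \<open>u\<close> in the pair \<open>(v, w)\<close>.
\<close>

definition D1 :: "('a::real_normed_vector \<Rightarrow> 'b::real_normed_vector) \<Rightarrow> 'a \<Rightarrow> 'a \<Rightarrow> 'b" where
  "D1 g u = frechet_derivative g (at u)"

definition D2 :: "('a::real_normed_vector \<Rightarrow> 'b::real_normed_vector) \<Rightarrow> 'a \<Rightarrow> 'a \<Rightarrow> 'a \<Rightarrow> 'b" where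
  "D2 g u v w = frechet_derivative (\<lambda>z. frechet_derivative g (at z) w) (at u) v"


section \<open>The problem and its pullbacks\<close>

text \<open>
  The suffix \<open>o\<close> marks the retractions and stratifications that carry a circle in the usual
  notation.  Stratifications are indexed by the point of the target manifold.
\<close>

record ('x, 'y, 'e, 'h) eq_problem =
  atlas_X :: "('x, 'e) chart set"
  atlas_Y :: "('y, 'h) chart set"
  ip :: "'x \<Rightarrow> 'e \<Rightarrow> 'e \<Rightarrow> real"
  cost :: "'x \<Rightarrow> real"
  constr :: "'x \<Rightarrow> 'y"
  target :: 'y
  retr_o :: "'x \<Rightarrow> 'e \<Rightarrow> 'x"
  retr :: "'x \<Rightarrow> 'e \<Rightarrow> 'x"
  retr_dom :: "'x \<Rightarrow> 'e set"
  retr_inv_dom :: "'x \<Rightarrow> 'e set"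
  strat_o :: "'y \<Rightarrow> 'y \<Rightarrow> 'h"
  strat :: "'y \<Rightarrow> 'y \<Rightarrow> 'h"

definition eq_setting ::
  "('x::topological_space, 'y::topological_space, 'e::{real_inner, banach}, 'h::{real_inner, banach})
     eq_problem \<Rightarrow> bool" where
  "eq_setting P \<longleftrightarrow>
     C2_atlas (atlas_X P) \<and> C2_atlas (atlas_Y P) \<and>
     C2_map (atlas_X P) std_atlas UNIV (cost P) \<and>
     C2_map (atlas_X P) (atlas_Y P) UNIV (constr P) \<and>
     (\<forall>x. compatible_inner (ip P x) \<and>
        (\<exists>W. local_retraction (atlas_X P) x W (retr_o P x)) \<and>
        local_retraction (atlas_X P) x (retr_dom P x) (retr P x) \<and>
        closed (retr_dom P x) \<and>
        retr_inv_dom P x \<subseteq> retr_dom P x \<and>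
        local_diffeo_on std_atlas (atlas_X P) (retr_inv_dom P x) (retr P x) 0 \<and>
        (\<exists>W. local_stratification (atlas_Y P) (constr P x) W (strat_o P (constr P x))) \<and>
        local_stratification (atlas_Y P) (constr P x) UNIV (strat P (constr P x)))"

definition nrm :: "('x, 'y, 'e, 'h) eq_problem \<Rightarrow> 'x \<Rightarrow> 'e \<Rightarrow> real" where
  "nrm P x v = sqrt (ip P x v v)"

text \<open>The vector \<open>v = 0\<close> contributes the quotient \<open>0 / 0 = 0\<close>, which does not alter the supremum.\<close>

definition dual_nrm :: "('x, 'y, 'e, 'h) eq_problem \<Rightarrow> 'x \<Rightarrow> ('e \<Rightarrow> real) \<Rightarrow> real" where
  "dual_nrm P x l = (SUP v. l v / nrm P x v)"

definition rinv :: "('x, 'y, 'e, 'h) eq_problem \<Rightarrow> 'x \<Rightarrow> 'x \<Rightarrow> 'e" where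
  "rinv P x = inv_into (retr_inv_dom P x) (retr P x)"

definition pull_f :: "('x, 'y, 'e, 'h) eq_problem \<Rightarrow> 'x \<Rightarrow> 'e \<Rightarrow> real" where
  "pull_f P x v = cost P (retr P x v)"

definition pull_c :: "('x, 'y, 'e, 'h::real_normed_vector) eq_problem \<Rightarrow> 'x \<Rightarrow> 'e \<Rightarrow> 'h" where
  "pull_c P x v =
     strat P (constr P x) (constr P (retr P x v)) - strat P (constr P x) (target P)"

definition pull_L ::
  "('x, 'y, 'e, 'h::real_normed_vector) eq_problem \<Rightarrow> 'x \<Rightarrow> ('h \<Rightarrow> real) \<Rightarrow> 'e \<Rightarrow> real" where
  "pull_L P x p v = pull_f P x v + p (pull_c P x v)"

text \<open>
  The target need not lie in the domain of \<open>strat_o P (constr P x)\<close>; this only affects an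
  additive constant, and only derivatives of \<open>pull_Lo\<close> are used.
\<close>

definition pull_Lo ::
  "('x, 'y, 'e, 'h::real_normed_vector) eq_problem \<Rightarrow> 'x \<Rightarrow> ('h \<Rightarrow> real) \<Rightarrow> 'e \<Rightarrow> real" where
  "pull_Lo P x p v = cost P (retr_o P x v) +
     p (strat_o P (constr P x) (constr P (retr_o P x v)) - strat_o P (constr P x) (target P))"

definition df :: "('x, 'y, 'e::real_normed_vector, 'h) eq_problem \<Rightarrow> 'x \<Rightarrow> 'e \<Rightarrow> real" where
  "df P x = D1 (pull_f P x) 0"

definition dc ::
  "('x, 'y, 'e::real_normed_vector, 'h::real_normed_vector) eq_problem \<Rightarrow> 'x \<Rightarrow> 'e \<Rightarrow> 'h" where
  "dc P x = D1 (pull_c P x) 0"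

definition pseudo_inv ::
  "('x, 'y, 'e, 'h::real_normed_vector) eq_problem \<Rightarrow> 'x \<Rightarrow> ('e \<Rightarrow> 'h) \<Rightarrow> 'h \<Rightarrow> 'e" where
  "pseudo_inv P x A w = (THE v. A v = w \<and> (\<forall>u. A u = 0 \<longrightarrow> ip P x v u = 0))"

definition multiplier ::
  "('x, 'y, 'e::real_normed_vector, 'h::real_normed_vector) eq_problem \<Rightarrow> 'x \<Rightarrow> 'h \<Rightarrow> real" where
  "multiplier P x w = - df P x (pseudo_inv P x (dc P x) w)"

definition dL ::
  "('x, 'y, 'e::real_normed_vector, 'h::real_normed_vector) eq_problem \<Rightarrow>
   'x \<Rightarrow> ('h \<Rightarrow> real) \<Rightarrow> 'e \<Rightarrow> real" where
  "dL P x p v = df P x v + p (dc P x v)"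

definition hess_o ::
  "('x, 'y, 'e::real_normed_vector, 'h::real_normed_vector) eq_problem \<Rightarrow> 'x \<Rightarrow> 'e \<Rightarrow> 'e \<Rightarrow> real" where
  "hess_o P x = D2 (pull_Lo P x (multiplier P x)) 0"

definition retr_transition ::
  "('x::topological_space, 'y, 'e::real_normed_vector, 'h) eq_problem \<Rightarrow> 'x \<Rightarrow> ('e \<Rightarrow> 'e) \<Rightarrow> bool" where
  "retr_transition P x \<Phi> \<longleftrightarrow>
     (\<exists>h. local_inverse std_atlas (atlas_X P) (retr_o P x) 0 h \<and> \<Phi> = h \<circ> retr P x)"

definition strat_transition ::
  "('x, 'y::topological_space, 'e, 'h::real_normed_vector) eq_problem \<Rightarrow> 'y \<Rightarrow> ('h \<Rightarrow> 'h) \<Rightarrow> bool" where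
  "strat_transition P y \<Psi> \<longleftrightarrow>
     (\<exists>h. local_inverse (atlas_Y P) std_atlas (strat_o P y) y h \<and> \<Psi> = strat P y \<circ> h)"

definition second_order_consistent ::
  "('x, 'y::topological_space, 'e, 'h::real_normed_vector) eq_problem \<Rightarrow> 'y \<Rightarrow> bool" where
  "second_order_consistent P y \<longleftrightarrow>
     (\<exists>\<Psi>. strat_transition P y \<Psi> \<and> (\<forall>v w. D2 \<Psi> 0 v w = 0))"

definition local_minimizer ::
  "('x::topological_space, 'y, 'e, 'h) eq_problem \<Rightarrow> 'x \<Rightarrow> bool" where
  "local_minimizer P z \<longleftrightarrow> constr P z = target P \<and>
     (\<forall>\<^sub>F x in nhds z. constr P x = target P \<longrightarrow> cost P z \<le> cost P x)"


section \<open>Assumptions\<close>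

definition non_degenerate ::
  "('x::topological_space, 'y, 'e::real_normed_vector, 'h) eq_problem \<Rightarrow> 'x set \<Rightarrow> bool" where
  "non_degenerate P U \<longleftrightarrow>
     (\<exists>Q \<rho> \<gamma>. open Q \<and> U \<subseteq> Q \<and>
        (\<forall>x\<in>Q. Q \<subseteq> retr P x ` retr_inv_dom P x) \<and>
        \<rho> > 0 \<and>
        (\<forall>x\<in>U. \<forall>v. nrm P x v < \<rho> \<longrightarrow> v \<in> retr_dom P x \<and> retr P x v \<in> Q) \<and>
        (\<forall>x1\<in>U. \<forall>x2\<in>U. \<forall>v w. nrm P x1 v < \<rho> \<longrightarrow> nrm P x1 w < \<rho> \<longrightarrow>
           nrm P x2 (rinv P x2 (retr P x1 v) - rinv P x2 (retr P x1 w)) \<le> \<gamma> * nrm P x1 (v - w)))"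

text \<open>
  Derivatives of the pullbacks are only taken at interior points of the domain of the
  retraction, where they are unambiguous.
\<close>

definition assumption_A ::
  "('x::topological_space, 'y, 'e::real_normed_vector, 'h::real_normed_vector) eq_problem \<Rightarrow>
   'x \<Rightarrow> 'x set \<Rightarrow> bool" where
  "assumption_A P z U \<longleftrightarrow> non_degenerate P U \<and>
     (\<exists>\<rho>0 \<omega>f \<omega>c \<omega>cs. \<rho>0 > 0 \<and>
       (\<forall>x\<in>U.
          (\<forall>d\<in>interior (retr_dom P x). nrm P x d \<le> \<rho>0 \<longrightarrow>
             dual_nrm P x (\<lambda>v. D1 (pull_f P x) d v - df P x v) \<le> \<omega>f * nrm P x d) \<and>
          surj (dc P x) \<and>
          (\<forall>d\<in>interior (retr_dom P x). \<forall>v. nrm P x d \<le> \<rho>0 \<longrightarrow>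
             nrm P x (pseudo_inv P x (dc P x) (D1 (pull_c P x) d v - dc P x v))
               \<le> \<omega>c * nrm P x d * nrm P x v) \<and>
          (rinv P x z \<in> interior (retr_dom P x) \<longrightarrow>
             surj (D1 (pull_c P x) (rinv P x z)) \<and>
             (\<forall>v. nrm P x (pseudo_inv P x (D1 (pull_c P x) (rinv P x z))
                     (D1 (pull_c P x) (rinv P x z) v - dc P x v))
                \<le> \<omega>cs * nrm P x (rinv P x z - 0) * nrm P x v))))"

definition assumption_B ::
  "('x::topological_space, 'y, 'e::real_normed_vector, 'h::real_normed_vector) eq_problem \<Rightarrow>
   'x set \<Rightarrow> bool" where
  "assumption_B P U \<longleftrightarrow> non_degenerate P U \<and>
     (\<exists>\<rho>0 \<omega>L \<alpha> ML M\<Phi>. \<rho>0 > 0 \<and> \<alpha> > 0 \<and>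
       (\<forall>x\<in>U.
          (\<forall>d\<in>interior (retr_dom P x). \<forall>v w. nrm P x d \<le> \<rho>0 \<longrightarrow>
             \<bar>D2 (pull_L P x (multiplier P x)) d v w - D2 (pull_L P x (multiplier P x)) 0 v w\<bar>
               \<le> \<omega>L * nrm P x d * nrm P x v * nrm P x w) \<and>
          (\<forall>v. dc P x v = 0 \<longrightarrow> hess_o P x v v \<ge> \<alpha> * (nrm P x v)\<^sup>2) \<and>
          (\<forall>v w. \<bar>hess_o P x v w\<bar> \<le> ML * nrm P x v * nrm P x w) \<and>
          (\<exists>\<Phi>. retr_transition P x \<Phi> \<and>
             (\<forall>v w. nrm P x (D2 \<Phi> 0 v w) \<le> M\<Phi> * nrm P x v * nrm P x w))))"


section \<open>The composite step method\<close>

record cs_params =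
  theta_aim :: real
  rho_ellbow :: real
  theta_acc :: real
  eta_low :: real
  eta_hat :: real
  b_low :: real
  b_up :: real
  b_hat :: real

definition valid_params :: "cs_params \<Rightarrow> bool" where
  "valid_params q \<longleftrightarrow>
     0 < theta_aim q \<and> theta_aim q < 1 \<and> 0 < rho_ellbow q \<and> rho_ellbow q \<le> 1 \<and>
     theta_aim q < theta_acc q \<and> theta_acc q < 1 \<and>
     0 < eta_low q \<and> eta_low q < 1 \<and> eta_low q \<le> eta_hat q \<and> eta_hat q < 1 \<and>
     0 < b_low q \<and> b_low q < 1 \<and> 1 < b_up q \<and> 1 < b_hat q \<and> b_hat q \<le> b_up q"

definition q_o ::
  "('x, 'y, 'e::real_normed_vector, 'h::real_normed_vector) eq_problem \<Rightarrow> 'x \<Rightarrow> 'e \<Rightarrow> real" where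
  "q_o P x d = pull_f P x 0 + df P x d + hess_o P x d d / 2"

definition q_tilde ::
  "('x, 'y, 'e::real_normed_vector, 'h::real_normed_vector) eq_problem \<Rightarrow>
   'x \<Rightarrow> real \<Rightarrow> 'e \<Rightarrow> 'e \<Rightarrow> real" where
  "q_tilde P x \<nu> dn dt =
     pull_L P x (multiplier P x) dn - (1 - \<nu>) * multiplier P x (pull_c P x 0) +
     (df P x dt + hess_o P x dn dt) + hess_o P x dt dt / 2"

text \<open>
  The models are functions of \<open>dn + dt\<close>, given by its normal part \<open>dn\<close> and its tangential
  part \<open>dt\<close>.
\<close>

definition q_hat ::
  "('x, 'y::topological_space, 'e::real_normed_vector, 'h::real_normed_vector) eq_problem \<Rightarrow>
   'x \<Rightarrow> real \<Rightarrow> 'e \<Rightarrow> 'e \<Rightarrow> real" where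
  "q_hat P x \<nu> dn dt =
     (if second_order_consistent P (constr P x) then q_o P x (dn + dt) else q_tilde P x \<nu> dn dt)"

definition cubic_model ::
  "('x, 'y::topological_space, 'e::real_normed_vector, 'h::real_normed_vector) eq_problem \<Rightarrow>
   'x \<Rightarrow> real \<Rightarrow> real \<Rightarrow> 'e \<Rightarrow> 'e \<Rightarrow> real" where
  "cubic_model P x \<omega>f \<nu> dn dt = q_hat P x \<nu> dn dt + \<omega>f / 6 * nrm P x (dn + dt) ^ 3"

definition greatest_in :: "real set \<Rightarrow> real \<Rightarrow> bool" where
  "greatest_in S s \<longleftrightarrow> s \<in> S \<and> (\<forall>t\<in>S. t \<le> s)"

definition full_normal_step ::
  "('x, 'y, 'e::real_normed_vector, 'h::real_normed_vector) eq_problem \<Rightarrow> 'x \<Rightarrow> 'e" where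
  "full_normal_step P x = - pseudo_inv P x (dc P x) (pull_c P x 0)"

definition damping_factor ::
  "('x, 'y, 'e::real_normed_vector, 'h::real_normed_vector) eq_problem \<Rightarrow> cs_params \<Rightarrow>
   'x \<Rightarrow> real \<Rightarrow> real \<Rightarrow> bool" where
  "damping_factor P q x \<omega>c \<nu> \<longleftrightarrow>
     greatest_in {s. 0 < s \<and> s \<le> 1 \<and>
        \<omega>c / 2 * nrm P x (s *\<^sub>R full_normal_step P x) \<le> rho_ellbow q * theta_aim q \<and>
        s *\<^sub>R full_normal_step P x \<in> retr_dom P x} \<nu>"

definition elliptic_on_kernel ::
  "('x, 'y, 'e::real_normed_vector, 'h::real_normed_vector) eq_problem \<Rightarrow> 'x \<Rightarrow> bool" where
  "elliptic_on_kernel P x \<longleftrightarrow>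
     (\<exists>a>0. \<forall>v. dc P x v = 0 \<longrightarrow> hess_o P x v v \<ge> a * (nrm P x v)\<^sup>2)"

text \<open>
  If the Hessian is not elliptic on the kernel, the modification of the tangent step is not
  specified: every kernel element is admitted.
\<close>

definition tangent_step ::
  "('x, 'y, 'e::real_normed_vector, 'h::real_normed_vector) eq_problem \<Rightarrow> 'x \<Rightarrow> 'e \<Rightarrow> 'e \<Rightarrow> bool" where
  "tangent_step P x dn Dt \<longleftrightarrow>
     dc P x Dt = 0 \<and>
     (elliptic_on_kernel P x \<longrightarrow>
        (\<exists>Dp :: 'h \<Rightarrow> real. bounded_linear Dp \<and>
           (\<forall>w. hess_o P x Dt w + Dp (dc P x w) + dL P x (multiplier P x) w + hess_o P x dn w = 0)))"

definition step_lengths ::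
  "('x, 'y, 'e::real_normed_vector, 'h::real_normed_vector) eq_problem \<Rightarrow> cs_params \<Rightarrow>
   'x \<Rightarrow> real \<Rightarrow> real \<Rightarrow> 'e \<Rightarrow> 'e \<Rightarrow> real set" where
  "step_lengths P q x \<omega>c \<nu> dn Dt =
     {\<tau>. \<nu> *\<^sub>R pull_c P x 0 + dc P x (dn + \<tau> *\<^sub>R Dt) = 0 \<and>
         \<omega>c / 2 * nrm P x (dn + \<tau> *\<^sub>R Dt) \<le> theta_aim q \<and>
         dn + \<tau> *\<^sub>R Dt \<in> retr_dom P x}"

definition step_length ::
  "('x, 'y, 'e::real_normed_vector, 'h::real_normed_vector) eq_problem \<Rightarrow> cs_params \<Rightarrow>
   'x \<Rightarrow> real \<Rightarrow> real \<Rightarrow> real \<Rightarrow> 'e \<Rightarrow> 'e \<Rightarrow> real \<Rightarrow> bool" where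
  "step_length P q x \<omega>c \<omega>f \<nu> dn Dt \<tau> \<longleftrightarrow>
     (let J = (\<lambda>s. q_o P x (dn + s *\<^sub>R Dt) + \<omega>f / 6 * nrm P x (dn + s *\<^sub>R Dt) ^ 3)
      in \<tau> \<in> step_lengths P q x \<omega>c \<nu> dn Dt \<and>
         (\<forall>s\<in>step_lengths P q x \<omega>c \<nu> dn Dt. J \<tau> \<le> J s))"

definition correction ::
  "('x, 'y, 'e::real_normed_vector, 'h::real_normed_vector) eq_problem \<Rightarrow> 'x \<Rightarrow> 'e \<Rightarrow> 'e" where
  "correction P x dx =
     - pseudo_inv P x (dc P x) (pull_c P x dx - pull_c P x 0 - dc P x dx)"

text \<open>
  The clipped value of the raw estimate is overridden after a poor step (increase by at
  least the factor \<open>b_hat\<close>, within the bound given by \<open>b_up\<close>) and after a good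
  step (no increase).
\<close>

definition update_\<omega>f :: "cs_params \<Rightarrow> real \<Rightarrow> real \<Rightarrow> real \<Rightarrow> real \<Rightarrow> bool" where
  "update_\<omega>f q \<eta> raw old new \<longleftrightarrow>
     (let clipped = min (b_up q * old) (max (b_low q * old) raw)
      in if \<eta> < eta_low q then b_hat q * old \<le> new \<and> clipped \<le> new \<and> new \<le> b_up q * old
         else if \<eta> \<ge> eta_hat q then new = min old clipped
         else new = clipped)"

text \<open>
  The state consists of the iterate and the two algorithmic quantities.
  \<open>cs_trial P q acc s s'\<close> describes one trial step, \<open>acc\<close> telling whether it is accepted.
  Since \<open>a / 0 = 0\<close>, a step whose predicted decrease vanishes is rejected.
\<close>

type_synonym 'x cs_state = "'x \<times> real \<times> real"

definition cs_trial ::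
  "('x, 'y::topological_space, 'e::real_normed_vector, 'h::real_normed_vector) eq_problem \<Rightarrow>
   cs_params \<Rightarrow> bool \<Rightarrow> 'x cs_state \<Rightarrow> 'x cs_state \<Rightarrow> bool" where
  "cs_trial P q acc = (\<lambda>(x, \<omega>c, \<omega>f) (x', \<omega>c', \<omega>f').
     surj (dc P x) \<and>
     (\<exists>\<nu> dn Dt \<tau> dt dx ds \<sigma> \<eta> raw.
        damping_factor P q x \<omega>c \<nu> \<and>
        dn = \<nu> *\<^sub>R full_normal_step P x \<and>
        tangent_step P x dn Dt \<and>
        step_length P q x \<omega>c \<omega>f \<nu> dn Dt \<tau> \<and>
        dt = \<tau> *\<^sub>R Dt \<and>
        dx = dn + dt \<and>
        ds = correction P x dx \<and>
        greatest_in {s. 0 \<le> s \<and> s \<le> 1 \<and> dx + s *\<^sub>R ds \<in> retr_dom P x} \<sigma> \<and>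
        \<eta> = (pull_f P x (dx + \<sigma> *\<^sub>R ds) - cubic_model P x \<omega>f \<nu> dn 0) /
            (cubic_model P x \<omega>f \<nu> dn dt - cubic_model P x \<omega>f \<nu> dn 0) \<and>
        (acc \<longleftrightarrow> nrm P x ds / nrm P x dx \<le> theta_acc q \<and> \<eta> \<ge> eta_low q) \<and>
        \<omega>c' = 2 * nrm P x ds / (nrm P x dx)\<^sup>2 \<and>
        raw = 6 / nrm P x dx ^ 3 * (pull_f P x (dx + \<sigma> *\<^sub>R ds) - q_hat P x \<nu> dn dt) \<and>
        update_\<omega>f q \<eta> raw \<omega>f \<omega>f' \<and>
        x' = (if acc then retr P x (dx + \<sigma> *\<^sub>R ds) else x)))"

text \<open>
  From each iterate to the next one, finitely many rejected trial steps are followed by an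
  accepted one.
\<close>

definition composite_step_sequence ::
  "('x, 'y::topological_space, 'e::real_normed_vector, 'h::real_normed_vector) eq_problem \<Rightarrow>
   cs_params \<Rightarrow> (nat \<Rightarrow> 'x) \<Rightarrow> bool" where
  "composite_step_sequence P q xs \<longleftrightarrow>
     (\<exists>\<omega>c \<omega>f. \<omega>c 0 > 0 \<and> \<omega>f 0 > 0 \<and>
        (\<forall>k. ((cs_trial P q False)\<^sup>*\<^sup>* OO cs_trial P q True)
               (xs k, \<omega>c k, \<omega>f k) (xs (Suc k), \<omega>c (Suc k), \<omega>f (Suc k))))"

end

theory Submission
  imports Defs
begin

text \<open>
  In the coordinates of the retraction at an iterate \<open>x\<close>, write \<open>xs\<close> for the solution.
  Criticality of the solution and the Lipschitz bounds on the pullbacks show that the full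
  step \<open>\<Delta>n + \<Delta>t\<close> misses \<open>xs\<close> by \<open>O(\<parallel>xs\<parallel>\<^sup>2)\<close>.  Every trial step makes the estimate of
  \<open>\<omega>c\<close> bounded, so eventually the normal step is not damped and the step size constraints
  are inactive.  Minimality of \<open>\<tau>\<close> along the line then gives \<open>1 - \<tau> = O(\<omega>f \<parallel>dx\<parallel>)\<close>.  The model
  error is \<open>O(\<parallel>dx\<parallel>\<^sup>3)\<close> up to a term of size \<open>\<parallel>f'\<bar>ker c'\<parallel> \<parallel>dx\<parallel>\<^sup>2\<close>, which is \<open>O(\<parallel>dx\<parallel>\<^sup>3 (1 + \<omega>f \<parallel>dx\<parallel>))\<close>
  by the estimate of \<open>\<tau>\<close>; hence a large \<open>\<omega>f\<close> is never increased and \<open>\<omega>f\<close> stays bounded.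
  So the accepted step, including the second order correction, also misses \<open>xs\<close> by
  \<open>O(\<parallel>xs\<parallel>\<^sup>2)\<close>, and the Lipschitz continuity of the coordinate changes carries this
  over to the coordinates at the limit.
\<close>


section \<open>Twice differentiable maps\<close>

text \<open>The norms need not vary continuously with the point, so every iterate is studied in its
  own coordinates, and only the Lipschitz bound for coordinate changes relates two points. The
  Hessian of the method belongs to the circled retraction and stratification. Its discrepancy with
  the Hessian of the actual pullback has two sources. The retractions contribute L'(0,p) applied to
  \<Phi>'', and L'(0,p) sees only the tangential part of f', which is small near the solution. The
  stratifications contribute only on pairs of normal vectors, the block that \<open>q_tilde\<close>
  replaces by an exact value at the normal step. Bounding \<omega>f looks circular, because the
  tangential part of f' is controlled through the step length and hence through \<omega>f itself.
  The loop closes since \<omega>f enters the raw estimate with a factor proportional to the step,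
  which is below 1/2 near the solution. A zero tangent step makes the quotient for \<eta> degenerate
  and has to be excluded separately: it is never accepted.\<close>

definition twice_diff :: "('a::real_normed_vector \<Rightarrow> 'b::real_normed_vector) \<Rightarrow> 'a \<Rightarrow> bool" where
  "twice_diff g u \<longleftrightarrow>
     (\<exists>g' :: 'a \<Rightarrow> 'a \<Rightarrow>\<^sub>L 'b. (\<forall>\<^sub>F z in nhds u. (g has_derivative blinfun_apply (g' z)) (at z)) \<and>
        g' differentiable (at u))"

lemma D1_eq: "(g has_derivative g') (at u) \<Longrightarrow> D1 g u = g'"
  unfolding D1_def by (metis frechet_derivative_at)

text \<open>\<open>D2\<close> differentiates \<open>D1 g z w\<close> with \<open>w\<close> held
  fixed, whereas \<open>twice_diff\<close> differentiates the operator \<open>g' z\<close>.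
  Evaluation at \<open>w\<close> is bounded linear on operators, so both give the same
  values.\<close>

lemma twice_diffE:
  assumes "twice_diff g u"
  obtains g' g'' where "\<forall>\<^sub>F z in nhds u. (g has_derivative blinfun_apply (g' z)) (at z)"
    "(g' has_derivative blinfun_apply g'') (at u)" "g' u = Blinfun (D1 g u)"
    "\<forall>\<^sub>F z in nhds u. D1 g z = blinfun_apply (g' z)"
    "\<And>v w. D2 g u v w = g'' v w"
proof -
  obtain g' where 1: "\<forall>\<^sub>F z in nhds u. (g has_derivative blinfun_apply (g' z)) (at z)"
    and "g' differentiable (at u)"
    using assms unfolding twice_diff_def by blast
  then obtain G where "(g' has_derivative G) (at u)" unfolding differentiable_def by blast
  then obtain g'' where 2: "(g' has_derivative blinfun_apply g'') (at u)"
    by (metis bounded_linear_Blinfun_apply has_derivative_bounded_linear)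
  have 3: "\<forall>\<^sub>F z in nhds u. D1 g z = blinfun_apply (g' z)"
    using 1 by eventually_elim (rule D1_eq)
  have 4: "D2 g u v w = g'' v w" for v w
  proof -
    have "((\<lambda>z. g' z w) has_derivative (\<lambda>v. g'' v w)) (at u)"
      using bounded_linear.has_derivative[OF blinfun.bounded_linear_left 2] by simp
    then have "((\<lambda>z. frechet_derivative g (at z) w) has_derivative (\<lambda>v. g'' v w)) (at u)"
      by (rule has_derivative_transform_eventually)
         (use 3 eventually_nhds_x_imp_x[OF 3] in
           \<open>auto simp: D1_def eventually_at_filter elim!: eventually_mono\<close>)
    then show ?thesis unfolding D2_def by (metis frechet_derivative_at)
  qed
  have "g' u = Blinfun (D1 g u)"
    using eventually_nhds_x_imp_x[OF 3] by (simp add: blinfun_apply_inverse)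
  then show thesis using that 1 2 3 4 by blast
qed

lemma twice_diff_has_derivative:
  assumes "twice_diff g u"
  shows "(g has_derivative D1 g u) (at u)"
proof -
  obtain g' where 1: "\<forall>\<^sub>F z in nhds u. (g has_derivative blinfun_apply (g' z)) (at z)"
    using assms unfolding twice_diff_def by blast
  then show ?thesis using D1_eq eventually_nhds_x_imp_x[OF 1] by metis
qed

lemma twice_diff_bounded_linear_D1: "twice_diff g u \<Longrightarrow> bounded_linear (D1 g u)"
  using twice_diff_has_derivative has_derivative_bounded_linear by blast

lemma twice_diff_isCont: "twice_diff g u \<Longrightarrow> isCont g u"
  using twice_diff_has_derivative has_derivative_continuous by blast

lemma twice_diff_D1_has_derivative:
  assumes "twice_diff g u"
  shows "((\<lambda>z. D1 g z w) has_derivative (\<lambda>v. D2 g u v w)) (at u)"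
proof -
  obtain g' g'' where g: "(g' has_derivative blinfun_apply g'') (at u)"
    and 3: "\<forall>\<^sub>F z in nhds u. D1 g z = blinfun_apply (g' z)"
    and 4: "\<And>v w. D2 g u v w = g'' v w"
    using assms by (elim twice_diffE) blast
  have "((\<lambda>z. g' z w) has_derivative (\<lambda>v. g'' v w)) (at u)"
    using bounded_linear.has_derivative[OF blinfun.bounded_linear_left g] by simp
  then show ?thesis unfolding 4
    by (rule has_derivative_transform_eventually)
       (use 3 eventually_nhds_x_imp_x[OF 3] in
         \<open>auto simp: eventually_at_filter elim!: eventually_mono\<close>)
qed

lemma twice_diff_bounded_bilinear_D2:
  assumes "twice_diff g u"
  shows "bounded_bilinear (D2 g u)"
proof -
  obtain g'' :: "'a \<Rightarrow>\<^sub>L 'a \<Rightarrow>\<^sub>L 'b" where "\<And>v w. D2 g u v w = g'' v w"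
    using assms by (elim twice_diffE) blast
  then have *: "D2 g u = (\<lambda>v w. g'' v w)" by (intro ext) auto
  show ?thesis unfolding *
    by (rule bounded_bilinear.comp1[OF bounded_bilinear_blinfun_apply])
       (rule blinfun.bounded_linear_right)
qed

text \<open>Differentiability of the operator valued derivative at \<open>u\<close> gives its
  continuity there. The vectorwise form is what the contraction in
  \<open>constrained_local_minimum\<close> and the paths in \<open>D1_bounded_along_path\<close>
  consume.\<close>

lemma twice_diff_continuous_D1:
  assumes "twice_diff g u" "e > 0"
  obtains \<delta> where "\<delta> > 0" "\<And>z v. dist z u < \<delta> \<Longrightarrow> (g has_derivative D1 g z) (at z)"
    "\<And>z v. dist z u < \<delta> \<Longrightarrow> norm (D1 g z v - D1 g u v) \<le> e * norm v"
proof -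
  obtain g' g'' where g: "\<forall>\<^sub>F z in nhds u. (g has_derivative blinfun_apply (g' z)) (at z)"
     "(g' has_derivative blinfun_apply g'') (at u)"
    and 3: "\<forall>\<^sub>F z in nhds u. D1 g z = blinfun_apply (g' z)"
    using assms by (elim twice_diffE) blast
  have "isCont g' u" using g(2) has_derivative_continuous by blast
  then have "(g' \<longlongrightarrow> g' u) (nhds u)" by (simp add: isCont_def tendsto_at_iff_tendsto_nhds)
  then have "\<forall>\<^sub>F z in nhds u. dist (g' z) (g' u) < e" using \<open>e > 0\<close> tendstoD by blast
  then have "\<forall>\<^sub>F z in nhds u. (g has_derivative D1 g z) (at z) \<and> (\<forall>v. norm (D1 g z v - D1 g u v) \<le> e * norm v)"
    using g(1) 3
  proof eventually_elim
    case (elim z)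
    have "D1 g u = g' u" using eventually_nhds_x_imp_x[OF 3] .
    then have "norm (D1 g z v - D1 g u v) \<le> e * norm v" for v
      using norm_blinfun[of "g' z - g' u" v] elim(1,3) mult_right_mono[of "dist (g' z) (g' u)" e "norm v"]
      by (simp add: blinfun.diff_left dist_norm) 
    then show ?case using elim by auto
  qed
  then show thesis using that unfolding eventually_nhds_metric by metis
qed

lemma twice_diff_eventually_differentiable:
  assumes "twice_diff g u"
  shows "\<forall>\<^sub>F z in nhds u. (g has_derivative D1 g z) (at z)"
  using assms unfolding twice_diff_def by (auto elim!: eventually_mono simp: D1_eq)

lemma eventually_eq_has_derivative:
  assumes "\<forall>\<^sub>F z in nhds u. f z = g z" "(f has_derivative D) (at u)"
  shows "(g has_derivative D) (at u)"
  using assms(2)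
  by (rule has_derivative_transform_eventually)
     (use assms(1) eventually_nhds_x_imp_x[OF assms(1)] in
       \<open>auto simp: eventually_at_filter elim!: eventually_mono\<close>)

text \<open>Both functions have the same derivatives at \<open>u\<close>, so the choice operator in
  \<open>frechet_derivative\<close> picks the same map, whether or not a derivative exists.\<close>

lemma D1_cong:
  assumes "\<forall>\<^sub>F z in nhds u. f z = g z"
  shows "D1 f u = D1 g u"
proof -
  have "(f has_derivative D) (at u) \<longleftrightarrow> (g has_derivative D) (at u)" for D
    using eventually_eq_has_derivative assms eventually_mono[OF assms, of "\<lambda>z. g z = f z"] by metis
  then show ?thesis unfolding D1_def frechet_derivative_def by simp
qed

lemma D1_cong_eventually:
  assumes "\<forall>\<^sub>F z in nhds u. f z = g z"
  shows "\<forall>\<^sub>F z in nhds u. D1 f z = D1 g z"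
proof -
  have "\<forall>\<^sub>F z in nhds u. (\<forall>\<^sub>F z in nhds z. f z = g z)"
    using assms by (simp add: eventually_eventually)
  then show ?thesis by eventually_elim (rule D1_cong)
qed

lemma D2_cong:
  assumes "\<forall>\<^sub>F z in nhds u. f z = g z"
  shows "D2 f u = D2 g u"
proof (intro ext)
  fix v w
  have "\<forall>\<^sub>F z in nhds u. (\<lambda>z. D1 f z w) z = (\<lambda>z. D1 g z w) z"
    using D1_cong_eventually[OF assms] by (auto elim: eventually_mono)
  from D1_cong[OF this] show "D2 f u v w = D2 g u v w" by (simp add: D1_def D2_def)
qed

lemma twice_diff_cong:
  assumes "\<forall>\<^sub>F z in nhds u. f z = g z" "twice_diff f u"
  shows "twice_diff g u"
proof -
  obtain f' where f': "\<forall>\<^sub>F z in nhds u. (f has_derivative blinfun_apply (f' z)) (at z)"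
    "f' differentiable (at u)"
    using assms unfolding twice_diff_def by blast
  have "\<forall>\<^sub>F z in nhds u. (\<forall>\<^sub>F z in nhds z. f z = g z)" using assms(1) by (simp add: eventually_eventually)
  then have "\<forall>\<^sub>F z in nhds u. (g has_derivative blinfun_apply (f' z)) (at z)"
    using f'(1) by eventually_elim (rule eventually_eq_has_derivative)
  then show ?thesis using f'(2) unfolding twice_diff_def by blast
qed

text \<open>Passing to the pointwise notion here frees all later chain rules from tracking open
  domains: they are applied at a single point of a chart.\<close>

lemma C2_open_twice_diff:
  assumes "C2_open W g" "u \<in> W"
  shows "twice_diff g u"
proof -
  obtain g' g'' where g: "\<And>u. u \<in> W \<Longrightarrow> (g has_derivative blinfun_apply (g' u)) (at u)"
    "\<And>u. u \<in> W \<Longrightarrow> (g' has_derivative blinfun_apply (g'' u)) (at u)" and "open W"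
    using assms(1) unfolding C2_open_def by blast
  then have "\<forall>\<^sub>F z in nhds u. z \<in> W" using assms(2) eventually_nhds_in_open by blast
  then have "\<forall>\<^sub>F z in nhds u. (g has_derivative blinfun_apply (g' z)) (at z)"
    by (rule eventually_mono) (rule g)
  then show ?thesis using g(2)[OF assms(2)] unfolding twice_diff_def differentiable_def by blast
qed

lemma D1_compose:
  assumes "twice_diff g u" "twice_diff h (g u)"
  shows "D1 (h \<circ> g) u v = D1 h (g u) (D1 g u v)"
  using D1_eq[OF diff_chain_at[OF twice_diff_has_derivative[OF assms(1)] twice_diff_has_derivative[OF assms(2)]]]
  by simp

text \<open>The derivative of the composite is the operator product \<open>k z\<close> of two
  operator valued maps, so the second order formula is the product rule for composition of bounded
  operators.\<close>

lemma
  assumes "twice_diff g u" "twice_diff h (g u)"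
  shows twice_diff_compose: "twice_diff (h \<circ> g) u"
    and D2_compose: "D2 (h \<circ> g) u v w =
      D2 h (g u) (D1 g u v) (D1 g u w) + D1 h (g u) (D2 g u v w)"
proof -
  obtain g' g'' where g: "\<forall>\<^sub>F z in nhds u. (g has_derivative blinfun_apply (g' z)) (at z)"
     "(g' has_derivative blinfun_apply g'') (at u)" "g' u = Blinfun (D1 g u)"
     "\<And>v w. D2 g u v w = g'' v w"
    using assms(1) by (elim twice_diffE) blast
  obtain h' h'' where h: "\<forall>\<^sub>F z in nhds (g u). (h has_derivative blinfun_apply (h' z)) (at z)"
     "(h' has_derivative blinfun_apply h'') (at (g u))" "h' (g u) = Blinfun (D1 h (g u))"
     "\<And>v w. D2 h (g u) v w = h'' v w"
    using assms(2) by (elim twice_diffE) blast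
  have Dg: "blinfun_apply (g' u) = D1 g u" "blinfun_apply (h' (g u)) = D1 h (g u)"
    by (simp_all add: g(3) h(3) bounded_linear_Blinfun_apply twice_diff_bounded_linear_D1 assms)
  define k where "k z = h' (g z) o\<^sub>L g' z" for z
  have "(g \<longlongrightarrow> g u) (nhds u)"
    using twice_diff_isCont[OF assms(1)] by (simp add: isCont_def tendsto_at_iff_tendsto_nhds)
  then have "\<forall>\<^sub>F z in nhds u. (h has_derivative blinfun_apply (h' (g z))) (at (g z))"
    using h(1) unfolding filterlim_iff by (auto elim!: allE)
  then have 1: "\<forall>\<^sub>F z in nhds u. ((h \<circ> g) has_derivative blinfun_apply (k z)) (at z)"
    using g(1)
  proof eventually_elim
    case (elim z)
    have "blinfun_apply (k z) = blinfun_apply (h' (g z)) \<circ> blinfun_apply (g' z)"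
      by (auto simp: k_def)
    then show ?case using diff_chain_at[OF elim(2) elim(1)] by simp
  qed
  have "((\<lambda>z. h' (g z)) has_derivative (\<lambda>v. h'' (D1 g u v))) (at u)"
    using diff_chain_at[OF twice_diff_has_derivative[OF assms(1)] h(2)] by (simp add: o_def)
  from bounded_bilinear.FDERIV[OF bounded_bilinear_blinfun_compose this g(2)]
  have 2: "(k has_derivative (\<lambda>v. (h' (g u) o\<^sub>L g'' v) + (h'' (D1 g u v) o\<^sub>L g' u))) (at u)"
    unfolding k_def .
  show "twice_diff (h \<circ> g) u"
    using 1 2 unfolding twice_diff_def differentiable_def by blast
  have 3: "\<forall>\<^sub>F z in nhds u. k z w = D1 (h \<circ> g) z w"
    using 1 by eventually_elim (simp add: D1_eq)
  have "((\<lambda>z. k z w) has_derivative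
      (\<lambda>v. ((h' (g u) o\<^sub>L g'' v) + (h'' (D1 g u v) o\<^sub>L g' u)) w)) (at u)"
    using bounded_linear.has_derivative[OF blinfun.bounded_linear_left 2] by simp
  from eventually_eq_has_derivative[OF 3 this] D1_eq[OF this]
  have "D1 (\<lambda>z. D1 (h \<circ> g) z w) u v = ((h' (g u) o\<^sub>L g'' v) + (h'' (D1 g u v) o\<^sub>L g' u)) w"
    by (simp add: D1_eq)
  then show "D2 (h \<circ> g) u v w =
      D2 h (g u) (D1 g u v) (D1 g u w) + D1 h (g u) (D2 g u v w)"
    by (simp add: D2_def[of "h \<circ> g"] D1_def[symmetric] blinfun.add_left g(4) h(4) Dg)
qed

lemma bounded_linear_twice_diff:
  assumes "bounded_linear p"
  shows "twice_diff p u" "D1 p u = p" "D2 p u v w = 0"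
proof -
  have 1: "(p has_derivative p) (at z)" for z
    using assms by (rule bounded_linear_imp_has_derivative)
  show "twice_diff p u"
    unfolding twice_diff_def
    by (rule exI[of _ "\<lambda>_. Blinfun p"]) (simp add: bounded_linear_Blinfun_apply assms 1)
  show "D1 p u = p" by (rule D1_eq[OF 1])
  have "frechet_derivative p (at z) = p" for z using D1_eq[OF 1] by (simp add: D1_def)
  then show "D2 p u v w = 0" by (simp add: D2_def)
qed

lemma
  assumes "twice_diff f u" "twice_diff g u"
  shows twice_diff_add: "twice_diff (\<lambda>z. f z + g z) u"
    and D1_add: "D1 (\<lambda>z. f z + g z) u v = D1 f u v + D1 g u v"
    and D2_add: "D2 (\<lambda>z. f z + g z) u v w = D2 f u v w + D2 g u v w"
proof -
  have d: "((\<lambda>z. f z + g z) has_derivative (\<lambda>v. D1 f u v + D1 g u v)) (at u)"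
    if "(f has_derivative D1 f u) (at u)" "(g has_derivative D1 g u) (at u)" for u
    using that by (rule has_derivative_add)
  show D1: "D1 (\<lambda>z. f z + g z) u v = D1 f u v + D1 g u v"
    using D1_eq[OF d] assms twice_diff_has_derivative by metis
  have ev: "\<forall>\<^sub>F z in nhds u. D1 f z w + D1 g z w = D1 (\<lambda>z. f z + g z) z w" for w
    using twice_diff_eventually_differentiable[OF assms(1)] twice_diff_eventually_differentiable[OF assms(2)]
    by eventually_elim (simp add: D1_eq[OF d])
  have "((\<lambda>z. D1 f z w + D1 g z w) has_derivative (\<lambda>v. D2 f u v w + D2 g u v w)) (at u)"
    by (intro has_derivative_add twice_diff_D1_has_derivative assms)
  from D1_eq[OF eventually_eq_has_derivative[OF ev this]]
  show "D2 (\<lambda>z. f z + g z) u v w = D2 f u v w + D2 g u v w"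
    unfolding D2_def D1_def[symmetric] by (simp only: )  
  obtain f' where f': "\<forall>\<^sub>F z in nhds u. (f has_derivative blinfun_apply (f' z)) (at z)"
    "f' differentiable (at u)"
    using assms unfolding twice_diff_def by blast
  obtain g' where g': "\<forall>\<^sub>F z in nhds u. (g has_derivative blinfun_apply (g' z)) (at z)"
    "g' differentiable (at u)"
    using assms unfolding twice_diff_def by blast
  have "\<forall>\<^sub>F z in nhds u. ((\<lambda>z. f z + g z) has_derivative blinfun_apply (f' z + g' z)) (at z)"
    using f'(1) g'(1)
  proof eventually_elim
    case (elim z)
    then show ?case using has_derivative_add[OF elim] by (simp add: blinfun.add_left[abs_def] plus_blinfun.rep_eq)
  qed
  then show "twice_diff (\<lambda>z. f z + g z) u"
    using f'(2) g'(2) unfolding twice_diff_def by (metis differentiable_add)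
qed

lemma
  shows twice_diff_const: "twice_diff (\<lambda>_. k) u"
    and D1_const: "D1 (\<lambda>_. k) u v = 0"
    and D2_const: "D2 (\<lambda>_. k) u v w = 0"
proof -
  have *: "((\<lambda>_. k) has_derivative (\<lambda>_. 0)) (at z)" for z :: 'a by simp
  show "twice_diff (\<lambda>_. k) u" unfolding twice_diff_def
    by (rule exI[of _ "\<lambda>_. 0"]) (simp add: zero_blinfun.rep_eq)
  have D: "D1 (\<lambda>_. k) z = (\<lambda>_. 0)" for z :: 'a using D1_eq[OF *] .
  then show "D1 (\<lambda>_. k) u v = 0" by simp
  show "D2 (\<lambda>_. k) u v w = 0" using D by (simp add: D2_def D1_def)
qed

lemma twice_diff_add_const:
  "twice_diff g u \<Longrightarrow> twice_diff (\<lambda>z. g z + k) u"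
  "twice_diff g u \<Longrightarrow> D1 (\<lambda>z. g z + k) u v = D1 g u v"
  "twice_diff g u \<Longrightarrow> D2 (\<lambda>z. g z + k) u v w = D2 g u v w"
  by (simp_all add: twice_diff_add D1_add D2_add twice_diff_const D1_const D2_const)

text \<open>The second difference \<open>\<Delta> s v w\<close> is symmetric in \<open>v\<close> and
  \<open>w\<close>, and it equals s^2 g''(v,w) up to o(s^2). Only the expansion of \<open>g'\<close>
  at the single point \<open>u\<close> enters.\<close>

lemma D2_symmetric:
  fixes g :: "'a::real_normed_vector \<Rightarrow> real"
  assumes "twice_diff g u"
  shows "D2 g u v w = D2 g u w v"
proof -
  obtain g' g'' where g: "\<forall>\<^sub>F z in nhds u. (g has_derivative blinfun_apply (g' z)) (at z)"
     "(g' has_derivative blinfun_apply g'') (at u)" 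
     "\<And>v w. D2 g u v w = g'' v w"
    using assms by (elim twice_diffE) blast
  define \<Delta> where "\<Delta> s v w = g (u + s *\<^sub>R v + s *\<^sub>R w) - g (u + s *\<^sub>R v) - g (u + s *\<^sub>R w) + g u" for s v w
  have key: "\<forall>\<^sub>F s in at_right 0. \<bar>\<Delta> s v w - s\<^sup>2 * g'' v w\<bar> \<le> e * s\<^sup>2 * K" if "e > 0" 
    and K: "K = (2 * norm v + 2 * norm w) * norm w" for e v w K
  proof -
    obtain d1 where d1: "d1 > 0" "\<And>z. dist z u < d1 \<Longrightarrow> (g has_derivative blinfun_apply (g' z)) (at z)"
      using g(1) unfolding eventually_nhds_metric by blast
    obtain d2 where d2: "d2 > 0" "\<And>z. norm (z - u) < d2 \<Longrightarrow> norm (g' z - g' u - g'' (z - u)) \<le> e * norm (z - u)"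
      using g(2) \<open>e > 0\<close> unfolding has_derivative_at_alt by blast
    define d where "d = min d1 d2"
    have "d > 0" using d1 d2 by (simp add: d_def)
    define s0 where "s0 = d / (norm v + norm w + 1)"
    have "s0 > 0" using \<open>d > 0\<close> by (simp add: s0_def add_nonneg_pos)
    have "\<bar>\<Delta> s v w - s\<^sup>2 * g'' v w\<bar> \<le> e * s\<^sup>2 * K" if s: "0 < s" "s < s0" for s
    proof -
      have sd: "s * (norm v + norm w) < d"
      proof -
        have "s * (norm v + norm w + 1) < d"
          using s(2) unfolding s0_def by (simp add: pos_less_divide_eq add_nonneg_pos)
        then show ?thesis using s(1) by (simp add: algebra_simps)
      qed
      have nb: "norm (a *\<^sub>R s *\<^sub>R v + b *\<^sub>R s *\<^sub>R w) \<le> s * (norm v + norm w)"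
        if "0 \<le> a" "a \<le> 1" "0 \<le> b" "b \<le> 1" for a b
      proof -
        have "norm (a *\<^sub>R s *\<^sub>R v + b *\<^sub>R s *\<^sub>R w) \<le> a * (s * norm v) + b * (s * norm w)"
          using norm_triangle_ineq[of "a *\<^sub>R s *\<^sub>R v" "b *\<^sub>R s *\<^sub>R w"] that s by simp
        also have "\<dots> \<le> 1 * (s * norm v) + 1 * (s * norm w)"
          by (intro add_mono mult_right_mono) (use that s in auto)
        finally show ?thesis by (simp add: algebra_simps)
      qed
      \<comment> \<open>The difference in direction \<open>v\<close>, carried along
        \<open>w\<close>. The mean value theorem turns the second difference into a difference of
        \<open>g'\<close> at two points \<open>u + a\<close> and \<open>u + b\<close> with a - b = s
        v, to which the expansion at \<open>u\<close> applies twice.\<close>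
      define \<phi> where "\<phi> \<tau> = g (u + s *\<^sub>R v + \<tau> *\<^sub>R s *\<^sub>R w) - g (u + \<tau> *\<^sub>R s *\<^sub>R w)" for \<tau>
      have "(\<phi> has_derivative (\<lambda>h. g' (u + s *\<^sub>R v + \<tau> *\<^sub>R s *\<^sub>R w) (h *\<^sub>R s *\<^sub>R w)
          - g' (u + \<tau> *\<^sub>R s *\<^sub>R w) (h *\<^sub>R s *\<^sub>R w))) (at \<tau> within {0..1})" if "0 \<le> \<tau>" "\<tau> \<le> 1" for \<tau>
      proof -
        have A: "(g has_derivative blinfun_apply (g' (u + s *\<^sub>R v + \<tau> *\<^sub>R s *\<^sub>R w))) (at (u + s *\<^sub>R v + \<tau> *\<^sub>R s *\<^sub>R w))"
          using nb[of 1 \<tau>] that sd by (intro d1(2)) (simp add: dist_norm d_def add.assoc)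
        have B: "(g has_derivative blinfun_apply (g' (u + \<tau> *\<^sub>R s *\<^sub>R w))) (at (u + \<tau> *\<^sub>R s *\<^sub>R w))"
          using nb[of 0 \<tau>] that sd by (intro d1(2)) (simp add: dist_norm d_def)
        have A': "((\<lambda>\<tau>. u + s *\<^sub>R v + \<tau> *\<^sub>R s *\<^sub>R w) has_derivative (\<lambda>h. h *\<^sub>R s *\<^sub>R w)) (at \<tau> within {0..1})"
          by (auto intro!: derivative_eq_intros)
        have B': "((\<lambda>\<tau>. u + \<tau> *\<^sub>R s *\<^sub>R w) has_derivative (\<lambda>h. h *\<^sub>R s *\<^sub>R w)) (at \<tau> within {0..1})"
          by (auto intro!: derivative_eq_intros)
        show ?thesis unfolding \<phi>_def
          by (intro has_derivative_diff has_derivative_compose[OF A' A] has_derivative_compose[OF B' B])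
      qed
      from mvt_very_simple[OF _ this] obtain \<tau> where \<tau>: "0 \<le> \<tau>" "\<tau> \<le> 1"
        "\<phi> 1 - \<phi> 0 = g' (u + s *\<^sub>R v + \<tau> *\<^sub>R s *\<^sub>R w) (s *\<^sub>R w) - g' (u + \<tau> *\<^sub>R s *\<^sub>R w) (s *\<^sub>R w)"
        by auto
      define a where "a = s *\<^sub>R v + \<tau> *\<^sub>R s *\<^sub>R w"
      define b where "b = \<tau> *\<^sub>R s *\<^sub>R w"
      have na: "norm a \<le> s * (norm v + norm w)" "norm b \<le> s * (norm v + norm w)"
        using nb[of 1 \<tau>] nb[of 0 \<tau>] \<tau> by (simp_all add: a_def b_def)
      have "norm (g' (u + a) - g' u - g'' a) \<le> e * norm a" "norm (g' (u + b) - g' u - g'' b) \<le> e * norm b"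
        using d2(2)[of "u + a"] d2(2)[of "u + b"] na sd by (simp_all add: d_def)
      moreover have "norm ((g' (u + a) - g' u - g'' a) - (g' (u + b) - g' u - g'' b)) \<le>
          norm (g' (u + a) - g' u - g'' a) + norm (g' (u + b) - g' u - g'' b)"
        by (rule norm_triangle_ineq4)
      moreover have "e * norm a \<le> e * (s * (norm v + norm w))" "e * norm b \<le> e * (s * (norm v + norm w))"
        using na \<open>e > 0\<close> by auto
      ultimately have "norm ((g' (u + a) - g' u - g'' a) - (g' (u + b) - g' u - g'' b)) \<le> e * (s * (2 * norm v + 2 * norm w))"
        by (simp add: algebra_simps)
      then have R: "norm (g' (u + a) - g' (u + b) - g'' (s *\<^sub>R v)) \<le> e * (s * (2 * norm v + 2 * norm w))"
        by (simp add: a_def b_def blinfun.add_right algebra_simps)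
      have "\<Delta> s v w - s\<^sup>2 * g'' v w = \<phi> 1 - \<phi> 0 - g'' (s *\<^sub>R v) (s *\<^sub>R w)"
        by (simp add: \<Delta>_def \<phi>_def blinfun.scaleR_right blinfun.scaleR_left power2_eq_square)
      also have "\<dots> = (g' (u + a) - g' (u + b) - g'' (s *\<^sub>R v)) (s *\<^sub>R w)"
        by (simp add: \<tau>(3) a_def b_def blinfun.diff_left add.assoc)
      finally have "\<bar>\<Delta> s v w - s\<^sup>2 * g'' v w\<bar> \<le> norm (g' (u + a) - g' (u + b) - g'' (s *\<^sub>R v)) * norm (s *\<^sub>R w)"
        using norm_blinfun by (metis real_norm_def)
      also have "\<dots> \<le> e * (s * (2 * norm v + 2 * norm w)) * norm (s *\<^sub>R w)"
        by (rule mult_right_mono[OF R]) simp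
      finally show ?thesis using s by (simp add: K power2_eq_square algebra_simps)
    qed
    then show ?thesis using \<open>s0 > 0\<close> unfolding eventually_at_right_field by blast
  qed
  define M where "M = (2 * norm v + 2 * norm w) * norm w + (2 * norm w + 2 * norm v) * norm v"
  have *: "\<bar>g'' v w - g'' w v\<bar> \<le> e * M" if "e > 0" for e
  proof -
    have "\<forall>\<^sub>F s in at_right (0::real). s > 0" by (simp add: eventually_at_right_less)
    with key[OF that refl, of v w] key[OF that refl, of w v]
    have "\<forall>\<^sub>F s in at_right (0::real). \<bar>g'' v w - g'' w v\<bar> \<le> e * M"
    proof eventually_elim
      case (elim s)
      have "\<Delta> s v w = \<Delta> s w v" by (simp add: \<Delta>_def algebra_simps)
      then have "\<bar>s\<^sup>2 * g'' v w - s\<^sup>2 * g'' w v\<bar> \<le> s\<^sup>2 * (e * M)"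
        using elim(1,2) by (simp add: M_def algebra_simps abs_le_iff)
      then have "s\<^sup>2 * \<bar>g'' v w - g'' w v\<bar> \<le> s\<^sup>2 * (e * M)"
        by (metis abs_mult abs_power2 right_diff_distrib)
      then show ?case using elim(3) by simp
    qed
    then show ?thesis using eventually_happens trivial_limit_at_right_real by blast
  qed
  have "M \<ge> 0" by (simp add: M_def)
  have "\<bar>g'' v w - g'' w v\<bar> \<le> 0 + d" if "d > 0" for d
  proof -
    have "\<bar>g'' v w - g'' w v\<bar> \<le> d / (M + 1) * M"
      using \<open>M \<ge> 0\<close> that by (intro *) (simp add: add_nonneg_pos)
    also have "\<dots> \<le> d" using \<open>M \<ge> 0\<close> that by (simp add: field_simps)
    finally show ?thesis by simp
  qed
  then have "\<bar>g'' v w - g'' w v\<bar> \<le> 0" by (rule field_le_epsilon)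
  then show ?thesis by (simp add: g)
qed

section \<open>Equivalent scalar products on a Hilbert space\<close>

text \<open>Successive approximation: each step removes half of the residual, so the corrections
  form a geometric series. The gauge \<open>q\<close> is left general because it is the norm of the
  type in the open mapping theorem and the norm \<open>n\<close> in
  \<open>ex_id_plus_small\<close>.\<close>

lemma approximate_solutions_imp_solution:
  fixes T :: "'a::banach \<Rightarrow> 'b::real_normed_vector"
  assumes T: "bounded_linear T" and "K \<ge> 0" "c \<ge> 0"
    and q: "\<And>h. norm h \<le> c * q h"
    and step: "\<And>h. \<exists>v. norm v \<le> K * q h \<and> q (h - T v) \<le> q h / 2"
  shows "\<exists>v. T v = h \<and> norm v \<le> 2 * K * q h"
proof -
  interpret T: bounded_linear T by fact
  obtain g where g: "\<And>h. norm (g h) \<le> K * q h" "\<And>h. q (h - T (g h)) \<le> q h / 2"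
    using step by metis
  define r where "r k = ((\<lambda>h. h - T (g h)) ^^ k) h" for k
  have r0: "r 0 = h" and rS: "r (Suc k) = r k - T (g (r k))" for k by (simp_all add: r_def)
  have qr: "q (r k) \<le> q h * (1/2) ^ k" for k
  proof (induction k)
    case (Suc k)
    then show ?case using g(2)[of "r k"] by (simp add: rS)
  qed (simp add: r0)
  have gr: "norm (g (r k)) \<le> (K * q h) * (1/2) ^ k" for k
    using g(1)[of "r k"] mult_left_mono[OF qr[of k] \<open>K \<ge> 0\<close>] by (simp add: mult.assoc)
  have sums: "(\<lambda>k. (K * q h) * (1/2) ^ k) sums (K * q h * 2)"
    using sums_mult[OF geometric_sums[of "1/2 :: real"], of "K * q h"] by simp
  have summ: "summable (\<lambda>k. g (r k))"
    by (rule summable_comparison_test'[OF sums_summable[OF sums]]) (rule gr)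
  define v where "v = (\<Sum>k. g (r k))"
  have "norm v \<le> K * q h * 2"
    unfolding v_def sums_unique[OF sums]
    by (rule norm_suminf_le[OF gr sums_summable[OF sums]])
  moreover have "T v = h"
  proof -
    have "(\<lambda>k. T (g (r k))) sums T v"
      unfolding v_def by (rule T.sums[OF summable_sums[OF summ]])
    \<comment> \<open>The images of the corrections are differences of consecutive residuals, so
      their sum telescopes to \<open>h\<close> once the residuals tend to 0.\<close>
    moreover have "(\<lambda>k. r k - r (Suc k)) sums (r 0 - 0)"
    proof (rule telescope_sums')
      have "norm (r k) \<le> c * (q h * (1/2) ^ k)" for k
        using q[of "r k"] mult_left_mono[OF qr[of k] \<open>c \<ge> 0\<close>] by simp
      moreover have "(\<lambda>k. c * (q h * (1/2) ^ k)) \<longlonglongrightarrow> 0"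
        by (intro tendsto_mult_right_zero LIMSEQ_power_zero) simp
      ultimately show "r \<longlonglongrightarrow> 0" by (intro Lim_null_comparison[of r]) (simp_all add: always_eventually)
    qed
    then have "(\<lambda>k. T (g (r k))) sums h" by (simp add: rS r0)
    ultimately show ?thesis using sums_unique2 by blast
  qed
  ultimately show ?thesis by (auto simp: mult_ac)
qed

text \<open>The open mapping theorem. Baire's theorem gives a ball inside the closure of the image
  of some ball; symmetry moves its centre to 0, and successive approximation removes the
  closure.\<close>

theorem surjective_imp_bounded_solutions:
  fixes A :: "'a::banach \<Rightarrow> 'b::banach"
  assumes A: "bounded_linear A" and "surj A"
  shows "\<exists>K>0. \<forall>h. \<exists>v. A v = h \<and> norm v \<le> K * norm h"
proof -
  interpret A: bounded_linear A by fact
  have "\<exists>k::nat. interior (closure (A ` cball 0 (real k))) \<noteq> {}"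
  proof (rule ccontr)
    assume *: "\<not> ?thesis"
    have "complete (UNIV :: 'b set)" by (rule complete_UNIV)
    then have "Met_TC.mtopology interior_of \<Union> (range (\<lambda>k::nat. closure (A ` cball 0 (real k)))) = {}"
      using * by (intro Met_TC.metric_Baire_category_alt) (auto simp: mcomplete_iff_complete)
    then have "interior (\<Union>k::nat. closure (A ` cball 0 (real k))) = {}" by simp
    moreover have "(\<Union>k::nat. closure (A ` cball 0 (real k))) = UNIV"
    proof -
      have "h \<in> (\<Union>k::nat. closure (A ` cball 0 (real k)))" for h
      proof -
        obtain v where "h = A v" using \<open>surj A\<close> by blast
        obtain k :: nat where "norm v \<le> real k" using real_arch_simple by blast
        then have "h \<in> A ` cball 0 (real k)" using \<open>h = A v\<close> by simp
        then have "h \<in> closure (A ` cball 0 (real k))" by (rule subsetD[OF closure_subset])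
        then show ?thesis by (rule UN_I[OF UNIV_I])
      qed
      then show ?thesis by blast
    qed
    ultimately show False by simp
  qed
  then obtain k :: nat and y where "y \<in> interior (closure (A ` cball 0 (real k)))" by blast
  then obtain r where r: "r > 0" "ball y r \<subseteq> closure (A ` cball 0 (real k))"
    by (meson mem_interior)
  \<comment> \<open>Half the difference of approximate preimages of \<open>y + h\<close> and
    \<open>y - h\<close> is an approximate preimage of \<open>h\<close>: the centre \<open>y\<close>
    cancels.\<close>
  have small: "\<exists>v. norm v \<le> real k \<and> norm (h - A v) \<le> e" if "norm h < r" "e > 0" for h e
  proof -
    have "y + h \<in> closure (A ` cball 0 (real k))" "y - h \<in> closure (A ` cball 0 (real k))"
      using that r by (auto simp: dist_norm intro!: subsetD[OF r(2)])
    then obtain v1 v2 where v: "norm v1 \<le> real k" "norm v2 \<le> real k"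
      "dist (A v1) (y + h) < e" "dist (A v2) (y - h) < e"
      unfolding closure_approachable using \<open>e > 0\<close> by force
    have "h - A ((1/2) *\<^sub>R (v1 - v2)) = (1/2) *\<^sub>R ((y + h - A v1) - (y - h - A v2))"
      by (simp add: A.scaleR A.diff algebra_simps) (simp add: scaleR_2[symmetric] flip: scaleR_add_left)
    moreover have "norm ((y + h - A v1) - (y - h - A v2)) \<le> e + e"
      using v(3,4) norm_triangle_ineq4[of "y + h - A v1" "y - h - A v2"]
      by (simp add: dist_norm norm_minus_commute)
    ultimately have "norm (h - A ((1/2) *\<^sub>R (v1 - v2))) \<le> e" by simp
    moreover have "norm ((1/2) *\<^sub>R (v1 - v2)) \<le> real k"
      using v(1,2) norm_triangle_ineq4[of v1 v2] by simp
    ultimately show ?thesis by blast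
  qed
  have "\<exists>v. norm v \<le> (2 * real k / r) * norm h \<and> norm (h - A v) \<le> norm h / 2" for h
  proof (cases "h = 0")
    case True
    then show ?thesis by (auto intro!: exI[of _ 0] simp: A.zero)
  next
    case False
    \<comment> \<open>Scales \<open>h\<close> to length r/2, inside the range of
      \<open>small\<close>.\<close>
    define t where "t = 2 * norm h / r"
    have "t > 0" using False r by (simp add: t_def)
    have "norm (h /\<^sub>R t) < r" using False r by (simp add: t_def field_simps)
    from small[OF this, of "norm h / 2 / t"] obtain v where
      v: "norm v \<le> real k" "norm (h /\<^sub>R t - A v) \<le> norm h / 2 / t" using \<open>t > 0\<close> False by auto
    have "h - A (t *\<^sub>R v) = t *\<^sub>R (h /\<^sub>R t - A v)"
      using \<open>t > 0\<close> by (simp add: A.scaleR scaleR_diff_right)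
    then have "norm (h - A (t *\<^sub>R v)) = t * norm (h /\<^sub>R t - A v)" using \<open>t > 0\<close> by simp
    also have "\<dots> \<le> norm h / 2" using v(2) \<open>t > 0\<close> by (simp add: field_simps)
    finally have "norm (h - A (t *\<^sub>R v)) \<le> norm h / 2" .
    moreover have "norm (t *\<^sub>R v) \<le> t * real k" using v(1) \<open>t > 0\<close> by simp
    ultimately show ?thesis by (auto intro!: exI[of _ "t *\<^sub>R v"] simp: t_def mult_ac)
  qed
  from approximate_solutions_imp_solution[OF A _ _ _ this, where c = 1]
  have "\<forall>h. \<exists>v. A v = h \<and> norm v \<le> (2 * (2 * real k / r)) * norm h" using r by simp
  \<comment> \<open>The summand 1 keeps the constant positive when \<open>k\<close> is 0.\<close>
  then have "\<forall>h. \<exists>v. A v = h \<and> norm v \<le> (2 * (2 * real k / r) + 1) * norm h"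
    by (meson order_trans mult_right_mono norm_ge_zero less_eq_real_def less_add_one)
  moreover have "2 * (2 * real k / r) + 1 > 0" using r by (simp add: add_nonneg_pos)
  ultimately show ?thesis by blast
qed

text \<open>The scalar product changes with the point of the manifold while the \<open>inner\<close>
  of the type is fixed, so the Hilbert space facts are derived for an arbitrary compatible
  form.\<close>

locale compatible_ip =
  fixes B :: "'e::{real_inner, banach} \<Rightarrow> 'e \<Rightarrow> real"
  assumes compatible: "compatible_inner B"
begin

sublocale B: bounded_bilinear B
  using compatible by (simp add: compatible_inner_def)

definition n :: "'e \<Rightarrow> real" where "n v = sqrt (B v v)"

text \<open>Independent of the problem record, so that it is also available for the inner product of
  the type in \<open>constrained_local_minimum\<close>; \<open>pinv_eq\<close> identifies it with
  \<open>pseudo_inv\<close>.\<close>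

definition pinv :: "('e \<Rightarrow> 'h::real_normed_vector) \<Rightarrow> 'h \<Rightarrow> 'e" where
  "pinv A w = (THE v. A v = w \<and> (\<forall>u. A u = 0 \<longrightarrow> B v u = 0))"

lemma sym: "B v w = B w v"
  using compatible by (simp add: compatible_inner_def)

lemma coercive: obtains a where "a > 0" "\<And>v. a * (norm v)\<^sup>2 \<le> B v v"
  using compatible unfolding compatible_inner_def by blast

lemma B_nonneg [simp]: "B v v \<ge> 0"
  by (rule coercive) (meson order_trans mult_nonneg_nonneg less_imp_le zero_le_power2)

lemma n_sq: "(n v)\<^sup>2 = B v v" and n_nonneg [simp]: "n v \<ge> 0"
  by (simp_all add: n_def)

lemma norm_le_n: obtains K where "K > 0" "\<And>v. norm v \<le> K * n v"
proof -
  obtain a where a: "a > 0" "\<And>v. a * (norm v)\<^sup>2 \<le> B v v" using coercive by blast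
  have "norm v \<le> sqrt (1 / a) * n v" for v
  proof -
    have "norm v = sqrt ((norm v)\<^sup>2)" by simp
    also have "\<dots> \<le> sqrt ((1 / a) * B v v)"
      using a(1) a(2)[of v] by (intro real_sqrt_le_mono) (simp add: field_simps)
    finally show ?thesis by (simp add: n_def real_sqrt_divide)
  qed
  then show thesis using that a(1) by (metis real_sqrt_gt_zero zero_less_divide_1_iff)
qed

lemma n_le_norm: obtains K where "K > 0" "\<And>v. n v \<le> K * norm v"
proof -
  obtain K where K: "K > 0" "\<And>v w. norm (B v w) \<le> norm v * norm w * K"
    using B.pos_bounded by blast
  have "n v \<le> sqrt K * norm v" for v
  proof -
    have "n v \<le> sqrt (K * (norm v)\<^sup>2)"
      using K(2)[of v v] by (simp add: n_def power2_eq_square mult_ac)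
    then show ?thesis by (simp add: real_sqrt_mult)
  qed
  then show thesis using that K(1) by (metis real_sqrt_gt_zero)
qed

lemma n_eq_0 [simp]: "n v = 0 \<longleftrightarrow> v = 0"
proof
  assume "n v = 0"
  then show "v = 0" using norm_le_n by (metis mult_zero_right norm_le_zero_iff)
qed (simp add: n_def B.zero_left)

lemma n_0 [simp]: "n 0 = 0" by simp

lemma n_scaleR [simp]: "n (s *\<^sub>R v) = \<bar>s\<bar> * n v"
  by (simp add: n_def B.scaleR_left B.scaleR_right real_sqrt_mult flip: mult.assoc)

lemma n_minus [simp]: "n (- v) = n v"
  by (simp add: n_def B.minus_left B.minus_right)

lemma cauchy_schwarz: "\<bar>B v w\<bar> \<le> n v * n w"
proof (cases "w = 0")
  case False
  then have pos: "B w w > 0" using n_eq_0[of w] B_nonneg[of w] by (simp add: n_def order_less_le)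
  define s where "s = B v w / B w w"
  have "0 \<le> B (v - s *\<^sub>R w) (v - s *\<^sub>R w)" by simp
  also have "\<dots> = B v v - 2 * s * B v w + s\<^sup>2 * B w w"
    by (simp add: B.diff_left B.diff_right B.scaleR_left B.scaleR_right sym[of w v] power2_eq_square algebra_simps)
  also have "\<dots> = B v v - (B v w)\<^sup>2 / B w w"
    using pos by (simp add: s_def power2_eq_square field_simps)
  finally have "(B v w)\<^sup>2 \<le> B v v * B w w" using pos by (simp add: field_simps)
  then show ?thesis
    by (simp add: n_def real_sqrt_mult[symmetric] real_le_rsqrt flip: real_sqrt_abs)
qed (simp add: B.zero_right)

lemma n_triangle: "n (v + w) \<le> n v + n w"
proof (rule power2_le_imp_le)
  have "(n (v + w))\<^sup>2 = (n v)\<^sup>2 + 2 * B v w + (n w)\<^sup>2"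
    by (simp add: n_sq B.add_left B.add_right sym[of w v])
  also have "\<dots> \<le> (n v)\<^sup>2 + 2 * (n v * n w) + (n w)\<^sup>2"
    using cauchy_schwarz[of v w] by linarith
  finally show "(n (v + w))\<^sup>2 \<le> (n v + n w)\<^sup>2" by (simp add: power2_sum algebra_simps)
qed simp

lemma n_triangle_diff: "n (v - w) \<le> n v + n w"
  using n_triangle[of v "- w"] by simp

lemma pythagoras: "B v w = 0 \<Longrightarrow> (n (v + w))\<^sup>2 = (n v)\<^sup>2 + (n w)\<^sup>2"
  by (simp add: n_sq B.add_left B.add_right sym[of w v])

lemma
  assumes "B v w = 0"
  shows orthogonal_le1: "n v \<le> n (v + w)" and orthogonal_le2: "n w \<le> n (v + w)"
  by (rule power2_le_imp_le; simp add: pythagoras[OF assms])+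

lemma continuous_n [continuous_intros]: "continuous_on S n"
  unfolding n_def[abs_def] by (intro continuous_intros B.continuous_on)

text \<open>Reduced to the real function obtained by pairing \<phi> with its own increment
  \<open>u\<close>; Cauchy-Schwarz then gives a bound in \<open>n\<close>, free of the equivalence
  constants to the norm of the type.\<close>

lemma mean_value_n:
  assumes "\<And>t. 0 \<le> t \<Longrightarrow> t \<le> 1 \<Longrightarrow> (\<phi> has_vector_derivative \<phi>' t) (at t within {0..1})"
    and le: "\<And>t. 0 \<le> t \<Longrightarrow> t \<le> 1 \<Longrightarrow> n (\<phi>' t) \<le> M"
  shows "n (\<phi> 1 - \<phi> 0) \<le> M"
proof -
  define u where "u = \<phi> 1 - \<phi> 0"
  have d: "((\<lambda>t. B u (\<phi> t)) has_derivative (\<lambda>h. B u (h *\<^sub>R \<phi>' t))) (at t within {0..1})"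
    if "0 \<le> t" "t \<le> 1" for t
    using assms(1)[OF that] unfolding has_vector_derivative_def
    by (rule bounded_linear.has_derivative[OF B.bounded_linear_right])
  from mvt_very_simple[OF _ d] obtain t where t: "0 \<le> t" "t \<le> 1"
    "B u (\<phi> 1) - B u (\<phi> 0) = B u (\<phi>' t)" by auto
  have "(n u)\<^sup>2 = B u (\<phi>' t)" using t(3) by (simp add: n_sq u_def B.diff_right)
  also have "\<dots> \<le> n u * n (\<phi>' t)" using cauchy_schwarz abs_le_D1 by blast
  also have "\<dots> \<le> n u * M" using le[OF t(1,2)] by (simp add: mult_left_mono)
  finally have "n u * n u \<le> n u * M" by (simp add: power2_eq_square)
  then show ?thesis using n_nonneg[of u] le[of 0] order_trans[OF n_nonneg[of "\<phi>' 0"] le[of 0]]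
    unfolding u_def[symmetric] by (cases "n u = 0") auto
qed

context
  fixes A :: "'e \<Rightarrow> 'h::banach"
  assumes A: "bounded_linear A" "surj A"
begin

interpretation A: bounded_linear A by (rule A)

text \<open>The preimage of least \<open>n\<close>-norm. It exists because a minimizing sequence is
  Cauchy, and minimality along each kernel direction is orthogonality.\<close>

lemma ex_orthogonal_preimage: "\<exists>v. A v = w \<and> (\<forall>u. A u = 0 \<longrightarrow> B v u = 0)"
proof -
  define S where "S = {v. A v = w}"
  have "S \<noteq> {}" using A(2) unfolding S_def by (metis (mono_tags, lifting) empty_Collect_eq surjD)
  define m where "m = (INF v\<in>S. B v v)"
  have m: "m \<le> B v v" if "v \<in> S" for v
    unfolding m_def using that by (intro cINF_lower bdd_belowI2[of _ 0]) auto
  have "\<exists>v\<in>S. B v v < m + 1 / real (Suc k)" for k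
    using cInf_lessD[of "(\<lambda>v. B v v) ` S" "m + 1 / real (Suc k)"] \<open>S \<noteq> {}\<close>
    unfolding m_def by auto
  then obtain v where v: "\<And>k. v k \<in> S" "\<And>k. B (v k) (v k) < m + 1 / real (Suc k)" by metis
  \<comment> \<open>Parallelogram identity: the midpoint of two preimages is again a preimage, so
    its value is at least \<open>m\<close>.\<close>
  have bnd: "B (v j - v k) (v j - v k) \<le> 2 / real (Suc j) + 2 / real (Suc k)" for j k
  proof -
    have "(1/2) *\<^sub>R (v j + v k) \<in> S" using v(1) 
      by (simp add: S_def A.scaleR A.add scaleR_2[symmetric])
    from m[OF this] have "4 * m \<le> B (v j + v k) (v j + v k)"
      by (simp add: B.scaleR_left B.scaleR_right)
    moreover have "B (v j - v k) (v j - v k) + B (v j + v k) (v j + v k) = 2 * B (v j) (v j) + 2 * B (v k) (v k)"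
      by (simp add: B.add_left B.add_right B.diff_left B.diff_right)
    ultimately show ?thesis using v(2)[of j] v(2)[of k] by simp
  qed
  obtain a where a: "a > 0" "\<And>v. a * (norm v)\<^sup>2 \<le> B v v" using coercive by blast
  have "Cauchy v"
  proof (rule metric_CauchyI)
    fix e :: real assume "e > 0"
    obtain N :: nat where N: "4 / (a * e\<^sup>2) < real N" using reals_Archimedean2 by blast
    have "dist (v j) (v k) < e" if "j \<ge> N" "k \<ge> N" for j k
    proof -
      have "N > 0" using N a \<open>e > 0\<close> by (metis divide_pos_pos gr0I mult_pos_pos not_less_iff_gr_or_eq of_nat_0 zero_less_numeral zero_less_power order_less_trans)
      have "2 / real (Suc j) < 2 / real N" "2 / real (Suc k) < 2 / real N"
        using that \<open>N > 0\<close> by (auto intro!: divide_strict_left_mono)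
      then have "a * (norm (v j - v k))\<^sup>2 < 4 / real N" using a(2)[of "v j - v k"] bnd[of j k] by simp
      also have "\<dots> < a * e\<^sup>2" using N \<open>N > 0\<close> a \<open>e > 0\<close> by (simp add: field_simps)
      finally have "(norm (v j - v k))\<^sup>2 < e\<^sup>2" using a by simp
      then show ?thesis using \<open>e > 0\<close> by (simp add: dist_norm power_less_imp_less_base)
    qed
    then show "\<exists>M. \<forall>m\<ge>M. \<forall>n\<ge>M. dist (v m) (v n) < e" by blast
  qed
  then obtain x where x: "v \<longlonglongrightarrow> x" using Cauchy_convergent convergent_def by blast
  have "(\<lambda>k. A (v k)) \<longlonglongrightarrow> A x" by (rule A.tendsto[OF x])
  moreover have "(\<lambda>k. A (v k)) = (\<lambda>k. w)" using v(1) by (auto simp: S_def)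
  ultimately have "A x = w" using LIMSEQ_unique by (metis tendsto_const)
  have "(\<lambda>k. B (v k) (v k)) \<longlonglongrightarrow> B x x" by (rule B.tendsto[OF x x])
  moreover have "(\<lambda>k. m + 1 / real (Suc k)) \<longlonglongrightarrow> m + 0"
    by (intro tendsto_add tendsto_const LIMSEQ_inverse_real_of_nat[unfolded inverse_eq_divide])
  ultimately have "B x x \<le> m + 0"
    by (rule LIMSEQ_le) (use v(2) less_imp_le in blast)
  have "B x u = 0" if "A u = 0" for u
  proof (rule ccontr)
    assume "B x u \<noteq> 0"
    then have "u \<noteq> 0" by (auto simp: B.zero_right)
    then have pos: "B u u > 0" using n_eq_0[of u] B_nonneg[of u] by (simp add: n_def order_less_le)
    \<comment> \<open>The minimizer of the quadratic along \<open>x + s u\<close>, which lowers the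
      value strictly unless the linear term vanishes.\<close>
    define s where "s = - (B x u / B u u)"
    have "x + s *\<^sub>R u \<in> S" using \<open>A x = w\<close> that by (simp add: S_def A.add A.scaleR)
    then have "B x x \<le> B (x + s *\<^sub>R u) (x + s *\<^sub>R u)" using m \<open>B x x \<le> m + 0\<close> by fastforce
    also have "\<dots> = B x x + 2 * s * B x u + s\<^sup>2 * B u u"
      by (simp add: B.add_left B.add_right B.scaleR_left B.scaleR_right sym[of u x] power2_eq_square algebra_simps)
    also have "\<dots> = B x x - (B x u)\<^sup>2 / B u u" using pos by (simp add: s_def power2_eq_square field_simps)
    finally have "(B x u)\<^sup>2 / B u u \<le> 0" by simp
    then show False using pos \<open>B x u \<noteq> 0\<close> by (simp add: divide_le_0_iff)
  qed
  then show ?thesis using \<open>A x = w\<close> by blast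
qed

lemma pinv_eqI:
  assumes "A v = w" "\<And>u. A u = 0 \<Longrightarrow> B v u = 0"
  shows "pinv A w = v"
  unfolding pinv_def
proof (rule the_equality)
  fix v' assume v': "A v' = w \<and> (\<forall>u. A u = 0 \<longrightarrow> B v' u = 0)"
  have "A (v' - v) = 0" using v' assms by (simp add: A.diff)
  then have "B (v' - v) (v' - v) = 0" using v' assms(2) by (simp add: B.diff_left)
  then have "n (v' - v) = 0" by (simp add: n_def)
  then show "v' = v" by simp
qed (use assms in auto)

lemma A_pinv [simp]: "A (pinv A w) = w"
  and pinv_orthogonal: "A u = 0 \<Longrightarrow> B (pinv A w) u = 0"
  using ex_orthogonal_preimage[of w] pinv_eqI by metis+

text \<open>Additivity and homogeneity come from uniqueness of the orthogonal preimage. Being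
  \<open>n\<close>-minimal among all preimages, it inherits the bound of the preimages supplied by
  the open mapping theorem.\<close>

lemma bounded_linear_pinv: "bounded_linear (pinv A)"
proof -
  obtain K where K: "K > 0" "\<And>h. \<exists>v. A v = h \<and> norm v \<le> K * norm h"
    using surjective_imp_bounded_solutions[OF A] by blast
  obtain K1 where K1: "K1 > 0" "\<And>v. n v \<le> K1 * norm v" using n_le_norm by blast
  obtain K2 where K2: "K2 > 0" "\<And>v. norm v \<le> K2 * n v" using norm_le_n by blast
  show ?thesis
  proof (rule bounded_linear_intro)
    show "pinv A (x + y) = pinv A x + pinv A y" for x y
      by (rule pinv_eqI) (simp_all add: A.add B.add_left pinv_orthogonal)
    show "pinv A (r *\<^sub>R x) = r *\<^sub>R pinv A x" for r x
      by (rule pinv_eqI) (simp_all add: A.scaleR B.scaleR_left pinv_orthogonal)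
    show "norm (pinv A h) \<le> norm h * (K2 * (K1 * K))" for h
    proof -
      obtain v where v: "A v = h" "norm v \<le> K * norm h" using K by blast
      have "A (v - pinv A h) = 0" using v(1) by (simp add: A.diff)
      then have "n (pinv A h) \<le> n v"
        using orthogonal_le1[OF pinv_orthogonal, of "v - pinv A h" h] by simp
      also have "\<dots> \<le> K1 * (K * norm h)" using K1(2)[of v] mult_left_mono[OF v(2) less_imp_le[OF K1(1)]] by (rule order_trans)
      finally have "K2 * n (pinv A h) \<le> K2 * (K1 * (K * norm h))" using K2(1) by simp
      then show ?thesis using K2(2)[of "pinv A h"] by (simp add: mult_ac)
    qed
  qed
qed

end

text \<open>A Neumann series: \<open>h\<close> itself solves the equation up to half of its size.
  The factor 2 comes afterwards, by absorbing n v / 2 in the triangle inequality.\<close>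

lemma ex_id_plus_small:
  assumes E: "bounded_linear E" and small: "\<And>v. n (E v) \<le> n v / 2"
  shows "\<exists>v. v + E v = h \<and> n v \<le> 2 * n h"
proof -
  interpret E: bounded_linear E by fact
  obtain K where K: "K > 0" "\<And>v. norm v \<le> K * n v" using norm_le_n by blast
  have "\<exists>v. norm v \<le> K * n h \<and> n (h - (v + E v)) \<le> n h / 2" for h
    using K(2)[of h] small[of h] by (intro exI[of _ h]) simp
  then obtain v where v: "v + E v = h"
    using approximate_solutions_imp_solution[of "\<lambda>v. v + E v" K K n h] K E bounded_linear_add[OF bounded_linear_ident E]
    by fastforce
  then have "n v \<le> n h + n (E v)" using n_triangle_diff[of h "E v"] by (metis add_diff_cancel_right')
  then show ?thesis using small[of v] v by (intro exI[of _ v]) simp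
qed

end

section \<open>First order condition for constrained minima\<close>

lemma compatible_inner_inner: "compatible_inner (\<bullet>)"
  unfolding compatible_inner_def
  by (auto simp: bounded_bilinear_inner inner_commute power2_norm_eq_inner intro!: exI[of _ 1])

text \<open>Every kernel direction \<open>u\<close> is tangent to the feasible set:
  \<open>a + t u\<close> becomes feasible after a correction \<open>T k\<close> of size o(t), found
  as a fixed point. Minimality along these points for both signs of \<open>t\<close> makes the
  derivative vanish.\<close>

theorem constrained_local_minimum:
  fixes f :: "'a::{real_inner, banach} \<Rightarrow> real" and c :: "'a \<Rightarrow> 'b::banach"
  assumes f: "(f has_derivative f') (at a)" and c: "twice_diff c a"
    and surj: "surj (D1 c a)"
    and min: "\<forall>\<^sub>F z in nhds a. c z = c a \<longrightarrow> f a \<le> f z"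
    and u: "D1 c a u = 0"
  shows "f' u = 0"
proof -
  interpret compatible_ip "(\<bullet>) :: 'a \<Rightarrow> _" by unfold_locales (rule compatible_inner_inner)
  define A where "A = D1 c a"
  have A: "bounded_linear A" unfolding A_def by (rule twice_diff_bounded_linear_D1[OF c])
  interpret A: bounded_linear A by (rule A)
  define T where "T = pinv A"
  have AT: "A (T h) = h" for h unfolding T_def using A_pinv A surj by (simp add: A_def)
  have "bounded_linear T" unfolding T_def using bounded_linear_pinv A surj by (simp add: A_def)
  then interpret T: bounded_linear T .
  interpret f': bounded_linear f' using f by (rule has_derivative_bounded_linear)
  obtain KT where KT: "KT > 0" "\<And>h. norm (T h) \<le> norm h * KT" using T.pos_bounded by blast
  obtain KF where KF: "KF > 0" "\<And>h. norm (f' h) \<le> norm h * KF" using f'.pos_bounded by blast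
  \<comment> \<open>Makes the map \<open>\<Psi>\<close> below a contraction with factor
    \<open>q * KT\<close> = 1/2.\<close>
  define q where "q = 1 / (2 * KT)"
  have "q > 0" using KT by (simp add: q_def)
  obtain d1 where d1: "d1 > 0" "\<And>z. dist z a < d1 \<Longrightarrow> (c has_derivative D1 c z) (at z)"
    "\<And>z v. dist z a < d1 \<Longrightarrow> norm (D1 c z v - A v) \<le> q * norm v"
    using twice_diff_continuous_D1[OF c \<open>q > 0\<close>] unfolding A_def by metis
  obtain d2 where d2: "d2 > 0" "\<And>z. dist z a < d2 \<Longrightarrow> c z = c a \<Longrightarrow> f a \<le> f z"
    using min unfolding eventually_nhds_metric by blast
  have strict: "norm (c z - c z' - A (z - z')) \<le> q * norm (z - z')"
    if "dist z a < d1" "dist z' a < d1" for z z'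
  proof -
    have "norm ((c z - A z) - (c z' - A z')) \<le> q * norm (z - z')"
    proof (rule differentiable_bound[of "ball a d1"])
      show "((\<lambda>z. c z - A z) has_derivative (\<lambda>v. D1 c x v - A v)) (at x within ball a d1)"
        if "x \<in> ball a d1" for x
        using that by (intro has_derivative_diff A.has_derivative has_derivative_ident
            has_derivative_at_withinI[OF d1(2)]) (simp add: dist_commute)
      show "onorm (\<lambda>v. D1 c x v - A v) \<le> q" if "x \<in> ball a d1" for x
        using that d1(3)[of x] \<open>q > 0\<close> by (intro onorm_bound) (auto simp: dist_commute)
    qed (use that in \<open>auto simp: dist_commute\<close>)
    then show ?thesis by (simp add: A.diff algebra_simps)
  qed
  \<comment> \<open>One inequality for every nonzero \<open>t\<close>; the two signs of
    \<open>t\<close> later give the upper and the lower bound for \<open>f' u\<close>.\<close>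
  have curve: "f' (t *\<^sub>R u) \<ge> - (e * \<bar>t\<bar>) * (KF * KT + norm u + KT * e)"
    if "e > 0" and t: "\<bar>t\<bar> < \<delta>" "t \<noteq> 0"
      and \<delta>: "\<delta> * norm u < d" "\<delta> * (norm u + KT * e) < d" 
      and d: "d \<le> d1" "d \<le> d2"
      "\<And>z. dist z a < d \<Longrightarrow> norm (c z - c a - A (z - a)) \<le> e / (2 * (norm u + 1)) * norm (z - a)"
      "\<And>z. dist z a < d \<Longrightarrow> norm (f z - f a - f' (z - a)) \<le> e * norm (z - a)"
    for e t \<delta> d
  proof -
    \<comment> \<open>A fixed point makes the corrected point feasible. Since \<open>A u\<close> = 0
      and \<open>A (T k) = k\<close>, \<open>\<Psi> k\<close> is minus the linearization error of
      \<open>c\<close> at that point, hence small and with small Lipschitz constant.\<close>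
    define \<Psi> where "\<Psi> k = k - (c (a + t *\<^sub>R u + T k) - c a)" for k
    define S where "S = cball (0::'b) (e * \<bar>t\<bar>)"
    have tu: "\<bar>t\<bar> * norm u \<le> \<delta> * norm u" using t by (intro mult_right_mono) auto
    have inb: "dist (a + t *\<^sub>R u + T k) a < d" "norm (t *\<^sub>R u + T k) \<le> \<bar>t\<bar> * (norm u + KT * e)" if "k \<in> S" for k
    proof -
      have "norm (t *\<^sub>R u + T k) \<le> \<bar>t\<bar> * norm u + norm k * KT"
        using norm_triangle_ineq[of "t *\<^sub>R u" "T k"] KT(2)[of k] by simp
      also have "\<dots> \<le> \<bar>t\<bar> * norm u + (e * \<bar>t\<bar>) * KT"
        using that KT by (simp add: S_def)
      finally show 1: "norm (t *\<^sub>R u + T k) \<le> \<bar>t\<bar> * (norm u + KT * e)" by (simp add: algebra_simps)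
      also have "\<dots> \<le> \<delta> * (norm u + KT * e)" using t KT \<open>e > 0\<close> by (intro mult_right_mono) auto
      finally show "dist (a + t *\<^sub>R u + T k) a < d" using \<delta>(2) by (simp add: dist_norm add.assoc)
    qed
    have lip: "norm (\<Psi> k - \<Psi> k') \<le> (1/2) * norm (k - k')" if "k \<in> S" "k' \<in> S" for k k'
    proof -
      have "\<Psi> k - \<Psi> k' = - (c (a + t *\<^sub>R u + T k) - c (a + t *\<^sub>R u + T k')
          - A ((a + t *\<^sub>R u + T k) - (a + t *\<^sub>R u + T k')))"
        by (simp add: \<Psi>_def A.diff A.add AT algebra_simps)
      then have "norm (\<Psi> k - \<Psi> k') \<le> q * norm (T (k - k'))"
        using strict[of "a + t *\<^sub>R u + T k" "a + t *\<^sub>R u + T k'"] inb(1)[OF that(1)] inb(1)[OF that(2)] d(1)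
        by (simp add: T.diff norm_minus_commute)
      also have "\<dots> \<le> q * (norm (k - k') * KT)" using KT(2) \<open>q > 0\<close> by (intro mult_left_mono) auto
      finally show ?thesis using KT(1) by (simp add: q_def)
    qed
    have "0 \<in> S" using \<open>e > 0\<close> by (simp add: S_def)
    \<comment> \<open>The tolerance e / (2 (norm u + 1)) is chosen for this bound: half of the
      radius of \<open>S\<close> is left for the contraction, so \<open>\<Psi>\<close> maps
      \<open>S\<close> into itself.\<close>
    have \<Psi>0: "norm (\<Psi> 0) \<le> e * \<bar>t\<bar> / 2"
    proof -
      have "norm (c (a + t *\<^sub>R u) - c a - A (t *\<^sub>R u)) \<le> e / (2 * (norm u + 1)) * (\<bar>t\<bar> * norm u)"
        using d(3)[of "a + t *\<^sub>R u"] tu \<delta>(1) by (simp add: dist_norm)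
      also have "\<dots> = (e * \<bar>t\<bar> / 2) * (norm u / (norm u + 1))" by (simp add: divide_simps)
      also have "\<dots> \<le> (e * \<bar>t\<bar> / 2) * 1"
        using \<open>e > 0\<close> by (intro mult_left_mono) (auto simp: divide_simps add_nonneg_pos)
      finally show ?thesis using u by (simp add: \<Psi>_def T.zero A.scaleR A.zero A_def[symmetric] norm_minus_commute)
    qed
    have "\<exists>!k\<in>S. \<Psi> k = k"
    proof (rule Banach_fix[where c = "1/2"])
      show "complete S" "S \<noteq> {}" using \<open>0 \<in> S\<close> by (auto simp: S_def complete_eq_closed)
      show "\<Psi> ` S \<subseteq> S"
      proof
        fix y assume "y \<in> \<Psi> ` S"
        then obtain k where k: "k \<in> S" "y = \<Psi> k" by blast
        have "norm (\<Psi> k) \<le> norm (\<Psi> k - \<Psi> 0) + norm (\<Psi> 0)"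
          using norm_triangle_ineq[of "\<Psi> k - \<Psi> 0" "\<Psi> 0"] by simp
        also have "\<dots> \<le> (1/2) * (e * \<bar>t\<bar>) + e * \<bar>t\<bar> / 2"
          using lip[OF k(1) \<open>0 \<in> S\<close>] k(1) \<Psi>0 by (simp add: S_def)
        finally show "y \<in> S" using k by (simp add: S_def)
      qed
    qed (use lip in \<open>auto simp: dist_norm\<close>)
    then obtain k where k: "k \<in> S" "\<Psi> k = k" by blast
    define z where "z = a + t *\<^sub>R u + T k"
    have "c z = c a" using k(2) by (simp add: \<Psi>_def z_def)
    have zd: "dist z a < d" using inb(1)[OF k(1)] by (simp add: z_def)
    then have "f a \<le> f z" using d2(2)[OF _ \<open>c z = c a\<close>] d(2) by simp
    have zn: "norm (z - a) \<le> \<bar>t\<bar> * (norm u + KT * e)" using inb(2)[OF k(1)] by (simp add: z_def add.assoc)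
    have "f z - f a - f' (z - a) \<le> e * norm (z - a)" using d(4)[OF zd] by (simp add: abs_le_iff)
    also have "\<dots> \<le> e * (\<bar>t\<bar> * (norm u + KT * e))" using zn \<open>e > 0\<close> by (intro mult_left_mono) auto
    finally have "f z - f a \<le> f' (t *\<^sub>R u) + f' (T k) + e * (\<bar>t\<bar> * (norm u + KT * e))"
      by (simp add: z_def add.assoc f'.add)
    moreover have "f' (T k) \<le> e * \<bar>t\<bar> * KF * KT"
    proof -
      have "f' (T k) \<le> norm (T k) * KF" using KF(2)[of "T k"] by simp
      also have "\<dots> \<le> (norm k * KT) * KF" using KT(2) KF(1) by (intro mult_right_mono) auto
      also have "\<dots> \<le> (e * \<bar>t\<bar> * KT) * KF" using k(1) KT(1) KF(1) by (intro mult_right_mono) (auto simp: S_def)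
      finally show ?thesis by (simp add: mult_ac)
    qed
    ultimately show ?thesis using \<open>f a \<le> f z\<close> by (simp add: algebra_simps)
  qed
  have bound: "\<bar>f' u\<bar> \<le> e * (KF * KT + norm u + KT * e)" if "e > 0" for e
  proof -
    have "e / (2 * (norm u + 1)) > 0" using \<open>e > 0\<close> by (simp add: add_nonneg_pos)
    moreover have "(c has_derivative A) (at a)" unfolding A_def by (rule twice_diff_has_derivative[OF c])
    ultimately obtain d3 where d3: "d3 > 0"
      "\<And>z. dist z a < d3 \<Longrightarrow> norm (c z - c a - A (z - a)) \<le> e / (2 * (norm u + 1)) * norm (z - a)"
      unfolding has_derivative_at_alt dist_norm by blast
    obtain d4 where d4: "d4 > 0" "\<And>z. dist z a < d4 \<Longrightarrow> norm (f z - f a - f' (z - a)) \<le> e * norm (z - a)"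
      using f \<open>e > 0\<close> unfolding has_derivative_at_alt dist_norm by blast
    define d where "d = Min {d1, d2, d3, d4}"
    have d: "d > 0" "d \<le> d1" "d \<le> d2" "d \<le> d3" "d \<le> d4" using d1 d2 d3 d4 by (auto simp: d_def)
    define \<delta> where "\<delta> = d / (norm u + KT * e + 1)"
    have den: "norm u + KT * e + 1 > 0" using KT \<open>e > 0\<close> by (simp add: add_nonneg_pos)
    then have "\<delta> > 0" using d by (simp add: \<delta>_def)
    have "\<delta> * (norm u + KT * e + 1) = d" using den by (simp add: \<delta>_def)
    then have d5: "\<delta> * (norm u + KT * e) < d" using \<open>\<delta> > 0\<close> by (simp add: algebra_simps)
    moreover have "\<delta> * norm u \<le> \<delta> * (norm u + KT * e)" using \<open>\<delta> > 0\<close> KT \<open>e > 0\<close> by simp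
    ultimately have d6: "\<delta> * norm u < d" by simp
    \<comment> \<open>Any modulus strictly between 0 and \<delta> would do; both signs are then
      inserted.\<close>
    have "f' (t *\<^sub>R u) \<ge> - (e * \<bar>t\<bar>) * (KF * KT + norm u + KT * e)" if "\<bar>t\<bar> = \<delta> / 2" for t
      by (rule curve[OF \<open>e > 0\<close> _ _ d6 d5]) (use that \<open>\<delta> > 0\<close> d d3(2) d4(2) in auto)
    from this[of "\<delta>/2"] this[of "-\<delta>/2"]
    have "(\<delta>/2) * f' u \<ge> - ((\<delta>/2) * (e * (KF * KT + norm u + KT * e)))"
      "(\<delta>/2) * f' u \<le> ((\<delta>/2) * (e * (KF * KT + norm u + KT * e)))"
      using \<open>\<delta> > 0\<close> by (simp_all add: f'.scaleR f'.neg mult_ac)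
    then have "(\<delta>/2) * \<bar>f' u\<bar> \<le> (\<delta>/2) * (e * (KF * KT + norm u + KT * e))"
      using \<open>\<delta> > 0\<close> by (simp only: abs_if split: if_split) (simp add: algebra_simps)
    then show ?thesis using \<open>\<delta> > 0\<close> by (simp only: mult_le_cancel_left_pos half_gt_zero)
  qed
  have "((\<lambda>e. e * (KF * KT + norm u + KT * e)) \<longlongrightarrow> 0 * (KF * KT + norm u + KT * 0)) (at_right 0)"
    by (intro tendsto_intros)
  then have "\<bar>f' u\<bar> \<le> 0 * (KF * KT + norm u + KT * 0)"
    by (rule tendsto_lowerbound)
       (use bound in \<open>auto intro: eventually_mono[OF eventually_at_right_less[of "0::real"]]\<close>)
  then show ?thesis by simp
qed

text \<open>The uniform solution bound makes an injective \<open>S t\<close> bounded below by 1/K,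
  so injectivity survives perturbations of size 1/(2K). As this works in both directions,
  injectivity is locally constant on the connected interval.\<close>

lemma inj_along_path:
  fixes S :: "real \<Rightarrow> 'a::real_normed_vector \<Rightarrow> 'b::real_normed_vector"
  assumes lin: "\<And>t. 0 \<le> t \<Longrightarrow> t \<le> 1 \<Longrightarrow> linear (S t)"
    and cont: "\<And>t e. 0 \<le> t \<Longrightarrow> t \<le> 1 \<Longrightarrow> e > 0 \<Longrightarrow>
      \<forall>\<^sub>F s in at t within {0..1}. \<forall>k. norm (S s k - S t k) \<le> e * norm k"
    and sol: "\<And>t h. 0 \<le> t \<Longrightarrow> t \<le> 1 \<Longrightarrow> \<exists>k. S t k = h \<and> norm k \<le> K * norm h"
    and "K > 0" and inj: "inj (S 0)"
  shows "inj (S 1)"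
proof -
  have below: "norm k \<le> K * norm (S t k)" if "0 \<le> t" "t \<le> 1" "inj (S t)" for t k
    using sol[OF that(1,2), of "S t k"] injD[OF that(3)] by metis
  have trans: "inj (S s)"
    if st: "0 \<le> t" "t \<le> 1" "inj (S t)" "0 \<le> s" "s \<le> 1" "\<And>k. norm (S s k - S t k) \<le> (1 / (2 * K)) * norm k" for s t
  proof -
    interpret s: linear "S s" using lin that by auto
    have "k = 0" if "S s k = 0" for k
    proof -
      have "norm k \<le> K * norm (S t k)" by (rule below[OF st(1-3)])
      also have "\<dots> \<le> K * ((1 / (2 * K)) * norm k)" using st(6)[of k] that \<open>K > 0\<close> by (intro mult_left_mono) auto
      also have "\<dots> = norm k / 2" using \<open>K > 0\<close> by simp
      finally show ?thesis by simp
    qed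
    then show ?thesis by (simp add: s.inj_iff_eq_0)
  qed
  have "inj (S 0) = inj (S 1)"
  proof (rule connected_local_const[of "{0..1::real}" 0 1 "\<lambda>t. inj (S t)"])
    have "\<forall>\<^sub>F s in at t within {0..1}. inj (S t) = inj (S s)" if "t \<in> {0..1}" for t
    proof -
      have "\<forall>\<^sub>F s in at t within {0..1}. s \<in> {0..1}" by (simp add: eventually_at_filter)
      moreover have "\<forall>\<^sub>F s in at t within {0..1}. \<forall>k. norm (S s k - S t k) \<le> (1 / (2 * K)) * norm k"
        using cont[of t "1 / (2 * K)"] that \<open>K > 0\<close> by simp
      ultimately show ?thesis
      proof eventually_elim
        case (elim s)
        then show ?case using trans[of t s] trans[of s t] that by (auto simp: norm_minus_commute)
      qed
    qed
    then show "\<forall>a\<in>{0..1}. \<forall>\<^sub>F b in at a within {0..1}. inj (S a) = inj (S b)" by blast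
  qed auto
  then show ?thesis using inj by simp
qed

section \<open>Coordinate representations\<close>

lemma chart_inv_std [simp]: "chart_inv (UNIV, id) = id"
  by (simp add: chart_inv_def)

lemma chart_at_std [simp]: "chart_at std_atlas u = (UNIV, id)"
  unfolding chart_at_def std_atlas_def by (rule some_equality) auto

lemma continuous_on_open_tendsto_nhds:
  assumes "continuous_on W h" "open W" "x \<in> W"
  shows "(h \<longlongrightarrow> h x) (nhds x)"
proof -
  have "(h \<longlongrightarrow> h x) (at x)"
    using assms by (metis at_within_open continuous_on_def)
  then show ?thesis by (simp add: tendsto_at_iff_tendsto_nhds)
qed

lemma C2_atlas_std: "C2_atlas (std_atlas :: ('e::{real_inner, banach}, 'e) chart set)"
proof -
  have "C2_open UNIV (id :: 'e \<Rightarrow> 'e)"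
    unfolding C2_open_def
    by (intro conjI exI[of _ "\<lambda>_. id_blinfun"] exI[of _ "\<lambda>_. 0"])
       (auto simp: id_def zero_blinfun.rep_eq)
  then show ?thesis
    by (auto simp: C2_atlas_def std_atlas_def homeomorphism_ident[unfolded id_def[symmetric]] intro!: homeomorphism_ident)
qed

lemma std_chart: "(UNIV, id) \<in> std_atlas" by (simp add: std_atlas_def)

context
  fixes A :: "('m::topological_space, 'e::{real_inner, banach}) chart set"
  assumes A: "C2_atlas A"
begin

lemma chart_at: "chart_at A x \<in> A" "x \<in> fst (chart_at A x)"
proof -
  have "\<exists>K. K \<in> A \<and> x \<in> fst K" using A unfolding C2_atlas_def by blast
  then have "chart_at A x \<in> A \<and> x \<in> fst (chart_at A x)" unfolding chart_at_def by (rule someI_ex)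
  then show "chart_at A x \<in> A" "x \<in> fst (chart_at A x)" by auto
qed

lemma chart_inv_left [simp]: "K \<in> A \<Longrightarrow> x \<in> fst K \<Longrightarrow> chart_inv K (snd K x) = x"
  using A unfolding C2_atlas_def homeomorphism_def by blast

lemma open_chart: "K \<in> A \<Longrightarrow> open (fst K)"
  using A unfolding C2_atlas_def by blast

lemma inj_chart: "K \<in> A \<Longrightarrow> inj_on (snd K) (fst K)"
  by (metis chart_inv_left inj_onI)

lemma eventually_chart_inv:
  assumes "K \<in> A" "x \<in> fst K" "eventually Q (nhds x)"
  shows "\<forall>\<^sub>F w in nhds (snd K x). chart_inv K w \<in> fst K \<and> snd K (chart_inv K w) = w \<and> Q (chart_inv K w)"
proof -
  have h: "open (snd K ` fst K)" "continuous_on (snd K ` fst K) (chart_inv K)"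
    using A assms(1) unfolding C2_atlas_def homeomorphism_def by blast+
  have "(chart_inv K \<longlongrightarrow> x) (nhds (snd K x))"
    using continuous_on_open_tendsto_nhds[OF h(2,1), of "snd K x"] assms(1,2) by simp
  then have 1: "\<forall>\<^sub>F w in nhds (snd K x). Q (chart_inv K w)"
    using assms(3) unfolding filterlim_iff by blast
  have "\<forall>\<^sub>F w in nhds (snd K x). w \<in> snd K ` fst K"
    using h(1) assms(2) by (intro eventually_nhds_in_open) auto
  then show ?thesis using 1 by eventually_elim (use assms in auto)
qed

lemma transition_twice_diff:
  assumes "K \<in> A" "L \<in> A" "x \<in> fst K" "x \<in> fst L"
  shows "twice_diff (snd L \<circ> chart_inv K) (snd K x)"
proof -
  have "C2_open (snd K ` (fst K \<inter> fst L)) (snd L \<circ> chart_inv K)"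
    using A assms unfolding C2_atlas_def by blast
  then show ?thesis by (rule C2_open_twice_diff) (use assms in blast)
qed

end

lemma tendsto_eventually: "(g \<longlongrightarrow> l) F \<Longrightarrow> eventually Q (nhds l) \<Longrightarrow> \<forall>\<^sub>F x in F. Q (g x)"
  unfolding filterlim_iff by blast

text \<open>At interior points the local C2 extension agrees with the map on a whole neighbourhood,
  so it has the same derivatives.\<close>

lemma C2_map_cong_nhds:
  assumes "C2_map A B S g" "x \<in> interior S"
  obtains W h where "open W" "x \<in> W" "\<And>u. u \<in> W \<Longrightarrow> h u = g u" "continuous_on W h"
    "\<And>K L. K \<in> A \<Longrightarrow> L \<in> B \<Longrightarrow> twice_diff (snd L \<circ> h \<circ> chart_inv K) (snd K x) \<or> x \<notin> fst K \<or> g x \<notin> fst L"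
proof -
  have "x \<in> S" using assms(2) interior_subset by blast
  from assms(1)[unfolded C2_map_def, rule_format, OF this]
  obtain W h where W: "open W" "x \<in> W" "\<And>u. u \<in> S \<inter> W \<Longrightarrow> h u = g u" "continuous_on W h"
    "\<And>K L. K \<in> A \<Longrightarrow> L \<in> B \<Longrightarrow>
        C2_open (snd K ` {u \<in> W \<inter> fst K. h u \<in> fst L}) (snd L \<circ> h \<circ> chart_inv K)"
    by blast
  show thesis
  proof (rule that[of "W \<inter> interior S" h])
    show "continuous_on (W \<inter> interior S) h" using W(4) continuous_on_subset by blast
    show "h u = g u" if "u \<in> W \<inter> interior S" for u using W(3) that interior_subset by blast
    show "twice_diff (snd L \<circ> h \<circ> chart_inv K) (snd K x) \<or> x \<notin> fst K \<or> g x \<notin> fst L"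
      if "K \<in> A" "L \<in> B" for K L
      using C2_open_twice_diff[OF W(5)[OF that], of "snd K x"] W(2) W(3)[of x] \<open>x \<in> S\<close> by auto
  qed (use W assms in auto)
qed

lemma C2_map_tendsto:
  assumes "C2_map A B S g" "x \<in> interior S"
  shows "(g \<longlongrightarrow> g x) (nhds x)"
proof -
  obtain W h where W: "open W" "x \<in> W" "\<And>u. u \<in> W \<Longrightarrow> h u = g u" "continuous_on W h"
    using C2_map_cong_nhds[OF assms] by metis
  have "(h \<longlongrightarrow> g x) (nhds x)"
    using continuous_on_open_tendsto_nhds[OF W(4,1,2)] W(3)[OF W(2)] by simp
  moreover have "\<forall>\<^sub>F u in nhds x. h u = g u"
    using eventually_nhds_in_open[OF W(1,2)] by (rule eventually_mono) (rule W(3))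
  ultimately show ?thesis by (rule Lim_transform_eventually)
qed

lemma C2_map_twice_diff:
  assumes "C2_atlas A" "C2_map A B S g" "x \<in> interior S" "K \<in> A" "x \<in> fst K" "L \<in> B" "g x \<in> fst L"
  shows "twice_diff (snd L \<circ> g \<circ> chart_inv K) (snd K x)"
proof -
  obtain W h where W: "open W" "x \<in> W" "\<And>u. u \<in> W \<Longrightarrow> h u = g u"
    "\<And>K L. K \<in> A \<Longrightarrow> L \<in> B \<Longrightarrow> twice_diff (snd L \<circ> h \<circ> chart_inv K) (snd K x) \<or> x \<notin> fst K \<or> g x \<notin> fst L"
    using C2_map_cong_nhds[OF assms(2,3)] by metis
  show ?thesis
  proof (rule twice_diff_cong)
    show "twice_diff (snd L \<circ> h \<circ> chart_inv K) (snd K x)" using W(4) assms by blast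
    show "\<forall>\<^sub>F w in nhds (snd K x). (snd L \<circ> h \<circ> chart_inv K) w = (snd L \<circ> g \<circ> chart_inv K) w"
      using eventually_chart_inv[OF assms(1,4,5) eventually_nhds_in_open[OF W(1,2)]]
      by eventually_elim (use W(3) in simp)
  qed
qed

lemmas C2_map_twice_diff_std_dom =
  C2_map_twice_diff[OF C2_atlas_std _ _ std_chart, simplified]

lemma C2_map_twice_diff_std_cod:
  "C2_atlas A \<Longrightarrow> C2_map A std_atlas S g \<Longrightarrow> x \<in> interior S \<Longrightarrow> K \<in> A \<Longrightarrow> x \<in> fst K \<Longrightarrow>
    twice_diff (g \<circ> chart_inv K) (snd K x)"
  using C2_map_twice_diff[of A std_atlas S g x K "(UNIV, id)"] by (simp add: std_chart)

text \<open>Pointwise twice differentiability makes the derivative continuous along the path in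
  operator norm, and the image of the compact interval is bounded.\<close>

lemma D1_bounded_along_path:
  fixes \<gamma> :: "real \<Rightarrow> 'a::real_normed_vector"
  assumes "\<And>t. t \<in> {0..1} \<Longrightarrow> twice_diff g (\<gamma> t)" "continuous_on {0..1} \<gamma>"
  obtains M where "M > 0" "\<And>t v. t \<in> {0..1} \<Longrightarrow> norm (D1 g (\<gamma> t) v) \<le> M * norm v"
    "\<And>t e. t \<in> {0..1} \<Longrightarrow> e > 0 \<Longrightarrow>
       \<forall>\<^sub>F s in at t within {0..1}. \<forall>v. norm (D1 g (\<gamma> s) v - D1 g (\<gamma> t) v) \<le> e * norm v"
proof -
  have ev: "\<forall>\<^sub>F s in at t within {0..1}. \<forall>v. norm (D1 g (\<gamma> s) v - D1 g (\<gamma> t) v) \<le> e * norm v"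
    if t: "t \<in> {0..1}" "e > 0" for t e
  proof -
    obtain d where d: "d > 0" "\<And>z v. dist z (\<gamma> t) < d \<Longrightarrow> norm (D1 g z v - D1 g (\<gamma> t) v) \<le> e * norm v"
      using twice_diff_continuous_D1[OF assms(1)[OF t(1)] t(2)] by metis
    have "\<forall>\<^sub>F s in at t within {0..1}. dist (\<gamma> s) (\<gamma> t) < d"
      using assms(2) t d(1) unfolding continuous_on_def by (intro tendstoD) auto
    then show ?thesis by (rule eventually_mono) (use d(2) in blast)
  qed
  define b where "b t = Blinfun (D1 g (\<gamma> t))" for t
  have b: "blinfun_apply (b t) = D1 g (\<gamma> t)" if "t \<in> {0..1}" for t
    unfolding b_def using twice_diff_bounded_linear_D1[OF assms(1)[OF that]]
    by (rule bounded_linear_Blinfun_apply)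
  have "continuous_on {0..1} b"
    unfolding continuous_on_def
  proof (intro ballI tendstoI)
    fix t e :: real assume t: "t \<in> {0..1}" and "e > 0"
    have "\<forall>\<^sub>F s in at t within {0..1}. s \<in> {0..1}" by (simp add: eventually_at_filter)
    moreover have "\<forall>\<^sub>F s in at t within {0..1}. \<forall>v. norm (D1 g (\<gamma> s) v - D1 g (\<gamma> t) v) \<le> (e/2) * norm v"
      using ev[OF t, of "e/2"] \<open>e > 0\<close> by simp
    ultimately show "\<forall>\<^sub>F s in at t within {0..1}. dist (b s) (b t) < e"
    proof eventually_elim
      case (elim s)
      have "norm (b s - b t) \<le> e / 2"
        by (rule norm_blinfun_bound) (use elim \<open>e > 0\<close> in \<open>simp_all add: blinfun.diff_left b[OF t] b\<close>)
      then show ?case using \<open>e > 0\<close> by (simp add: dist_norm)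
    qed
  qed
  then have "bounded (b ` {0..1})" by (intro compact_imp_bounded compact_continuous_image) auto
  then obtain M where M: "\<And>t. t \<in> {0..1} \<Longrightarrow> norm (b t) \<le> M" unfolding bounded_iff by blast
  have "norm (D1 g (\<gamma> t) v) \<le> (\<bar>M\<bar> + 1) * norm v" if "t \<in> {0..1}" for t v
  proof -
    have "norm (D1 g (\<gamma> t) v) \<le> norm (b t) * norm v" using norm_blinfun[of "b t" v] b[OF that] by simp
    also have "\<dots> \<le> (\<bar>M\<bar> + 1) * norm v" using M[OF that] by (intro mult_right_mono) auto
    finally show ?thesis .
  qed
  then show thesis using that[of "\<bar>M\<bar> + 1"] ev by simp
qed

section \<open>The problem read in charts\<close>

lemma local_retractionD:
  assumes "local_retraction A x V r"
  shows "0 \<in> interior V" "C2_map std_atlas A V r" "r 0 = x" "has_tangent_map std_atlas A r 0 (\<lambda>v. v)"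
  using assms by (simp_all add: local_retraction_def)

lemma local_stratificationD:
  assumes "local_stratification A y U s"
  shows "y \<in> interior U" "C2_map A std_atlas U s" "s y = 0" "has_tangent_map A std_atlas s y (\<lambda>v. v)"
  using assms by (simp_all add: local_stratification_def)

locale problem =
  fixes P :: "('x::topological_space, 'y::topological_space,
               'e::{real_inner, banach}, 'h::{real_inner, banach}) eq_problem"
  assumes setting: "eq_setting P"
begin

sublocale ip: compatible_ip "ip P x"
  rewrites "compatible_ip.n (ip P x) = nrm P x" for x
proof -
  show 1: "compatible_ip (ip P x)"
    using setting by unfold_locales (simp add: eq_setting_def)
  show "compatible_ip.n (ip P x) = nrm P x"
    by (rule ext) (simp add: compatible_ip.n_def[OF 1] nrm_def)
qed

lemma pinv_eq: "ip.pinv x = pseudo_inv P x"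
  by (intro ext) (simp add: ip.pinv_def pseudo_inv_def)

context
  fixes A :: "'e \<Rightarrow> 'h"
  assumes A: "bounded_linear A" "surj A"
begin

lemma A_pseudo_inv: "A (pseudo_inv P x A w) = w"
  using ip.A_pinv[OF A, of x] by (simp add: pinv_eq)

lemma pseudo_inv_orthogonal: "A u = 0 \<Longrightarrow> ip P x (pseudo_inv P x A w) u = 0"
  using ip.pinv_orthogonal[OF A, of u x] by (simp add: pinv_eq)

lemma bounded_linear_pseudo_inv: "bounded_linear (pseudo_inv P x A)"
  using ip.bounded_linear_pinv[OF A, of x] by (simp add: pinv_eq)

end

lemma atlas_X: "C2_atlas (atlas_X P)" and atlas_Y: "C2_atlas (atlas_Y P)"
  using setting by (simp_all add: eq_setting_def)

lemma cost_C2: "C2_map (atlas_X P) std_atlas UNIV (cost P)"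
  and constr_C2: "C2_map (atlas_X P) (atlas_Y P) UNIV (constr P)"
  using setting by (simp_all add: eq_setting_def)

lemma retr_C2: "C2_map std_atlas (atlas_X P) (retr_dom P x) (retr P x)"
  and retr_0 [simp]: "retr P x 0 = x"
  and retr_dom_0: "0 \<in> interior (retr_dom P x)"
  and retr_tangent: "has_tangent_map std_atlas (atlas_X P) (retr P x) 0 (\<lambda>v. v)"
  using setting by (simp_all add: eq_setting_def local_retraction_def)

lemma retr_o: "\<exists>W. local_retraction (atlas_X P) x W (retr_o P x)"
  using setting by (simp add: eq_setting_def)

lemma strat_C2: "C2_map (atlas_Y P) std_atlas UNIV (strat P (constr P x))"
  and strat_0 [simp]: "strat P (constr P x) (constr P x) = 0"
  and strat_tangent: "has_tangent_map (atlas_Y P) std_atlas (strat P (constr P x)) (constr P x) (\<lambda>v. v)"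
  using setting by (simp_all add: eq_setting_def local_stratification_def)

lemma strat_o: "\<exists>V. local_stratification (atlas_Y P) (constr P x) V (strat_o P (constr P x))"
  using setting by (simp add: eq_setting_def)

lemma retr_diffeo: "local_diffeo_on std_atlas (atlas_X P) (retr_inv_dom P x) (retr P x) 0"
  using setting by (simp_all add: eq_setting_def)

abbreviation "KX \<equiv> chart_at (atlas_X P)"
abbreviation "KY \<equiv> chart_at (atlas_Y P)"

lemmas KX = chart_at[OF atlas_X]
lemmas KY = chart_at[OF atlas_Y]

lemma eventually_retr:
  assumes "v \<in> interior (retr_dom P x)" "eventually Q (nhds (retr P x v))"
  shows "\<forall>\<^sub>F u in nhds v. Q (retr P x u)"
  by (rule tendsto_eventually[OF C2_map_tendsto[OF retr_C2 assms(1)] assms(2)])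

lemma constr_tendsto: "(constr P \<longlongrightarrow> constr P u) (nhds u)"
  by (rule C2_map_tendsto[OF constr_C2]) simp

lemma eventually_in_chart_X: "K \<in> atlas_X P \<Longrightarrow> u \<in> fst K \<Longrightarrow> \<forall>\<^sub>F z in nhds u. z \<in> fst K"
  by (intro eventually_nhds_in_open open_chart[OF atlas_X])

lemma eventually_in_chart_Y: "K \<in> atlas_Y P \<Longrightarrow> u \<in> fst K \<Longrightarrow> \<forall>\<^sub>F z in nhds u. z \<in> fst K"
  by (intro eventually_nhds_in_open open_chart[OF atlas_Y])

text \<open>Coordinate forms of retraction, cost, constraint and stratification. The charts stay
  parameters: derivatives at 0 are computed in the charts at \<open>x\<close>, whereas
  \<open>critical_in_pullback\<close> works along a segment in the charts at the solution.\<close>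

definition "Rc K x = snd K \<circ> retr P x"
definition "Fc K = cost P \<circ> chart_inv K"
definition "Cc K L = snd L \<circ> constr P \<circ> chart_inv K"
definition "Sc L y = strat P y \<circ> chart_inv L"

lemma twice_diff_Rc:
  "v \<in> interior (retr_dom P x) \<Longrightarrow> K \<in> atlas_X P \<Longrightarrow> retr P x v \<in> fst K \<Longrightarrow> twice_diff (Rc K x) v"
  unfolding Rc_def by (rule C2_map_twice_diff_std_dom[OF retr_C2])

lemma twice_diff_Fc: "K \<in> atlas_X P \<Longrightarrow> u \<in> fst K \<Longrightarrow> twice_diff (Fc K) (snd K u)"
  unfolding Fc_def by (rule C2_map_twice_diff_std_cod[OF atlas_X cost_C2]) auto

lemma twice_diff_Cc:
  "K \<in> atlas_X P \<Longrightarrow> u \<in> fst K \<Longrightarrow> L \<in> atlas_Y P \<Longrightarrow> constr P u \<in> fst L \<Longrightarrow>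
    twice_diff (Cc K L) (snd K u)"
  unfolding Cc_def by (rule C2_map_twice_diff[OF atlas_X constr_C2]) auto

lemma twice_diff_Sc: "L \<in> atlas_Y P \<Longrightarrow> y \<in> fst L \<Longrightarrow> twice_diff (Sc L (constr P x)) (snd L y)"
  unfolding Sc_def by (rule C2_map_twice_diff_std_cod[OF atlas_Y strat_C2]) auto

context
  fixes x v K L
  assumes v: "v \<in> interior (retr_dom P x)"
    and K: "K \<in> atlas_X P" "retr P x v \<in> fst K"
    and L: "L \<in> atlas_Y P" "constr P (retr P x v) \<in> fst L"
begin

lemma pull_f_eq: "\<forall>\<^sub>F u in nhds v. (Fc K \<circ> Rc K x) u = pull_f P x u"
  using eventually_retr[OF v eventually_in_chart_X[OF K]]
  by eventually_elim (simp add: Fc_def Rc_def pull_f_def chart_inv_left[OF atlas_X K(1)])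

lemma CR_eq: "\<forall>\<^sub>F u in nhds v. (Cc K L \<circ> Rc K x) u = snd L (constr P (retr P x u))"
  using eventually_retr[OF v eventually_in_chart_X[OF K]]
  by eventually_elim (simp add: Cc_def Rc_def chart_inv_left[OF atlas_X K(1)])

lemma pull_c_eq:
  "\<forall>\<^sub>F u in nhds v. (Sc L (constr P x) \<circ> (Cc K L \<circ> Rc K x)) u
      + - strat P (constr P x) (target P) = pull_c P x u"
proof -
  have "\<forall>\<^sub>F u in nhds v. constr P (retr P x u) \<in> fst L"
    using eventually_retr[OF v tendsto_eventually[OF constr_tendsto eventually_in_chart_Y[OF L]]] .
  then show ?thesis using CR_eq
    by eventually_elim (simp add: Sc_def pull_c_def chart_inv_left[OF atlas_Y L(1)])
qed

lemma at_v:
  "Rc K x v = snd K (retr P x v)" "Cc K L (Rc K x v) = snd L (constr P (retr P x v))"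
  by (simp_all add: Rc_def Cc_def chart_inv_left[OF atlas_X K])

lemma twice_diff_at_v:
  "twice_diff (Rc K x) v" "twice_diff (Fc K) (Rc K x v)" "twice_diff (Cc K L) (Rc K x v)"
  "twice_diff (Cc K L \<circ> Rc K x) v" "twice_diff (Sc L (constr P x)) (Cc K L (Rc K x v))"
proof -
  show 1: "twice_diff (Rc K x) v" using v K by (rule twice_diff_Rc)
  show "twice_diff (Fc K) (Rc K x v)" unfolding at_v by (rule twice_diff_Fc[OF K])
  show 2: "twice_diff (Cc K L) (Rc K x v)" unfolding at_v by (rule twice_diff_Cc[OF K L])
  show "twice_diff (Cc K L \<circ> Rc K x) v" using 1 2 by (rule twice_diff_compose)
  show "twice_diff (Sc L (constr P x)) (Cc K L (Rc K x v))"
    unfolding at_v(2) by (rule twice_diff_Sc[OF L])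
qed

lemma twice_diff_pull_f: "twice_diff (pull_f P x) v"
  by (rule twice_diff_cong[OF pull_f_eq]) (intro twice_diff_compose twice_diff_at_v)

lemma twice_diff_pull_c: "twice_diff (pull_c P x) v"
  by (rule twice_diff_cong[OF pull_c_eq])
     (intro twice_diff_add_const twice_diff_compose[of "Cc K L \<circ> Rc K x"] twice_diff_at_v, simp add: twice_diff_at_v)

lemma D1_pull_f: "D1 (pull_f P x) v w = D1 (Fc K) (snd K (retr P x v)) (D1 (Rc K x) v w)"
  unfolding D1_cong[OF pull_f_eq, symmetric] at_v[symmetric] by (intro D1_compose twice_diff_at_v)

lemma D1_CR: "D1 (Cc K L \<circ> Rc K x) v w = D1 (Cc K L) (snd K (retr P x v)) (D1 (Rc K x) v w)"
  unfolding at_v[symmetric] by (intro D1_compose twice_diff_at_v)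

lemma D1_pull_c: "D1 (pull_c P x) v w =
    D1 (Sc L (constr P x)) (snd L (constr P (retr P x v))) (D1 (Cc K L \<circ> Rc K x) v w)"
proof -
  have S: "twice_diff (Sc L (constr P x)) ((Cc K L \<circ> Rc K x) v)" by (simp add: twice_diff_at_v)
  have "(Cc K L \<circ> Rc K x) v = snd L (constr P (retr P x v))" by (simp add: at_v(2))
  then show ?thesis
    unfolding D1_cong[OF pull_c_eq, symmetric]
    by (subst twice_diff_add_const(2)[OF twice_diff_compose[OF twice_diff_at_v(4) S]])
       (simp only: D1_compose[OF twice_diff_at_v(4) S])
qed

end

lemmas twice_diff_pull =
  twice_diff_pull_f[OF _ KX KY] twice_diff_pull_c[OF _ KX KY]

lemma D1_Rc_0: "D1 (Rc (KX x) x) 0 w = w"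
  using D1_eq[OF retr_tangent[of x, unfolded has_tangent_map_def, simplified]] by (simp add: Rc_def)

lemma D1_Sc: "D1 (Sc (KY (constr P x)) (constr P x)) (snd (KY (constr P x)) (constr P x)) w = w"
  using D1_eq[OF strat_tangent[of x, unfolded has_tangent_map_def, simplified]] by (simp add: Sc_def)

text \<open>In the chart at \<open>x\<close> the retraction has the identity as derivative at 0,
  which leaves the derivative of the cost alone; for \<open>dc\<close> the same holds with the
  stratification.\<close>

lemma df_eq: "df P x w = D1 (Fc (KX x)) (snd (KX x) x) w"
  unfolding df_def using D1_pull_f[OF retr_dom_0, of "KX x" x] KX D1_Rc_0 
  by (metis (no_types, lifting) retr_0 KY)

lemma dc_eq: "dc P x w = D1 (Cc (KX x) (KY (constr P x))) (snd (KX x) x) w"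
  unfolding dc_def
  using D1_pull_c[OF retr_dom_0, of "KX x" x "KY (constr P x)"] D1_CR[OF retr_dom_0, of "KX x" x "KY (constr P x)"]
    KX KY D1_Rc_0[of x] D1_Sc[of x] by simp

lemma dc_bounded_linear: "bounded_linear (dc P x)" and df_bounded_linear: "bounded_linear (df P x)"
  unfolding dc_def df_def by (intro twice_diff_bounded_linear_D1 twice_diff_pull retr_dom_0)+

lemma multiplier_bounded_linear:
  assumes "surj (dc P x)"
  shows "bounded_linear (multiplier P x)"
  unfolding multiplier_def[abs_def]
  by (intro bounded_linear_minus bounded_linear_compose[OF df_bounded_linear]
      bounded_linear_pseudo_inv[OF dc_bounded_linear assms])

end

section \<open>Derivatives of the pullbacks\<close>

context problem
begin

lemma twice_diff_pull_L:
  assumes "bounded_linear p" "v \<in> interior (retr_dom P x)"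
  shows "twice_diff (pull_L P x p) v"
    and "D1 (pull_L P x p) v w = D1 (pull_f P x) v w + p (D1 (pull_c P x) v w)"
proof -
  have c: "twice_diff p (pull_c P x v)" by (rule bounded_linear_twice_diff(1)[OF assms(1)])
  have eq: "pull_L P x p = (\<lambda>u. pull_f P x u + (p \<circ> pull_c P x) u)" by (auto simp: pull_L_def)
  show "twice_diff (pull_L P x p) v"
    unfolding eq by (intro twice_diff_add twice_diff_pull twice_diff_compose c assms)
  have "D1 (pull_L P x p) v w = D1 (pull_f P x) v w + D1 (p \<circ> pull_c P x) v w"
    unfolding eq by (intro D1_add twice_diff_pull twice_diff_compose c assms)
  then show "D1 (pull_L P x p) v w = D1 (pull_f P x) v w + p (D1 (pull_c P x) v w)"
    by (simp add: D1_compose[OF twice_diff_pull(2)[OF assms(2)] c] bounded_linear_twice_diff(2)[OF assms(1)])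
qed

text \<open>
  In the charts \<open>K\<close> at \<open>x\<close> and \<open>L\<close> at \<open>c x\<close>, retractions and stratifications have the identity as
  derivative, so their choice enters second derivatives only through their own second derivatives.
\<close>

context
  fixes x :: 'x and p
  assumes p: "bounded_linear (p :: 'h \<Rightarrow> real)"
begin

private abbreviation "K \<equiv> KX x"
private abbreviation "L \<equiv> KY (constr P x)"
private abbreviation "a \<equiv> snd K x"
private abbreviation "b \<equiv> snd L (constr P x)"
private abbreviation "C \<equiv> Cc K L"
private abbreviation "F \<equiv> Fc K"

text \<open>The Lagrangian in charts, with the stratification as a parameter: the plain and the
  circled version then share one computation, and so do the two retractions in
  \<open>lag_retr\<close>.\<close>

private definition "lag S = (\<lambda>z. F z + (p \<circ> (S \<circ> C)) z)"

private lemma Ca: "C a = b"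
  by (simp add: Cc_def chart_inv_left[OF atlas_X] KX)

private lemma twice_diff_C: "twice_diff C a" and twice_diff_F: "twice_diff F a"
  by (intro twice_diff_Cc twice_diff_Fc KX KY)+

private lemma lag:
  assumes "twice_diff S b" "\<And>w. D1 S b w = w"
  shows "twice_diff (lag S) a"
    and "D1 (lag S) a w = dL P x p w"
    and "D2 (lag S) a v w = D2 F a v w + p (D2 S b (dc P x v) (dc P x w) + D2 C a v w)"
proof -
  have S: "twice_diff S (C a)" using assms(1) by (simp add: Ca)
  have SC: "twice_diff (S \<circ> C) a" by (rule twice_diff_compose[OF twice_diff_C S])
  have pt: "twice_diff p ((S \<circ> C) a)" by (rule bounded_linear_twice_diff(1)[OF p])
  have pSC: "twice_diff (p \<circ> (S \<circ> C)) a" by (rule twice_diff_compose[OF SC pt])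
  show "twice_diff (lag S) a" unfolding lag_def by (rule twice_diff_add[OF twice_diff_F pSC])
  show "D1 (lag S) a w = dL P x p w"
    unfolding lag_def D1_add[OF twice_diff_F pSC] D1_compose[OF SC pt]
      D1_compose[OF twice_diff_C S] bounded_linear_twice_diff(2)[OF p]
    by (simp add: Ca assms(2) dL_def df_eq dc_eq)
  show "D2 (lag S) a v w = D2 F a v w + p (D2 S b (dc P x v) (dc P x w) + D2 C a v w)"
    unfolding lag_def D2_add[OF twice_diff_F pSC] D2_compose[OF SC pt]
      D2_compose[OF twice_diff_C S] bounded_linear_twice_diff[OF p]
    by (simp add: Ca assms(2) dc_eq)
qed

private lemma lag_retr:
  assumes "twice_diff S b" "\<And>w. D1 S b w = w"
    and "twice_diff R 0" "R 0 = a" "\<And>w. D1 R 0 w = w"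
  shows "twice_diff (lag S \<circ> R) 0"
    and "D2 (lag S \<circ> R) 0 v w =
      D2 F a v w + p (D2 S b (dc P x v) (dc P x w) + D2 C a v w) + dL P x p (D2 R 0 v w)"
proof -
  have l: "twice_diff (lag S) (R 0)" using lag(1)[OF assms(1,2)] by (simp add: assms(4))
  show "twice_diff (lag S \<circ> R) 0" by (rule twice_diff_compose[OF assms(3) l])
  show "D2 (lag S \<circ> R) 0 v w =
      D2 F a v w + p (D2 S b (dc P x v) (dc P x w) + D2 C a v w) + dL P x p (D2 R 0 v w)"
    unfolding D2_compose[OF assms(3) l]
    by (simp add: assms(4,5) lag[OF assms(1,2)])
qed

private lemma D2_pull_L:
  "D2 (pull_L P x p) 0 v w = D2 F a v w +
     p (D2 (Sc L (constr P x)) b (dc P x v) (dc P x w) + D2 C a v w) + dL P x p (D2 (Rc K x) 0 v w)"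
proof -
  have S: "twice_diff (Sc L (constr P x)) b" by (intro twice_diff_Sc KY)
  have R: "twice_diff (Rc K x) 0" "Rc K x 0 = a"
    by (rule twice_diff_Rc[OF retr_dom_0]; simp add: KX) (simp add: Rc_def)
  note l = lag_retr[OF S D1_Sc R D1_Rc_0]
  have *: "\<forall>\<^sub>F u in nhds 0. (lag (Sc L (constr P x)) \<circ> Rc K x) u +
      - p (strat P (constr P x) (target P)) = pull_L P x p u"
  proof -
    have "\<forall>\<^sub>F u in nhds 0. (F \<circ> Rc K x) u = pull_f P x u"
      by (rule pull_f_eq[OF retr_dom_0]) (auto intro: KX KY)
    moreover have "\<forall>\<^sub>F u in nhds 0. (Sc L (constr P x) \<circ> (C \<circ> Rc K x)) u
      + - strat P (constr P x) (target P) = pull_c P x u"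
      by (rule pull_c_eq[OF retr_dom_0]) (auto intro: KX KY)
    ultimately show ?thesis
    proof eventually_elim
      case (elim u)
      have "p (s + - t) = p s + - p t" for s t 
        using p by (simp add: bounded_linear.linear linear_diff)
      then show ?case by (simp add: pull_L_def elim[symmetric] lag_def)
    qed
  qed
  then have "D2 (pull_L P x p) 0 v w = D2 (lag (Sc L (constr P x)) \<circ> Rc K x) 0 v w"
    unfolding D2_cong[symmetric, OF *] by (intro twice_diff_add_const l)
  then show ?thesis using l by simp
qed

private lemma pull_Lo:
  assumes W: "local_retraction (atlas_X P) x W (retr_o P x)"
    and V: "local_stratification (atlas_Y P) (constr P x) V (strat_o P (constr P x))"
  defines "Ro \<equiv> snd K \<circ> retr_o P x" and "So \<equiv> strat_o P (constr P x) \<circ> chart_inv L"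
  shows "twice_diff Ro 0" "Ro 0 = a" "\<And>w. D1 Ro 0 w = w"
    "twice_diff So b" "\<And>w. D1 So b w = w"
    "twice_diff (pull_Lo P x p) 0"
    "D2 (pull_Lo P x p) 0 v w = D2 F a v w +
     p (D2 So b (dc P x v) (dc P x w) + D2 C a v w) + dL P x p (D2 Ro 0 v w)"
proof -
  note W = local_retractionD[OF W] and V = local_stratificationD[OF V]
  show R: "twice_diff Ro 0"
    unfolding Ro_def by (rule C2_map_twice_diff_std_dom[OF W(2,1)]) (auto simp: W(3) KX)
  show R0: "Ro 0 = a" by (simp add: Ro_def W(3))
  show DR: "D1 Ro 0 w = w" for w
    using D1_eq[OF W(4)[unfolded has_tangent_map_def, simplified]] by (simp add: Ro_def W(3))
  show S: "twice_diff So b"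
    unfolding So_def by (rule C2_map_twice_diff_std_cod[OF atlas_Y V(2,1)]) (auto simp: KY)
  show DS: "D1 So b w = w" for w
    using D1_eq[OF V(4)[unfolded has_tangent_map_def, simplified]] by (simp add: So_def)
  note l = lag_retr[OF S DS R R0 DR]
  have ret: "(retr_o P x \<longlongrightarrow> x) (nhds 0)" using C2_map_tendsto[OF W(2,1)] by (simp add: W(3))
  have "\<forall>\<^sub>F u in nhds 0. retr_o P x u \<in> fst K"
    by (rule tendsto_eventually[OF ret eventually_in_chart_X[OF KX]])
  moreover have "\<forall>\<^sub>F u in nhds 0. constr P (retr_o P x u) \<in> fst L"
    by (rule tendsto_eventually[OF ret tendsto_eventually[OF constr_tendsto eventually_in_chart_Y[OF KY]]])
  ultimately have *: "\<forall>\<^sub>F u in nhds 0. (lag So \<circ> Ro) u +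
      - p (strat_o P (constr P x) (target P)) = pull_Lo P x p u"
  proof eventually_elim
    case (elim u)
    have "p (s - t) = p s + - p t" for s t 
      using p by (simp add: bounded_linear.linear linear_diff)
    then show ?case using elim
      by (simp add: pull_Lo_def lag_def So_def Ro_def Cc_def Fc_def chart_inv_left[OF atlas_X] chart_inv_left[OF atlas_Y] KX KY)
  qed
  show "twice_diff (pull_Lo P x p) 0"
    by (rule twice_diff_cong[OF *]) (intro twice_diff_add_const l)
  have "D2 (pull_Lo P x p) 0 v w = D2 (lag So \<circ> Ro) 0 v w"
    unfolding D2_cong[symmetric, OF *] by (intro twice_diff_add_const l)
  then show "D2 (pull_Lo P x p) 0 v w = D2 F a v w +
     p (D2 So b (dc P x v) (dc P x w) + D2 C a v w) + dL P x p (D2 Ro 0 v w)"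
    using l by simp
qed

lemma twice_diff_pull_Lo: "twice_diff (pull_Lo P x p) 0"
  using retr_o[of x] strat_o[of x] pull_Lo(6) by blast

text \<open>Near 0 the retraction is the circled one after \<Phi>, and both have identity
  derivative. The second order chain rule then reduces to adding second derivatives.\<close>

private lemma retr_transition:
  assumes "retr_transition P x \<Phi>" 
    and W: "local_retraction (atlas_X P) x W (retr_o P x)"
  shows "D2 (Rc K x) 0 v w = D2 (snd K \<circ> retr_o P x) 0 v w + D2 \<Phi> 0 v w"
proof -
  note W = local_retractionD[OF W]
  define Ro where "Ro = snd K \<circ> retr_o P x"
  obtain N where N: "local_diffeo_on std_atlas (atlas_X P) N (retr_o P x) 0"
    and \<Phi>: "\<Phi> = inv_into N (retr_o P x) \<circ> retr P x"
    using assms(1) unfolding retr_transition_def local_inverse_def by blast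
  define h where "h = inv_into N (retr_o P x)"
  have N': "0 \<in> N" "x \<in> interior (retr_o P x ` N)" "inj_on (retr_o P x) N"
    "C2_map (atlas_X P) std_atlas (retr_o P x ` N) h"
    using N interior_subset[of N] by (auto simp: local_diffeo_on_def W(3) h_def)
  have hx: "h x = 0" using N'(1,3) W(3) by (metis h_def inv_into_f_f)
  have h: "twice_diff (h \<circ> chart_inv K) (Rc K x 0)"
    using C2_map_twice_diff_std_cod[OF atlas_X N'(4,2) KX] by (simp add: Rc_def)
  have Rc: "twice_diff (Rc K x) 0"
    by (auto intro!: twice_diff_Rc retr_dom_0 KX)
  have ev: "\<forall>\<^sub>F u in nhds 0. retr P x u \<in> fst K"
    using eventually_retr[OF retr_dom_0, of "\<lambda>z. z \<in> fst K" x] eventually_in_chart_X[OF KX] by simp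
  then have e1: "\<forall>\<^sub>F u in nhds 0. ((h \<circ> chart_inv K) \<circ> Rc K x) u = \<Phi> u"
    by eventually_elim (simp add: \<Phi> h_def Rc_def chart_inv_left[OF atlas_X] KX)
  have \<Phi>2: "twice_diff \<Phi> 0"
    by (rule twice_diff_cong[OF e1 twice_diff_compose[OF Rc h]])
  have \<Phi>0: "\<Phi> 0 = 0" using hx by (simp add: \<Phi> h_def)
  have "\<forall>\<^sub>F u in nhds 0. retr P x u \<in> interior (retr_o P x ` N)"
    using eventually_retr[OF retr_dom_0, of "\<lambda>z. z \<in> interior (retr_o P x ` N)" x] N'(2) eventually_nhds_in_open
    by (metis open_interior retr_0)
  then have e2: "\<forall>\<^sub>F u in nhds 0. (Ro \<circ> \<Phi>) u = Rc K x u"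
  proof eventually_elim
    case (elim u)
    then have "retr P x u \<in> retr_o P x ` N" using interior_subset by blast
    then show ?case by (simp add: Ro_def Rc_def \<Phi> f_inv_into_f)
  qed
  have Ro: "twice_diff Ro (\<Phi> 0)" "\<And>w. D1 Ro 0 w = w"
  proof -
    show "twice_diff Ro (\<Phi> 0)"
      unfolding Ro_def \<Phi>0 by (rule C2_map_twice_diff_std_dom[OF W(2,1)]) (auto simp: W(3) KX)
    show "D1 Ro 0 w = w" for w
      using D1_eq[OF W(4)[unfolded has_tangent_map_def, simplified]] by (simp add: Ro_def W(3))
  qed
  have "D1 \<Phi> 0 w = w" for w
    using D1_compose[OF \<Phi>2 Ro(1), of w] D1_cong[OF e2] D1_Rc_0[of x w] by (simp add: \<Phi>0 Ro(2))
  moreover have "D2 (Ro \<circ> \<Phi>) 0 = D2 (Rc K x) 0" by (rule D2_cong[OF e2])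
  ultimately show ?thesis
    unfolding Ro_def[symmetric] using D2_compose[OF \<Phi>2 Ro(1), of v w] by (simp only: \<Phi>0 Ro(2))
qed

text \<open>Near \<open>c x\<close> the stratification is \<Psi> after the circled one. With
  \<Psi>'' = 0 and \<Psi>' the identity, the chain rule leaves the circled second
  derivative.\<close>

private lemma strat_transition:
  assumes "strat_transition P (constr P x) \<Psi>" "\<And>v w. D2 \<Psi> 0 v w = 0"
    and V: "local_stratification (atlas_Y P) (constr P x) V (strat_o P (constr P x))"
  shows "D2 (Sc L (constr P x)) b v w = D2 (strat_o P (constr P x) \<circ> chart_inv L) b v w"
proof -
  note V = local_stratificationD[OF V]
  let ?y = "constr P x"
  define So where "So = strat_o P ?y \<circ> chart_inv L"
  obtain N where N: "local_diffeo_on (atlas_Y P) std_atlas N (strat_o P ?y) ?y"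
    and \<Psi>: "\<Psi> = strat P ?y \<circ> inv_into N (strat_o P ?y)"
    using assms(1) unfolding strat_transition_def local_inverse_def by blast
  define h where "h = inv_into N (strat_o P ?y)"
  have N': "?y \<in> N" "0 \<in> interior (strat_o P ?y ` N)" "inj_on (strat_o P ?y) N" "?y \<in> interior N"
    "C2_map std_atlas (atlas_Y P) (strat_o P ?y ` N) h"
    using N interior_subset[of N] by (auto simp: local_diffeo_on_def V(3) h_def)
  have h0: "h 0 = ?y" using N'(1,3) V(3) by (metis h_def inv_into_f_f)
  have h: "twice_diff (snd L \<circ> h) 0"
    by (rule C2_map_twice_diff_std_dom[OF N'(5,2)]) (auto simp: h0 KY)
  have S: "twice_diff (Sc L ?y) ((snd L \<circ> h) 0)" by (auto simp: h0 intro!: twice_diff_Sc KY)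
  have ev: "\<forall>\<^sub>F u in nhds 0. h u \<in> fst L"
    using tendsto_eventually[OF C2_map_tendsto[OF N'(5,2)], unfolded h0, OF eventually_in_chart_Y[OF KY]] .
  then have e1: "\<forall>\<^sub>F u in nhds 0. (Sc L ?y \<circ> (snd L \<circ> h)) u = \<Psi> u"
    by eventually_elim (simp add: \<Psi> h_def Sc_def chart_inv_left[OF atlas_Y] KY)
  have So: "twice_diff So b" "\<And>w. D1 So b w = w" "So b = 0"
  proof -
    show "twice_diff So b"
      unfolding So_def by (rule C2_map_twice_diff_std_cod[OF atlas_Y V(2,1)]) (auto simp: KY)
    show "D1 So b w = w" for w
      using D1_eq[OF V(4)[unfolded has_tangent_map_def, simplified]] by (simp add: So_def)
    show "So b = 0" by (simp add: So_def chart_inv_left[OF atlas_Y] KY V(3))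
  qed
  have \<Psi>2: "twice_diff \<Psi> (So b)"
    unfolding So(3) by (rule twice_diff_cong[OF e1 twice_diff_compose[OF h S]])
  have e2: "\<forall>\<^sub>F u in nhds b. (\<Psi> \<circ> So) u = Sc L ?y u"
    using eventually_chart_inv[OF atlas_Y KY eventually_nhds_in_open[OF open_interior N'(4)]]
  proof eventually_elim
    case (elim u)
    then have "chart_inv L u \<in> N" using interior_subset by blast
    then show ?case using N'(3) by (simp add: \<Psi> So_def Sc_def)
  qed
  have "D1 \<Psi> 0 w = w" for w
    using D1_compose[OF So(1) \<Psi>2, of w] D1_cong[OF e2] D1_Sc[of x w] by (simp add: So)
  moreover have "D2 (\<Psi> \<circ> So) b = D2 (Sc L ?y) b" by (rule D2_cong[OF e2])
  ultimately show ?thesis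
    unfolding So_def[symmetric] using D2_compose[OF So(1) \<Psi>2, of v w] by (simp add: So(3) assms(2))
qed

text \<open>The stratifications enter through a bilinear form in \<open>dc P x v\<close> and
  \<open>dc P x w\<close>. It agrees for a consistent pair and vanishes if one argument is
  tangential, so only the second derivatives of the retractions remain, and these differ by
  \<Phi>''.\<close>

lemma hessian_difference:
  assumes "retr_transition P x \<Phi>"
    and "second_order_consistent P (constr P x) \<or> dc P x v = 0 \<or> dc P x w = 0"
  shows "D2 (pull_L P x p) 0 v w - D2 (pull_Lo P x p) 0 v w = dL P x p (D2 \<Phi> 0 v w)"
proof -
  obtain W where W: "local_retraction (atlas_X P) x W (retr_o P x)"
    using retr_o by blast
  obtain V where V: "local_stratification (atlas_Y P) (constr P x) V (strat_o P (constr P x))"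
    using strat_o by blast
  note Lo = pull_Lo[OF W V]
  let ?S = "Sc L (constr P x)" and ?So = "strat_o P (constr P x) \<circ> chart_inv L"
  have S: "twice_diff ?S b" by (intro twice_diff_Sc KY)
  interpret S: bounded_bilinear "D2 ?S b" by (rule twice_diff_bounded_bilinear_D2[OF S])
  interpret So: bounded_bilinear "D2 ?So b" by (rule twice_diff_bounded_bilinear_D2[OF Lo(4)])
  have "D2 ?S b (dc P x v) (dc P x w) = D2 ?So b (dc P x v) (dc P x w)"
  proof (cases "second_order_consistent P (constr P x)")
    case True
    then show ?thesis unfolding second_order_consistent_def using strat_transition[OF _ _ V] by blast
  next
    case False
    then show ?thesis using assms(2) by (auto simp: S.zero_left S.zero_right So.zero_left So.zero_right)
  qed
  moreover have "linear (dL P x p)"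
  proof -
    interpret c: bounded_linear "dc P x" by (rule dc_bounded_linear)
    interpret f: bounded_linear "df P x" by (rule df_bounded_linear)
    interpret p: bounded_linear p by (rule p)
    show ?thesis unfolding dL_def[abs_def]
      by (rule linearI) (simp_all add: c.add c.scaleR f.add f.scaleR p.add p.scaleR algebra_simps)
  qed
  ultimately show ?thesis
    unfolding D2_pull_L Lo(7) retr_transition[OF assms(1) W]
    by (simp add: linear_add)
qed

end

lemma hess_o:
  assumes "surj (dc P x)"
  shows hess_o_sym: "hess_o P x v w = hess_o P x w v"
    and hess_o_bilinear: "bounded_bilinear (hess_o P x)"
proof -
  note t = twice_diff_pull_Lo[OF multiplier_bounded_linear[OF assms], of x]
  show "hess_o P x v w = hess_o P x w v" unfolding hess_o_def by (rule D2_symmetric[OF t])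
  show "bounded_bilinear (hess_o P x)" unfolding hess_o_def by (rule twice_diff_bounded_bilinear_D2[OF t])
qed

text \<open>A chart of the target is injective, so equality of coordinates is feasibility and the
  minimizer remains one in coordinates. The stratification offers no such conclusion.\<close>

lemma critical_in_charts:
  assumes min: "local_minimizer P z" and surj: "surj (dc P z)"
    and u: "D1 (Cc (KX z) (KY (constr P z))) (snd (KX z) z) u = 0"
  shows "D1 (Fc (KX z)) (snd (KX z) z) u = 0"
proof -
  let ?K = "KX z" and ?L = "KY (constr P z)"
  let ?a = "snd ?K z"
  have Ca: "Cc ?K ?L ?a = snd ?L (constr P z)" and Fa: "Fc ?K ?a = cost P z"
    by (simp_all add: Cc_def Fc_def chart_inv_left[OF atlas_X] KX)
  have "\<forall>\<^sub>F x in nhds z. (constr P x = target P \<longrightarrow> cost P z \<le> cost P x) \<and> constr P x \<in> fst ?L"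
    using min unfolding local_minimizer_def
    by (intro eventually_conj tendsto_eventually[OF constr_tendsto eventually_in_chart_Y[OF KY]]) auto
  from eventually_chart_inv[OF atlas_X KX this]
  have ev: "\<forall>\<^sub>F w in nhds ?a. Cc ?K ?L w = Cc ?K ?L ?a \<longrightarrow> Fc ?K ?a \<le> Fc ?K w"
  proof eventually_elim
    case (elim w)
    show ?case
    proof
      assume "Cc ?K ?L w = Cc ?K ?L ?a"
      then have "snd ?L (constr P (chart_inv ?K w)) = snd ?L (constr P z)" unfolding Ca by (simp add: Cc_def)
      then have "constr P (chart_inv ?K w) = constr P z"
        using inj_onD[OF inj_chart[OF atlas_Y KY(1)]] elim KY(2) by blast
      then have "constr P (chart_inv ?K w) = target P"
        using min by (simp add: local_minimizer_def)
      then show "Fc ?K ?a \<le> Fc ?K w" using elim unfolding Fa by (simp add: Fc_def)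
    qed
  qed
  show ?thesis
  proof (rule constrained_local_minimum[OF _ _ _ ev u])
    show "(Fc ?K has_derivative D1 (Fc ?K) ?a) (at ?a)"
      by (intro twice_diff_has_derivative twice_diff_Fc KX)
    show "twice_diff (Cc ?K ?L) ?a" by (intro twice_diff_Cc KX KY)
    have "D1 (Cc ?K ?L) ?a = dc P z" by (rule ext) (simp add: dc_eq)
    then show "surj (D1 (Cc ?K ?L) ?a)" using surj by simp
  qed
qed

text \<open>
  The stratification need not be injective near \<open>c z\<close>, so criticality of \<open>z\<close> does not transfer
  to the pullbacks directly.  Along the segment from \<open>0\<close> to \<open>d\<close> the derivative of the pulled back
  constraint stays uniformly surjective, and it factors through the derivative of the
  stratification, which is injective at \<open>c x\<close> and hence along the whole segment.
\<close>

lemma critical_in_pullback: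
  assumes min: "local_minimizer P z" and surj_z: "surj (dc P z)" and surj_x: "surj (dc P x)"
    and d: "retr P x d = z"
    and dom: "\<And>t. t \<in> {0..1} \<Longrightarrow> t *\<^sub>R d \<in> interior (retr_dom P x)"
    and K: "\<And>t. t \<in> {0..1} \<Longrightarrow> retr P x (t *\<^sub>R d) \<in> fst (KX z)"
    and L: "\<And>t. t \<in> {0..1} \<Longrightarrow> constr P (retr P x (t *\<^sub>R d)) \<in> fst (KY (constr P z))"
    and small: "\<And>t v. t \<in> {0..1} \<Longrightarrow>
      nrm P x (pseudo_inv P x (dc P x) (D1 (pull_c P x) (t *\<^sub>R d) v - dc P x v)) \<le> nrm P x v / 2"
    and u: "D1 (pull_c P x) d u = 0"
  shows "D1 (pull_f P x) d u = 0"
proof -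
  let ?K = "KX z" and ?L = "KY (constr P z)"
  note KK = KX(1)[of z] and LL = KY(1)[of "constr P z"]
  let ?S = "Sc ?L (constr P x)" and ?T = "pseudo_inv P x (dc P x)"
  define G where "G = Cc ?K ?L \<circ> Rc ?K x"
  define w where "w t = snd ?L (constr P (retr P x (t *\<^sub>R d)))" for t
  define S where "S t = D1 ?S (w t)" for t
  have G: "twice_diff G (t *\<^sub>R d)" and GS: "G (t *\<^sub>R d) = w t" "twice_diff ?S (w t)"
    and Bt: "D1 (pull_c P x) (t *\<^sub>R d) v = S t (D1 G (t *\<^sub>R d) v)" if "t \<in> {0..1}" for t v
    unfolding G_def S_def
    using twice_diff_at_v(4,5)[OF dom[OF that] KK K[OF that] LL L[OF that]]
      D1_pull_c[OF dom[OF that] KK K[OF that] LL L[OF that]]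
      at_v(2)[OF dom[OF that] KK K[OF that] LL L[OF that]] by (simp_all add: w_def)
  have cont\<gamma>: "continuous_on {0..1} (\<lambda>t. t *\<^sub>R d)" by (intro continuous_intros)
  obtain M where M: "M > 0" "\<And>t v. t \<in> {0..1} \<Longrightarrow> norm (D1 G (t *\<^sub>R d) v) \<le> M * norm v"
    by (rule D1_bounded_along_path[OF G cont\<gamma>]) auto
  have "continuous_on {0..1} w"
  proof -
    have "isCont G (t *\<^sub>R d)" if "t \<in> {0..1}" for t by (rule twice_diff_isCont[OF G[OF that]])
    then have "continuous_on ((\<lambda>t. t *\<^sub>R d) ` {0..1}) G"
      by (auto intro!: continuous_at_imp_continuous_on)
    from continuous_on_compose[OF cont\<gamma> this] have "continuous_on {0..1} (\<lambda>t. G (t *\<^sub>R d))"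
      by (simp add: o_def)
    then show ?thesis by (rule continuous_on_eq) (simp add: GS)
  qed
  note contw = this
  have contS: "\<forall>\<^sub>F s in at t within {0..1}. \<forall>k. norm (S s k - S t k) \<le> e * norm k"
    if "t \<in> {0..1}" "e > 0" for t e
    unfolding S_def by (rule D1_bounded_along_path[of ?S w, OF GS(2) contw]) (use that in auto)
  have T: "bounded_linear ?T" by (rule bounded_linear_pseudo_inv[OF dc_bounded_linear surj_x])
  interpret T: bounded_linear ?T by (rule T)
  interpret A: bounded_linear "dc P x" by (rule dc_bounded_linear)
  note AT = A_pseudo_inv[OF dc_bounded_linear surj_x]
  obtain KT where KT: "KT > 0" "\<And>h. norm (?T h) \<le> norm h * KT" using T.pos_bounded by blast
  obtain K1 where K1: "K1 > 0" "\<And>v. norm v \<le> K1 * nrm P x v" using ip.norm_le_n[of x] by blast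
  obtain K2 where K2: "K2 > 0" "\<And>v. nrm P x v \<le> K2 * norm v" using ip.n_le_norm[of x] by blast
  have sol: "\<exists>k. S t k = h \<and> norm k \<le> (M * (K1 * (2 * (K2 * KT)))) * norm h" if t: "t \<in> {0..1}" for t h
  proof -
    let ?B = "D1 (pull_c P x) (t *\<^sub>R d)"
    have B: "bounded_linear ?B" by (rule twice_diff_bounded_linear_D1[OF twice_diff_pull(2)[OF dom[OF t]]])
    have "bounded_linear (\<lambda>v. ?T (?B v - dc P x v))"
      by (intro bounded_linear_compose[OF T] bounded_linear_sub B dc_bounded_linear)
    \<comment> \<open>Instead of \<open>?B v = h\<close>, the equation obtained by applying
      \<open>?T\<close> to its difference with \<open>dc P x\<close> is solved: it is a perturbation
      of the identity by at most 1/2, and applying \<open>dc P x\<close> recovers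
      \<open>?B v = h\<close>.\<close>
    from ip.ex_id_plus_small[OF this, of x, of "?T h"] small[OF t]
    obtain v where v: "v + ?T (?B v - dc P x v) = ?T h" "nrm P x v \<le> 2 * nrm P x (?T h)" by blast
    have "dc P x (v + ?T (?B v - dc P x v)) = dc P x (?T h)" by (simp only: v(1))
    then have "?B v = h" by (simp add: A.add AT)
    have "norm (D1 G (t *\<^sub>R d) v) \<le> M * norm v" by (rule M(2)[OF t])
    also have "\<dots> \<le> M * (K1 * (2 * (K2 * (norm h * KT))))"
    proof (intro mult_left_mono)
      have "nrm P x (?T h) \<le> K2 * (norm h * KT)"
        using K2(2)[of "?T h"] mult_left_mono[OF KT(2)[of h], of K2] K2(1) by linarith
      then have "K1 * nrm P x v \<le> K1 * (2 * (K2 * (norm h * KT)))"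
        using v(2) K1(1) by (intro mult_left_mono) auto
      then show "norm v \<le> K1 * (2 * (K2 * (norm h * KT)))" using K1(2)[of v] by linarith
    qed (use M in auto)
    finally show ?thesis using Bt[OF t, of v] \<open>?B v = h\<close>
      by (intro exI[of _ "D1 G (t *\<^sub>R d) v"]) (simp add: mult_ac)
  qed
  have linS: "linear (S t)" if "t \<in> {0..1}" for t
    unfolding S_def using twice_diff_bounded_linear_D1[OF GS(2)[OF that]] bounded_linear.linear by blast
  \<comment> \<open>The stratification has identity derivative in the chart at \<open>c x\<close>,
    but here it is read in the chart at \<open>c z\<close>. So \<open>S 0\<close> is the derivative
    of the chart transition \<tau>, with the derivative of \<tau>' as left inverse.\<close>
  have "inj (S 0)"
  proof -
    let ?M = "KY (constr P x)"
    have cx: "constr P x \<in> fst ?L" using L[of 0] by simp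
    have w0: "w 0 = snd ?L (constr P x)" by (simp add: w_def)
    define \<tau> where "\<tau> = snd ?M \<circ> chart_inv ?L"
    define \<tau>' where "\<tau>' = snd ?L \<circ> chart_inv ?M"
    have \<tau>: "twice_diff \<tau> (w 0)" "\<tau> (w 0) = snd ?M (constr P x)"
      unfolding \<tau>_def w0 using transition_twice_diff[OF atlas_Y LL KY(1) cx KY(2)] 
      by (auto simp: chart_inv_left[OF atlas_Y LL cx])
    have \<tau>': "twice_diff \<tau>' (\<tau> (w 0))"
      unfolding \<tau>'_def \<tau>(2) by (rule transition_twice_diff[OF atlas_Y KY(1) LL KY(2) cx])
    have ev: "\<forall>\<^sub>F y in nhds (w 0). chart_inv ?L y \<in> fst ?L \<and> snd ?L (chart_inv ?L y) = y \<and> chart_inv ?L y \<in> fst ?M"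
      unfolding w0 by (rule eventually_chart_inv[OF atlas_Y LL cx eventually_in_chart_Y[OF KY]])
    have e1: "\<forall>\<^sub>F y in nhds (w 0). (\<tau>' \<circ> \<tau>) y = (\<lambda>y. y) y"
      using ev by eventually_elim (simp add: \<tau>_def \<tau>'_def chart_inv_left[OF atlas_Y KY(1)])
    have e2: "\<forall>\<^sub>F y in nhds (w 0). (Sc ?M (constr P x) \<circ> \<tau>) y = ?S y"
      using ev by eventually_elim (simp add: \<tau>_def Sc_def chart_inv_left[OF atlas_Y KY(1)])
    have SM: "twice_diff (Sc ?M (constr P x)) (\<tau> (w 0))"
      unfolding \<tau>(2) by (intro twice_diff_Sc KY)
    have "S 0 k = D1 \<tau> (w 0) k" for k
      unfolding S_def D1_cong[OF e2, symmetric] D1_compose[OF \<tau>(1) SM] by (simp add: \<tau>(2) D1_Sc)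
    moreover have "D1 \<tau>' (\<tau> (w 0)) (D1 \<tau> (w 0) k) = k" for k
      using D1_compose[OF \<tau>(1) \<tau>', of k] D1_cong[OF e1] bounded_linear_twice_diff(2)[OF bounded_linear_ident]
      by metis
    ultimately show ?thesis by (metis injI)
  qed
  have "inj (S 1)"
    by (rule inj_along_path[of S "M * (K1 * (2 * (K2 * KT)))"])
       (use linS contS sol \<open>inj (S 0)\<close> M(1) K1(1) K2(1) KT(1) in auto)
  have 1: "1 \<in> {0..1::real}" by simp
  have "S 1 (D1 G d u) = 0" using Bt[OF 1, of u] u by simp
  then have "D1 G d u = 0" using \<open>inj (S 1)\<close> linS[OF 1] linear_injective_0 by blast
  have dd: "d \<in> interior (retr_dom P x)" "retr P x d \<in> fst ?K" "constr P (retr P x d) \<in> fst ?L"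
    using dom[OF 1] K[OF 1] L[OF 1] by simp_all
  have "D1 (Cc ?K ?L) (snd ?K z) (D1 (Rc ?K x) d u) = 0"
    using \<open>D1 G d u = 0\<close> D1_CR[OF dd(1) KK dd(2) LL dd(3)] by (simp add: G_def d)
  from critical_in_charts[OF min surj_z this]
  show ?thesis using D1_pull_f[OF dd(1) KK dd(2) LL dd(3)] by (simp add: d)
qed

end

section \<open>Estimates at one iterate\<close>

lemma line_has_derivative:
  assumes "(g has_derivative D) (at (b + t *\<^sub>R v))"
  shows "((\<lambda>t. g (b + t *\<^sub>R v)) has_derivative (\<lambda>h. D (h *\<^sub>R v))) (at t within S)"
proof -
  have "((\<lambda>t. b + t *\<^sub>R v) has_derivative (\<lambda>h. h *\<^sub>R v)) (at t within S)"
    by (auto intro!: derivative_eq_intros)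
  from has_derivative_compose[OF this assms] show ?thesis .
qed

context compatible_ip
begin

lemma segment:
  assumes "n a < s" "n b < s" "0 \<le> t" "t \<le> 1"
  shows "n (b + t *\<^sub>R (a - b)) < s"
proof -
  have "b + t *\<^sub>R (a - b) = (1 - t) *\<^sub>R b + t *\<^sub>R a" by (simp add: algebra_simps)
  then have "n (b + t *\<^sub>R (a - b)) \<le> (1 - t) * n b + t * n a"
    using n_triangle[of "(1 - t) *\<^sub>R b" "t *\<^sub>R a"] assms by simp
  also have "\<dots> < s" using convex_bound_lt[of "n b" s "n a" "1 - t" t] assms by simp
  finally show ?thesis .
qed

lemma segment_le:
  assumes "n a \<le> s" "n b \<le> s" "0 \<le> t" "t \<le> 1"
  shows "n (b + t *\<^sub>R (a - b)) \<le> s"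
proof -
  have "b + t *\<^sub>R (a - b) = (1 - t) *\<^sub>R b + t *\<^sub>R a" by (simp add: algebra_simps)
  then have "n (b + t *\<^sub>R (a - b)) \<le> (1 - t) * n b + t * n a"
    using n_triangle[of "(1 - t) *\<^sub>R b" "t *\<^sub>R a"] assms by simp
  also have "\<dots> \<le> s" using convex_bound_le[of "n b" s "n a" "1 - t" t] assms by simp
  finally show ?thesis .
qed

context
  fixes d t :: 'e
  assumes orth: "B d t = 0"
begin

lemma n_line_sq: "(n (d + s *\<^sub>R t))\<^sup>2 = (n d)\<^sup>2 + s\<^sup>2 * (n t)\<^sup>2"
  using pythagoras[of d "s *\<^sub>R t"] orth by (simp add: B.scaleR_right power_mult_distrib)

lemma n_line_mono: "\<bar>s\<bar> \<le> \<bar>s'\<bar> \<Longrightarrow> n (d + s *\<^sub>R t) \<le> n (d + s' *\<^sub>R t)"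
  by (rule power2_le_imp_le) (auto simp: n_line_sq abs_le_square_iff mult_right_mono)

text \<open>The gradient inequality at \<open>s\<close> for the convex function \<open>s \<mapsto> n (d + s t) ^ 3\<close>.\<close>

lemma n_line_cube_le:
  assumes "0 \<le> s"
  shows "n (d + s *\<^sub>R t) ^ 3 - n (d + \<tau> *\<^sub>R t) ^ 3 \<le> 3 * (n t)\<^sup>2 * s * (s - \<tau>) * n (d + s *\<^sub>R t)"
proof -
  define N where "N = n (d + s *\<^sub>R t)"
  define M where "M = n (d + \<tau> *\<^sub>R t)"
  have nn: "N \<ge> 0" "M \<ge> 0" by (simp_all add: N_def M_def)
  have "B (d + s *\<^sub>R t) (d + \<tau> *\<^sub>R t) = (n d)\<^sup>2 + s * \<tau> * (n t)\<^sup>2"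
    using orth by (simp add: n_sq B.add_left B.add_right B.scaleR_left B.scaleR_right sym[of t d])
  then have "(n d)\<^sup>2 + s * \<tau> * (n t)\<^sup>2 \<le> N * M"
    using cauchy_schwarz[of "d + s *\<^sub>R t" "d + \<tau> *\<^sub>R t"] by (simp add: N_def M_def)
  moreover have "N\<^sup>2 = (n d)\<^sup>2 + s\<^sup>2 * (n t)\<^sup>2" unfolding N_def by (rule n_line_sq)
  ultimately have "N\<^sup>2 - N * M \<le> (n t)\<^sup>2 * s * (s - \<tau>)" by (simp add: power2_eq_square algebra_simps)
  then have "3 * N * (N\<^sup>2 - N * M) \<le> 3 * N * ((n t)\<^sup>2 * s * (s - \<tau>))"
    using nn by (intro mult_left_mono) auto
  \<comment> \<open>Splits off the term controlled by Cauchy-Schwarz; the remainder has a sign and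
    is dropped.\<close>
  moreover have "N ^ 3 - M ^ 3 = 3 * N * (N\<^sup>2 - N * M) - (N - M)\<^sup>2 * (2 * N + M)"
    by (simp add: power2_eq_square power3_eq_cube algebra_simps)
  moreover have "(N - M)\<^sup>2 * (2 * N + M) \<ge> 0" using nn by simp
  ultimately have "N ^ 3 - M ^ 3 \<le> 3 * N * ((n t)\<^sup>2 * s * (s - \<tau>))" by linarith
  then show ?thesis by (simp add: N_def M_def mult_ac)
qed

text \<open>Comparison with the parameter 0 alone, where the cubic term is smallest: the parabola
  with vertex at 1 then confines \<tau> to [0, 2].\<close>

lemma line_minimum_weak:
  assumes "h > 0" "\<omega> \<ge> 0"
    and min: "h / 2 * (1 - \<tau>)\<^sup>2 + \<omega> / 6 * n (d + \<tau> *\<^sub>R t) ^ 3 \<le> h / 2 + \<omega> / 6 * n d ^ 3"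
  shows "0 \<le> \<tau>" "\<tau> \<le> 2"
proof -
  have "n d ^ 3 \<le> n (d + \<tau> *\<^sub>R t) ^ 3" using n_line_mono[of 0 \<tau>] by (intro power_mono) auto
  then have "\<omega> / 6 * n d ^ 3 \<le> \<omega> / 6 * n (d + \<tau> *\<^sub>R t) ^ 3" using assms by (intro mult_left_mono) auto
  then have "h / 2 * (1 - \<tau>)\<^sup>2 \<le> h / 2 * 1" using min by linarith
  then have "(1 - \<tau>)\<^sup>2 \<le> 1\<^sup>2" using assms by simp
  then have "\<bar>1 - \<tau>\<bar> \<le> 1" by (metis abs_le_square_iff abs_one)
  then show "0 \<le> \<tau>" "\<tau> \<le> 2" by auto
qed

text \<open>The objective is a parabola with vertex at 1 plus an increasing cubic term, so the
  minimizer lies in ]0, 1], and stationarity measures how far it falls short of 1. The factor \<tau>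
  on the right of that estimate is kept on purpose: it replaces the full tangent step by the
  shortened one.\<close>

lemma line_minimum:
  assumes h: "h > 0" "\<omega> \<ge> 0"
    and min: "\<And>s. 0 \<le> s \<Longrightarrow> s \<le> 1 \<Longrightarrow>
      h / 2 * (1 - \<tau>)\<^sup>2 + \<omega> / 6 * n (d + \<tau> *\<^sub>R t) ^ 3 \<le> h / 2 * (1 - s)\<^sup>2 + \<omega> / 6 * n (d + s *\<^sub>R t) ^ 3"
  shows "0 < \<tau>" "\<tau> \<le> 1" "2 * h * (1 - \<tau>) \<le> \<omega> * (n t)\<^sup>2 * \<tau> * n (d + \<tau> *\<^sub>R t)"
    "h / 2 * (1 - \<tau>)\<^sup>2 + \<omega> / 6 * n (d + \<tau> *\<^sub>R t) ^ 3 < h / 2 + \<omega> / 6 * n d ^ 3"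
proof -
  have slope: "2 * h * (1 - \<tau>) \<le> \<omega> * (n t)\<^sup>2 * \<tau> * n (d + \<tau> *\<^sub>R t)"
    if "0 \<le> \<tau>" "\<tau> < 1" and min: "\<And>s. 0 \<le> s \<Longrightarrow> s \<le> 1 \<Longrightarrow>
      h / 2 * (1 - \<tau>)\<^sup>2 + \<omega> / 6 * n (d + \<tau> *\<^sub>R t) ^ 3 \<le> h / 2 * (1 - s)\<^sup>2 + \<omega> / 6 * n (d + s *\<^sub>R t) ^ 3"
    for \<tau>
  proof -
    have le: "h * (2 - s - \<tau>) \<le> \<omega> * (n t)\<^sup>2 * s * n (d + s *\<^sub>R t)" if s: "\<tau> < s" "s \<le> 1" for s
    proof -
      have "h / 2 * ((1 - \<tau>)\<^sup>2 - (1 - s)\<^sup>2) \<le> \<omega> / 6 * (n (d + s *\<^sub>R t) ^ 3 - n (d + \<tau> *\<^sub>R t) ^ 3)"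
        using min[of s] s \<open>0 \<le> \<tau>\<close> by (simp add: algebra_simps)
      also have "\<dots> \<le> \<omega> / 6 * (3 * (n t)\<^sup>2 * s * (s - \<tau>) * n (d + s *\<^sub>R t))"
        using n_line_cube_le[of s \<tau>] h s \<open>0 \<le> \<tau>\<close> by (intro mult_left_mono) auto
      finally have "(s - \<tau>) * (h * (2 - s - \<tau>)) \<le> (s - \<tau>) * (\<omega> * (n t)\<^sup>2 * s * n (d + s *\<^sub>R t))"
        by (simp add: power2_eq_square algebra_simps)
      then show ?thesis using s by simp
    qed
    \<comment> \<open>The secant inequality for \<tau> < s \<le> 1 becomes the one-sided derivative
      condition at \<tau> in the limit.\<close>
    have "((\<lambda>s. \<omega> * (n t)\<^sup>2 * s * n (d + s *\<^sub>R t)) \<longlongrightarrow> \<omega> * (n t)\<^sup>2 * \<tau> * n (d + \<tau> *\<^sub>R t)) (at_right \<tau>)"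
    proof -
      have "continuous_on UNIV (\<lambda>s. n (d + s *\<^sub>R t))"
        by (rule continuous_on_compose2[OF continuous_n[of UNIV]]) (auto intro!: continuous_intros)
      then have "((\<lambda>s. n (d + s *\<^sub>R t)) \<longlongrightarrow> n (d + \<tau> *\<^sub>R t)) (at \<tau>)"
        by (simp add: continuous_on_def)
      then show ?thesis by (intro tendsto_intros) (auto intro: filterlim_at_split[THEN iffD1, THEN conjunct2])
    qed
    moreover have "((\<lambda>s. h * (2 - s - \<tau>)) \<longlongrightarrow> h * (2 - \<tau> - \<tau>)) (at_right \<tau>)"
      by (intro tendsto_intros)
    moreover have "\<forall>\<^sub>F s in at_right \<tau>. h * (2 - s - \<tau>) \<le> \<omega> * (n t)\<^sup>2 * s * n (d + s *\<^sub>R t)"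
      using le \<open>\<tau> < 1\<close> unfolding eventually_at_right_field by (intro exI[of _ 1]) auto
    ultimately have "h * (2 - \<tau> - \<tau>) \<le> \<omega> * (n t)\<^sup>2 * \<tau> * n (d + \<tau> *\<^sub>R t)"
      by (intro tendsto_le[OF trivial_limit_at_right_real])
    then show ?thesis by (simp add: algebra_simps)
  qed
  \<comment> \<open>If 0 were optimal, the slope estimate at 0 would read 2h \<le> 0. This yields
    the strict decrease below.\<close>
  have not0: False if "\<And>s. 0 \<le> s \<Longrightarrow> s \<le> 1 \<Longrightarrow>
      h / 2 + \<omega> / 6 * n d ^ 3 \<le> h / 2 * (1 - s)\<^sup>2 + \<omega> / 6 * n (d + s *\<^sub>R t) ^ 3"
    using slope[of 0] that h by simp
  have nonneg: "0 \<le> \<tau>" using line_minimum_weak[OF h] min[of 0] by simp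
  show lt: "h / 2 * (1 - \<tau>)\<^sup>2 + \<omega> / 6 * n (d + \<tau> *\<^sub>R t) ^ 3 < h / 2 + \<omega> / 6 * n d ^ 3"
  proof (rule ccontr)
    assume "\<not> ?thesis"
    then show False using min not0 by (meson linorder_not_less order_trans)
  qed
  show "0 < \<tau>" using lt nonneg by (cases "\<tau> = 0") auto
  show "\<tau> \<le> 1"
  proof (rule ccontr)
    assume "\<not> \<tau> \<le> 1"
    then have "n (d + 1 *\<^sub>R t) ^ 3 \<le> n (d + \<tau> *\<^sub>R t) ^ 3"
      using n_line_mono[of 1 \<tau>] by (intro power_mono) auto
    then have "\<omega> / 6 * n (d + 1 *\<^sub>R t) ^ 3 \<le> \<omega> / 6 * n (d + \<tau> *\<^sub>R t) ^ 3"
      using h by (intro mult_left_mono) auto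
    moreover have "h / 2 * (1 - \<tau>)\<^sup>2 > 0" using h \<open>\<not> \<tau> \<le> 1\<close> by simp
    ultimately show False using min[of 1] by simp
  qed
  then show "2 * h * (1 - \<tau>) \<le> \<omega> * (n t)\<^sup>2 * \<tau> * n (d + \<tau> *\<^sub>R t)"
    using slope[OF nonneg _ min] nonneg h by (cases "\<tau> = 1") auto
qed

end
end

text \<open>The arithmetic of the two cases of \<open>model_error\<close>: \<open>M\<close> bounds
  Taylor remainders and \<open>G\<close> bounds Hessian discrepancies, for \<open>q_o\<close> and
  for \<open>q_tilde\<close> respectively.\<close>

lemma abs_remainder_bounds:
  fixes Q X Y Z W G M :: real
  shows "Q = X + Y / 2 \<Longrightarrow> \<bar>Y\<bar> \<le> G \<Longrightarrow> \<bar>X\<bar> \<le> M \<Longrightarrow> \<bar>Q\<bar> \<le> M + G / 2"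
    and "Q = X - Z + W + Y / 2 \<Longrightarrow> \<bar>X\<bar> \<le> M \<Longrightarrow> \<bar>Z\<bar> \<le> M \<Longrightarrow> \<bar>W\<bar> \<le> G \<Longrightarrow> \<bar>Y\<bar> \<le> G \<Longrightarrow>
      \<bar>Q\<bar> \<le> 2 * M + 3 / 2 * G"
  by linarith+

text \<open>
  A single constant \<open>C\<close> dominates all constants of the
  assumptions and \<open>1 / \<alpha>\<close>; \<open>xs\<close> is the solution in the coordinates of the retraction at \<open>x\<close>, and
  \<open>critical\<close> is the first order condition at \<open>xs\<close> combined with the third bound of Assumption (A).
\<close>

locale newton_point = problem P
  for P :: "('x::topological_space, 'y::topological_space,
               'e::{real_inner, banach}, 'h::{real_inner, banach}) eq_problem" +
  fixes x :: 'x and C r :: real and xs :: 'e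
  assumes C: "C \<ge> 1" and r: "0 < r" "r \<le> 1"
    and dom: "nrm P x d < r \<Longrightarrow> d \<in> interior (retr_dom P x)"
    and surj: "surj (dc P x)"
    and f_lip: "nrm P x d < r \<Longrightarrow> \<bar>D1 (pull_f P x) d v - df P x v\<bar> \<le> C * nrm P x d * nrm P x v"
    and f_bound: "\<bar>df P x v\<bar> \<le> C * nrm P x v"
    and c_lip: "nrm P x d < r \<Longrightarrow>
      nrm P x (pseudo_inv P x (dc P x) (D1 (pull_c P x) d v - dc P x v)) \<le> C * nrm P x d * nrm P x v"
    and L_lip: "nrm P x d < r \<Longrightarrow>
      \<bar>D2 (pull_L P x (multiplier P x)) d v w - D2 (pull_L P x (multiplier P x)) 0 v w\<bar>
        \<le> C * nrm P x d * nrm P x v * nrm P x w"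
    and elliptic: "dc P x v = 0 \<Longrightarrow> (nrm P x v)\<^sup>2 \<le> C * hess_o P x v v"
    and hess_bound: "\<bar>hess_o P x v w\<bar> \<le> C * nrm P x v * nrm P x w"
    and transition: "second_order_consistent P (constr P x) \<or> dc P x v = 0 \<or> dc P x w = 0 \<Longrightarrow>
      \<exists>u. D2 (pull_L P x (multiplier P x)) 0 v w - hess_o P x v w = dL P x (multiplier P x) u \<and>
        nrm P x u \<le> C * nrm P x v * nrm P x w"
    and xs: "nrm P x xs < r" "pull_c P x xs = 0"
    and critical: "dc P x w = 0 \<Longrightarrow> \<exists>\<zeta>. nrm P x \<zeta> \<le> C * nrm P x xs * nrm P x w \<and>
      D1 (pull_c P x) xs \<zeta> = D1 (pull_c P x) xs w \<and> D1 (pull_f P x) xs \<zeta> = D1 (pull_f P x) xs w"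
begin

abbreviation "n \<equiv> nrm P x"
abbreviation "f \<equiv> pull_f P x"
abbreviation "c \<equiv> pull_c P x"
abbreviation "A \<equiv> dc P x"
abbreviation "T \<equiv> pseudo_inv P x A"
abbreviation "p \<equiv> multiplier P x"
abbreviation "Lg \<equiv> pull_L P x p"
abbreviation "H \<equiv> hess_o P x"
abbreviation "e \<equiv> n xs"
abbreviation "\<Delta>n \<equiv> full_normal_step P x"

sublocale A: bounded_linear A by (rule dc_bounded_linear)
sublocale T: bounded_linear T by (rule bounded_linear_pseudo_inv[OF dc_bounded_linear surj])
sublocale p: bounded_linear p by (rule multiplier_bounded_linear[OF surj])
sublocale df: bounded_linear "df P x" by (rule df_bounded_linear)
sublocale H: bounded_bilinear H by (rule hess_o_bilinear[OF surj])

lemmas H_sym = hess_o_sym[OF surj]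
lemmas AT [simp] = A_pseudo_inv[OF dc_bounded_linear surj, of x]
lemmas T_orth = pseudo_inv_orthogonal[OF dc_bounded_linear surj, of _ x]

lemma C0: "0 \<le> C" "0 < C" using C by auto

lemma e_le_1: "e \<le> 1" and e_ge_0: "0 \<le> e" using xs r by auto

lemma kernel_part: "A (v - T (A v)) = 0" by (simp add: A.diff)

lemma n_kernel_part: "n (v - T (A v)) \<le> n v" and n_T_A: "n (T (A v)) \<le> n v"
  using ip.orthogonal_le1[OF T_orth[OF kernel_part[of v], of "A v"]]
     ip.orthogonal_le2[OF T_orth[OF kernel_part[of v], of "A v"]] by simp_all

lemma p_eq: "p h = - df P x (T h)" by (simp add: multiplier_def)

text \<open>The multiplier makes L'(0,p) the derivative of the cost after orthogonal projection onto
  the kernel; in particular it vanishes on normal directions.\<close>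

lemma dL_eq: "dL P x p v = df P x (v - T (A v))"
  by (simp add: dL_def p_eq df.diff)

lemma dL_T [simp]: "dL P x p (T h) = 0" by (simp add: dL_eq df.zero)

lemma dL_kernel: "A v = 0 \<Longrightarrow> dL P x p v = df P x v" by (simp add: dL_eq T.zero)

text \<open>The multiplier acts through \<open>T\<close>, so values in the target space are measured
  by \<open>n (T h)\<close>, the quantity that Assumption (A) controls.\<close>

lemma p_bound: "n (T h) \<le> b \<Longrightarrow> \<bar>p h\<bar> \<le> C * b"
  using order_trans[OF f_bound[of "T h"] mult_left_mono[of "n (T h)" b C]] C0 by (simp add: p_eq)

lemmas segment = ip.segment[where x = x] and segment_le = ip.segment_le[where x = x]

lemma c_remainder:
  assumes "n a < r" "n b < r" "n a \<le> M" "n b \<le> M"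
  shows "n (T (c a - c b - A (a - b))) \<le> C * M * n (a - b)"
proof -
  define \<phi> where "\<phi> t = T (c (b + t *\<^sub>R (a - b)) - A (t *\<^sub>R (a - b)))" for t
  have "n (\<phi> 1 - \<phi> 0) \<le> C * M * n (a - b)"
  proof (rule ip.mean_value_n)
    fix t :: real assume t: "0 \<le> t" "t \<le> 1"
    let ?u = "b + t *\<^sub>R (a - b)"
    have u: "n ?u < r" by (rule segment[OF assms(1,2) t])
    have D: "bounded_linear (D1 c ?u)"
      by (rule twice_diff_bounded_linear_D1[OF twice_diff_pull(2)[OF dom[OF u]]])
    interpret D: bounded_linear "D1 c ?u" by (rule D)
    have "((\<lambda>t. A (t *\<^sub>R (a - b))) has_derivative (\<lambda>h. A (h *\<^sub>R (a - b)))) (at t within {0..1})"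
      by (auto intro!: derivative_eq_intros A.has_derivative)
    then have "(\<phi> has_derivative (\<lambda>h. T (D1 c ?u (h *\<^sub>R (a - b)) - A (h *\<^sub>R (a - b))))) (at t within {0..1})"
      unfolding \<phi>_def
      by (intro T.has_derivative has_derivative_diff line_has_derivative
          twice_diff_has_derivative[OF twice_diff_pull(2)[OF dom[OF u]]])
    then show "(\<phi> has_vector_derivative T (D1 c ?u (a - b) - A (a - b))) (at t within {0..1})"
      unfolding has_vector_derivative_def
      by (simp add: D.scaleR A.scaleR T.scaleR flip: scaleR_diff_right)
    have "n (T (D1 c ?u (a - b) - A (a - b))) \<le> C * n ?u * n (a - b)" by (rule c_lip[OF u])
    also have "\<dots> \<le> C * M * n (a - b)"
      using segment_le[OF assms(3,4) t] C0 by (intro mult_left_mono mult_right_mono) auto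
    finally show "n (T (D1 c ?u (a - b) - A (a - b))) \<le> C * M * n (a - b)" .
  qed
  then show ?thesis by (simp add: \<phi>_def A.zero algebra_simps flip: T.diff)
qed

text \<open>Because \<open>c xs = 0\<close>, the error of the normal step is the linearization error
  of the constraint between 0 and \<open>xs\<close>.\<close>

lemma normal_step_error: "n (\<Delta>n - T (A xs)) \<le> C * e\<^sup>2"
proof -
  have "n (T (c xs - c 0 - A (xs - 0))) \<le> C * e * n (xs - 0)"
    by (rule c_remainder) (use xs r in auto)
  moreover have "T (c xs - c 0 - A (xs - 0)) = \<Delta>n - T (A xs)"
    by (simp add: xs full_normal_step_def T.diff T.neg)
  ultimately show ?thesis by (simp add: power2_eq_square mult.assoc)
qed

lemma e_sq_le: "e\<^sup>2 \<le> e"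
  using mult_left_mono[OF e_le_1 e_ge_0] by (simp add: power2_eq_square)

lemma normal_step_bound: "n \<Delta>n \<le> 2 * C * e"
proof -
  have "n \<Delta>n \<le> n (\<Delta>n - T (A xs)) + n (T (A xs))" using ip.n_triangle[of x "\<Delta>n - T (A xs)" "T (A xs)"] by simp
  also have "\<dots> \<le> C * e\<^sup>2 + e" by (intro add_mono normal_step_error n_T_A)
  also have "\<dots> \<le> C * e + C * e"
    using mult_left_mono[OF e_sq_le C0(1)] mult_right_mono[OF C e_ge_0] by simp
  finally show ?thesis by simp
qed

lemma A_normal_step: "A \<Delta>n = - c 0"
  by (simp add: full_normal_step_def A.neg)

lemma normal_step_orth: "A w = 0 \<Longrightarrow> ip P x \<Delta>n w = 0"
  using T_orth[of w "- c 0"] by (simp add: full_normal_step_def T.neg)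

lemma D1_f_bound: "n d < r \<Longrightarrow> \<bar>D1 f d v\<bar> \<le> 2 * C * n v"
proof -
  assume d: "n d < r"
  have "C * n d * n v \<le> C * 1 * n v" using d r C0 by (intro mult_left_mono mult_right_mono) auto
  then show ?thesis using f_lip[OF d, of v] f_bound[of v] by linarith
qed

lemma C_powers: "C \<le> C\<^sup>2" "C\<^sup>2 \<le> C ^ 3" "C \<le> C ^ 3" "1 \<le> C\<^sup>2" "1 \<le> C ^ 3" "C ^ 3 \<le> C ^ 4" "C\<^sup>2 \<le> C ^ 4" "C \<le> C ^ 4" "1 \<le> C ^ 4"
  using power_increasing[of 1 2 C] power_increasing[of 2 3 C] power_increasing[of 1 3 C]
    power_increasing[of 3 4 C] power_increasing[of 2 4 C] power_increasing[of 1 4 C] one_le_power[OF C] C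
  by auto

text \<open>By criticality the derivative at \<open>xs\<close> takes the same value on
  \<open>w\<close> and on a vector of length O(e); Lipschitz continuity then transfers the smallness
  to 0.\<close>

lemma df_kernel_bound:
  assumes w: "A w = 0"
  shows "\<bar>df P x w\<bar> \<le> 3 * C\<^sup>2 * e * n w"
proof -
  obtain \<zeta> where \<zeta>: "n \<zeta> \<le> C * e * n w" "D1 f xs \<zeta> = D1 f xs w" using critical[OF w] by blast
  have "\<bar>D1 f xs \<zeta>\<bar> \<le> 2 * C * n \<zeta>" by (rule D1_f_bound[OF xs(1)])
  also have "\<dots> \<le> 2 * C * (C * e * n w)" using \<zeta>(1) C0 by (intro mult_left_mono) auto
  finally have 1: "\<bar>D1 f xs w\<bar> \<le> 2 * C * (C * e * n w)" using \<zeta>(2) by simp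
  have "C * e * n w \<le> C * (C * e * n w)" using mult_right_mono[OF C, of "C * e * n w"] C0 by simp
  then show ?thesis using f_lip[OF xs(1), of w] 1 by (simp add: power2_eq_square algebra_simps)
qed

text \<open>\<open>g\<close> is a parameter because two bounds for f' on the kernel are used: one by
  the distance to the solution, one by the length of the step.\<close>

lemma dL_bound:
  assumes g: "\<And>w. A w = 0 \<Longrightarrow> \<bar>df P x w\<bar> \<le> g * n w" and "g \<ge> 0"
  shows "\<bar>dL P x p u\<bar> \<le> g * n u"
  using g[OF kernel_part[of u]] mult_left_mono[OF n_kernel_part[of u] \<open>g \<ge> 0\<close>] by (simp add: dL_eq)

lemma D1_L: "n d < r \<Longrightarrow> D1 Lg d v = D1 f d v + p (D1 c d v)"
  by (rule twice_diff_pull_L(2)[OF multiplier_bounded_linear[OF surj] dom])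

lemma D1_L_0: "D1 Lg 0 v = dL P x p v"
  using D1_L[of 0] r by (simp add: dL_def df_def dc_def)

lemma twice_diff_L: "n d < r \<Longrightarrow> twice_diff Lg d"
  by (rule twice_diff_pull_L(1)[OF multiplier_bounded_linear[OF surj] dom])

text \<open>Criticality replaces \<open>w\<close> by a short \<zeta> in the cost and in the
  constraint derivative at once. L'(xs) is itself O(e) on \<zeta>, which gives second order; 5 = 1 +
  3 + 1 from the three summands.\<close>

lemma D1_L_xs:
  assumes w: "A w = 0"
  shows "\<bar>D1 Lg xs w\<bar> \<le> 5 * C ^ 3 * e\<^sup>2 * n w"
proof -
  obtain \<zeta> where \<zeta>: "n \<zeta> \<le> C * e * n w" "D1 c xs \<zeta> = D1 c xs w" "D1 f xs \<zeta> = D1 f xs w"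
    using critical[OF w] by blast
  define b where "b = C * e * n w"
  have b: "0 \<le> b" "n \<zeta> \<le> b" using C0 \<zeta>(1) by (auto simp: b_def)
  have "D1 Lg xs w = (D1 f xs \<zeta> - df P x \<zeta>) + dL P x p \<zeta> + p (D1 c xs \<zeta> - A \<zeta>)"
    by (simp add: D1_L[OF xs(1)] \<zeta>(2,3) dL_def p.diff)
  moreover have "\<bar>D1 f xs \<zeta> - df P x \<zeta>\<bar> \<le> C * e * b"
    by (rule order_trans[OF f_lip[OF xs(1), of \<zeta>] mult_left_mono[OF b(2)]]) (use C0 in simp)
  moreover have "\<bar>dL P x p \<zeta>\<bar> \<le> 3 * C\<^sup>2 * e * b"
    by (rule order_trans[OF dL_bound[OF df_kernel_bound] mult_left_mono[OF b(2)]]) (use C0 in simp_all)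
  moreover have "\<bar>p (D1 c xs \<zeta> - A \<zeta>)\<bar> \<le> C * (C * e * b)"
    by (intro p_bound order_trans[OF c_lip[OF xs(1), of \<zeta>] mult_left_mono[OF b(2)]]) (use C0 in simp)
  moreover have "C * e * b \<le> C\<^sup>2 * e * b"
    using C_powers(1) b(1) by (intro mult_right_mono) auto
  ultimately have "\<bar>D1 Lg xs w\<bar> \<le> 5 * C\<^sup>2 * e * b" by (simp add: power2_eq_square algebra_simps)
  then show ?thesis by (simp add: b_def power2_eq_square power3_eq_cube mult_ac)
qed

text \<open>\<open>xs\<close> satisfies the linearized optimality condition of the tangent step up
  to second order. The constant 9 collects 1 from the variation of L'', 3 from the change to the
  circled Hessian and 5 from \<open>D1_L_xs\<close>.\<close>

lemma optimality_residual:
  assumes w: "A w = 0"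
  shows "\<bar>df P x w + H xs w\<bar> \<le> 9 * C ^ 3 * e\<^sup>2 * n w"
proof -
  have "((\<lambda>t. D1 Lg (0 + t *\<^sub>R xs) w) has_derivative (\<lambda>h. D2 Lg (0 + t *\<^sub>R xs) (h *\<^sub>R xs) w)) (at t within {0..1})"
    if "0 \<le> t" "t \<le> 1" for t
  proof (rule line_has_derivative[of "\<lambda>z. D1 Lg z w"], rule twice_diff_D1_has_derivative, rule twice_diff_L)
    show "n (0 + t *\<^sub>R xs) < r" using segment[of xs r 0 t] xs r that by simp
  qed
  from mvt_very_simple[OF _ this] obtain t where t: "0 \<le> t" "t \<le> 1"
    "D1 Lg xs w - D1 Lg 0 w = D2 Lg (t *\<^sub>R xs) xs w" by auto
  have tx: "n (t *\<^sub>R xs) \<le> e" using t mult_right_mono[of t 1 e] by simp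
  then have "\<bar>D2 Lg (t *\<^sub>R xs) xs w - D2 Lg 0 xs w\<bar> \<le> C * n (t *\<^sub>R xs) * e * n w"
    using xs by (intro L_lip) auto
  also have "\<dots> \<le> C * e * e * n w" using tx C0 by (intro mult_right_mono mult_left_mono) auto
  also have "\<dots> \<le> C ^ 3 * e * e * n w" using C_powers(3) by (intro mult_right_mono) auto
  finally have 1: "\<bar>D2 Lg (t *\<^sub>R xs) xs w - D2 Lg 0 xs w\<bar> \<le> C ^ 3 * e\<^sup>2 * n w"
    by (simp add: power2_eq_square mult_ac)
  obtain u where u: "D2 Lg 0 xs w - H xs w = dL P x p u" "n u \<le> C * e * n w"
    using transition[of xs w] w by blast
  have "\<bar>dL P x p u\<bar> \<le> 3 * C\<^sup>2 * e * n u" by (rule dL_bound[OF df_kernel_bound]) auto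
  also have "\<dots> \<le> 3 * C\<^sup>2 * e * (C * e * n w)" using u(2) by (intro mult_left_mono) auto
  finally have 2: "\<bar>D2 Lg 0 xs w - H xs w\<bar> \<le> 3 * C ^ 3 * e\<^sup>2 * n w"
    using u(1) by (simp add: power2_eq_square power3_eq_cube mult_ac)
  show ?thesis using 1 2 D1_L_xs[OF w] t(3) D1_L_0[of w] dL_kernel[OF w] by (simp add: algebra_simps abs_le_iff)
qed

section \<open>The tangent step and the full Newton step\<close>

lemma elliptic_bound:
  assumes "A w = 0" "H w w \<le> b * n w" "b \<ge> 0"
  shows "n w \<le> C * b"
proof (cases "n w = 0")
  case False
  have "n w * n w \<le> C * (b * n w)"
    using elliptic[OF assms(1)] mult_left_mono[OF assms(2) C0(1)] by (simp add: power2_eq_square)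
  then have "n w * n w \<le> (C * b) * n w" by (simp add: mult.assoc)
  then show ?thesis using False ip.n_nonneg[of x w] by (simp add: mult_le_cancel_right)
qed (use assms C0 in simp)

text \<open>Excludes the unspecified modification of the tangent step.\<close>

lemma elliptic_on_kernel: "elliptic_on_kernel P x"
  unfolding elliptic_on_kernel_def
  using elliptic C0 by (intro exI[of _ "1 / C"]) (auto simp: field_simps)

lemma tangent_stepD:
  assumes "tangent_step P x dn Dt"
  shows "A Dt = 0" and "A w = 0 \<Longrightarrow> H Dt w + df P x w + H dn w = 0"
proof -
  show "A Dt = 0" using assms by (simp add: tangent_step_def)
  assume w: "A w = 0"
  obtain Dp :: "'h \<Rightarrow> real" where Dp: "bounded_linear Dp"
     "H Dt w + Dp (A w) + dL P x p w + H dn w = 0"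
    using assms elliptic_on_kernel unfolding tangent_step_def by blast
  moreover have "Dp 0 = 0" using Dp(1) by (simp add: bounded_linear.linear linear_0)
  ultimately show "H Dt w + df P x w + H dn w = 0" using w dL_kernel[OF w] by simp
qed

lemma tangent_step_bound:
  assumes "tangent_step P x dn Dt"
  shows "n Dt \<le> 3 * C ^ 3 * e + C\<^sup>2 * n dn"
proof -
  note t = tangent_stepD[OF assms]
  have "H Dt Dt = - df P x Dt - H dn Dt" using t(2)[OF t(1)] by simp
  also have "\<dots> \<le> 3 * C\<^sup>2 * e * n Dt + C * n dn * n Dt"
    using df_kernel_bound[OF t(1)] hess_bound[of dn Dt] by linarith
  finally have "n Dt \<le> C * (3 * C\<^sup>2 * e + C * n dn)"
    using C0 by (intro elliptic_bound t) (auto simp: algebra_simps)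
  then show ?thesis by (simp add: power2_eq_square power3_eq_cube algebra_simps)
qed

text \<open>Makes a vanishing tangent step a property of the iterate alone, shared by all trials at
  it with the same \<open>dn\<close>.\<close>

lemma tangent_step_unique:
  assumes "tangent_step P x dn Dt" "tangent_step P x dn Dt'"
  shows "Dt = Dt'"
proof -
  note t = tangent_stepD[OF assms(1)] and t' = tangent_stepD[OF assms(2)]
  have w: "A (Dt - Dt') = 0" using t(1) t'(1) by (simp add: A.diff)
  have "H (Dt - Dt') (Dt - Dt') = 0" using t(2)[OF w] t'(2)[OF w] by (simp add: H.diff_left)
  then have "n (Dt - Dt') \<le> C * 0" by (intro elliptic_bound w) auto
  then have "n (Dt - Dt') = 0" using ip.n_nonneg[of x "Dt - Dt'"] by simp
  then show ?thesis by simp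
qed

text \<open>The tangent step equation bounds f' on the kernel by the step instead of the distance to
  the solution. This is what lets the model error be compared with powers of the step
  length.\<close>

lemma df_kernel_le_step:
  assumes "tangent_step P x dn Dt" "A w = 0"
  shows "\<bar>df P x w\<bar> \<le> C * n (dn + Dt) * n w"
proof -
  have "df P x w = - H (dn + Dt) w"
    using tangent_stepD(2)[OF assms] by (simp add: H.add_left)
  then show ?thesis using hess_bound[of "dn + Dt" w] by simp
qed

text \<open>The tangential error solves the tangent step equation up to the optimality residual and
  the normal error, so ellipticity bounds it: 10 = 9 + 1, and 11 after adding the normal
  error.\<close>

lemma newton_step_error:
  assumes "tangent_step P x \<Delta>n Dt"
  shows "n (\<Delta>n + Dt - xs) \<le> 11 * C ^ 4 * e\<^sup>2"
proof -
  note t = tangent_stepD[OF assms]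
  define w where "w = (xs - T (A xs)) - Dt"
  have w: "A w = 0" using t(1) kernel_part[of xs] by (simp add: w_def A.diff)
  have "w = (xs - \<Delta>n - Dt) + (\<Delta>n - T (A xs))" by (simp add: w_def)
  then have "H w w = H (xs - \<Delta>n - Dt) w + H (\<Delta>n - T (A xs)) w"
    by (metis H.add_left)
  also have "H (xs - \<Delta>n - Dt) w = df P x w + H xs w" using t(2)[OF w] by (simp add: H.diff_left)
  finally have "H w w = (df P x w + H xs w) + H (\<Delta>n - T (A xs)) w" .
  moreover have "\<bar>H (\<Delta>n - T (A xs)) w\<bar> \<le> C ^ 3 * e\<^sup>2 * n w"
  proof -
    have "\<bar>H (\<Delta>n - T (A xs)) w\<bar> \<le> C * n (\<Delta>n - T (A xs)) * n w" by (rule hess_bound)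
    also have "\<dots> \<le> C * (C * e\<^sup>2) * n w"
      using normal_step_error C0 by (intro mult_right_mono mult_left_mono) auto
    also have "\<dots> = C\<^sup>2 * e\<^sup>2 * n w" by (simp add: power2_eq_square)
    also have "\<dots> \<le> C ^ 3 * e\<^sup>2 * n w" using C_powers(2) by (intro mult_right_mono) auto
    finally show ?thesis .
  qed
  ultimately have "H w w \<le> 10 * C ^ 3 * e\<^sup>2 * n w" using optimality_residual[OF w] by linarith
  then have "n w \<le> C * (10 * C ^ 3 * e\<^sup>2)" using C0 by (intro elliptic_bound w) auto
  then have "n w \<le> 10 * C ^ 4 * e\<^sup>2" by (simp add: power_numeral_reduce)
  moreover have "n (\<Delta>n - T (A xs)) \<le> C ^ 4 * e\<^sup>2"
    using normal_step_error mult_right_mono[OF C_powers(8), of "e\<^sup>2"] by simp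
  moreover have eq: "\<Delta>n + Dt - xs = (\<Delta>n - T (A xs)) - w" by (simp add: w_def)
  ultimately show ?thesis
    unfolding eq using ip.n_triangle_diff[of x "\<Delta>n - T (A xs)" w] by linarith
qed

section \<open>Second order correction and model error\<close>

lemma correction_bound:
  assumes "n dx < r"
  shows "n (correction P x dx) \<le> C * (n dx)\<^sup>2"
proof -
  have "n (T (c dx - c 0 - A (dx - 0))) \<le> C * n dx * n (dx - 0)"
    by (rule c_remainder) (use assms r in auto)
  then show ?thesis by (simp add: correction_def power2_eq_square mult.assoc)
qed

lemma taylor_L:
  assumes a: "n a < r"
  shows "\<bar>Lg a - Lg 0 - dL P x p a - D2 Lg 0 a a / 2\<bar> \<le> C * n a ^ 3"
proof -
  define diff where "diff m t = (if m = 0 then Lg (0 + t *\<^sub>R a)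
     else if m = Suc 0 then D1 Lg (0 + t *\<^sub>R a) a else D2 Lg (0 + t *\<^sub>R a) a a)" for m :: nat and t
  have ta: "n (t *\<^sub>R a) < r" if "0 \<le> t" "t \<le> 1" for t using segment[of a r 0 t] a r that by simp
  have "DERIV (diff m) t :> diff (Suc m) t" if "m < 2" "0 \<le> t" "t \<le> 1" for m t
  proof -
    have t: "n (0 + t *\<^sub>R a) < r" using ta that by simp
    note td = twice_diff_L[OF t]
    interpret D1: bounded_linear "D1 Lg (0 + t *\<^sub>R a)" by (rule twice_diff_bounded_linear_D1[OF td])
    interpret D2: bounded_bilinear "D2 Lg (0 + t *\<^sub>R a)" by (rule twice_diff_bounded_bilinear_D2[OF td])
    have D1': "D1 Lg (t *\<^sub>R a) (h *\<^sub>R a) = D1 Lg (t *\<^sub>R a) a * h"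
      "D2 Lg (t *\<^sub>R a) (h *\<^sub>R a) a = D2 Lg (t *\<^sub>R a) a a * h" for h
      using D1.scaleR[of h a] D2.scaleR_left[of h a a] by (simp_all add: mult.commute)
    have "m = 0 \<or> m = Suc 0" using \<open>m < 2\<close> by auto
    then show ?thesis
      using line_has_derivative[OF twice_diff_has_derivative[OF td], of UNIV]
        line_has_derivative[of "\<lambda>z. D1 Lg z a", OF twice_diff_D1_has_derivative[OF td], of UNIV]
      by (auto simp: diff_def[abs_def] has_field_derivative_def D1')
  qed
  then obtain t where t: "0 < t" "t < 1"
    "diff 0 1 = (\<Sum>m<2. (diff m 0 / fact m) * (1 - 0) ^ m) + (diff 2 t / fact 2) * (1 - 0) ^ 2"
    using Taylor[of 2 diff "diff 0" 0 1 0 1] by auto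
  have "Lg a = Lg 0 + D1 Lg 0 a + D2 Lg (t *\<^sub>R a) a a / 2"
    using t(3) by (simp add: diff_def numeral_2_eq_2)
  then have "\<bar>Lg a - Lg 0 - dL P x p a - D2 Lg 0 a a / 2\<bar> = \<bar>D2 Lg (t *\<^sub>R a) a a - D2 Lg 0 a a\<bar> / 2"
    by (simp add: D1_L_0 field_simps)
  also have "\<dots> \<le> C * n (t *\<^sub>R a) * n a * n a / 2"
    using L_lip[OF ta, of t a a] t by simp
  also have "\<dots> \<le> C * n a * n a * n a"
  proof -
    have "C * n (t *\<^sub>R a) * n a * n a \<le> C * n a * n a * n a"
      using t C0 by (intro mult_right_mono mult_left_mono) (auto simp: mult_left_le_one_le)
    moreover have "0 \<le> C * n (t *\<^sub>R a) * n a * n a" using C0 by simp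
    ultimately show ?thesis by simp
  qed
  finally show ?thesis by (simp add: power3_eq_cube mult.assoc)
qed

text \<open>L'(0,p) vanishes on the range of \<open>T\<close>, so along a normal displacement the
  Lagrangian has slope only O(M). A displacement of second order therefore costs third
  order.\<close>

lemma L_correction:
  assumes "n d < r" "n d \<le> M" "n (d + T h) < r" "n (d + T h) \<le> M"
  shows "\<bar>Lg (d + T h) - Lg d\<bar> \<le> 2 * C\<^sup>2 * M * n (T h)"
proof -
  let ?s = "T h"
  have seg: "n (d + t *\<^sub>R ?s) < r" "n (d + t *\<^sub>R ?s) \<le> M" if "0 \<le> t" "t \<le> 1" for t
    using segment[OF assms(3,1) that] segment_le[OF assms(4,2) that] by simp_all
  have "((\<lambda>t. Lg (d + t *\<^sub>R ?s)) has_derivative (\<lambda>h. D1 Lg (d + t *\<^sub>R ?s) (h *\<^sub>R ?s))) (at t within {0..1})"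
    if "0 \<le> t" "t \<le> 1" for t
    by (intro line_has_derivative twice_diff_has_derivative twice_diff_L seg that)
  from mvt_very_simple[OF _ this] obtain t where t: "0 \<le> t" "t \<le> 1"
    "Lg (d + ?s) - Lg d = D1 Lg (d + t *\<^sub>R ?s) ?s" by auto
  let ?u = "d + t *\<^sub>R ?s"
  note u = seg[OF t(1,2)]
  have "D1 Lg ?u ?s = (D1 f ?u ?s - df P x ?s) + dL P x p ?s + p (D1 c ?u ?s - A ?s)"
    by (simp add: D1_L[OF u(1)] dL_def p.diff)
  also have "dL P x p ?s = 0" by simp
  finally have "\<bar>D1 Lg ?u ?s\<bar> \<le> C * n ?u * n ?s + C * (C * n ?u * n ?s)"
    using f_lip[OF u(1), of ?s] p_bound[OF c_lip[OF u(1), of ?s]] by linarith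
  also have "\<dots> = (C + C\<^sup>2) * n ?s * n ?u" by (simp add: power2_eq_square algebra_simps)
  also have "\<dots> \<le> (2 * C\<^sup>2) * n ?s * M"
    using u(2) C0 C_powers(1) by (intro mult_mono mult_right_mono) auto
  finally show ?thesis using t(3) by (simp add: mult_ac)
qed

text \<open>The new cost is compared with the Lagrangian at \<open>dx\<close>, which costs 6, and
  then with the model through a Taylor expansion, which costs 2. The separate term with
  \<open>g\<close> is the Hessian discrepancy.\<close>

lemma model_error:
  assumes tangent: "A dt = 0"
    and small: "2 * n (\<Delta>n + dt) < r" "C * n (\<Delta>n + dt) \<le> 1"
    and g: "\<And>w. A w = 0 \<Longrightarrow> \<bar>df P x w\<bar> \<le> g * n w" "g \<ge> 0"
  defines "dx \<equiv> \<Delta>n + dt" and "ds \<equiv> correction P x (\<Delta>n + dt)"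
  shows "\<bar>f (dx + ds) - q_hat P x 1 \<Delta>n dt\<bar> \<le> 8 * C ^ 3 * n dx ^ 3 + 2 * C * g * (n dx)\<^sup>2"
proof -
  define m where "m = n dx"
  have m: "0 \<le> m" "2 * m < r" "C * m \<le> 1" using small by (simp_all add: m_def dx_def)
  have dxr: "n dx < r" "n dx \<le> 2 * m" using m(1,2) unfolding m_def by linarith+
  have ds: "n ds \<le> C * m\<^sup>2" using correction_bound[OF dxr(1)] by (simp add: ds_def dx_def m_def)
  have "C * m\<^sup>2 \<le> m" using mult_right_mono[OF m(3,1)] by (simp add: power2_eq_square mult.assoc)
  then have "n ds \<le> m" using ds by simp
  then have dxs: "n (dx + ds) \<le> 2 * m" using ip.n_triangle[of x dx ds] by (simp add: m_def)
  then have dxsr: "n (dx + ds) < r" using m by simp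
  have ds_eq: "ds = T (- (c dx - c 0 - A dx))" by (simp only: ds_def dx_def correction_def T.neg)
  have Adx: "A dx = - c 0" by (simp add: dx_def A.add A_normal_step tangent)
  \<comment> \<open>The correction satisfies A ds = - c dx, since A dx = - c 0. So the constraint
    value after the correction is a pure linearization error, of third order in \<open>m\<close>
    when measured through \<open>T\<close>.\<close>
  have cds: "c (dx + ds) - c dx - A ds = c (dx + ds)"
    by (subst (2) ds_eq) (simp add: Adx)
  moreover have "\<bar>p (c (dx + ds) - c dx - A ds)\<bar> \<le> C * (C * (2 * m) * n ds)"
    using c_remainder[OF dxsr dxr(1) dxs dxr(2)] by (intro p_bound) simp
  ultimately have "\<bar>p (c (dx + ds))\<bar> \<le> 2 * C\<^sup>2 * m * n ds"
    unfolding cds by (simp add: power2_eq_square mult_ac)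
  moreover have "\<bar>Lg (dx + ds) - Lg dx\<bar> \<le> 2 * C\<^sup>2 * (2 * m) * n ds"
    using dxr dxsr dxs unfolding ds_eq by (intro L_correction)
  moreover have "f (dx + ds) = Lg (dx + ds) - p (c (dx + ds))" by (simp add: pull_L_def)
  ultimately have "\<bar>f (dx + ds) - Lg dx\<bar> \<le> 6 * C\<^sup>2 * m * n ds" by (simp add: abs_le_iff)
  also have "\<dots> \<le> 6 * C\<^sup>2 * m * (C * m\<^sup>2)" using ds m by (intro mult_left_mono) auto
  finally have 1: "\<bar>f (dx + ds) - Lg dx\<bar> \<le> 6 * C ^ 3 * m ^ 3"
    by (simp add: power2_eq_square power3_eq_cube mult_ac)
  have diff: "\<bar>D2 Lg 0 v w - H v w\<bar> \<le> C * g * m\<^sup>2"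
    if vw: "second_order_consistent P (constr P x) \<or> A v = 0 \<or> A w = 0" "n v \<le> m" "n w \<le> m" for v w
  proof -
    obtain u where u: "D2 Lg 0 v w - H v w = dL P x p u" "n u \<le> C * n v * n w"
      using transition[OF vw(1)] by blast
    have "\<bar>dL P x p u\<bar> \<le> g * n u" by (rule dL_bound[OF g])
    also have "\<dots> \<le> g * (C * n v * n w)" using u(2) g(2) by (intro mult_left_mono)
    also have "\<dots> \<le> g * (C * m * m)"
      using vw m C0 g(2) by (intro mult_left_mono mult_mono) auto
    finally show ?thesis using u(1) by (simp add: power2_eq_square mult_ac)
  qed
  have "ip P x \<Delta>n dt = 0" by (rule normal_step_orth[OF tangent])
  from ip.orthogonal_le1[OF this] ip.orthogonal_le2[OF this]
  have parts: "n \<Delta>n \<le> m" "n dt \<le> m" by (simp_all add: m_def dx_def)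
  have Cgm: "0 \<le> C * g * m\<^sup>2" using C0 g(2) by simp
  have Cm3: "C * m ^ 3 \<le> C ^ 3 * m ^ 3" using C_powers(3) m(1) by (intro mult_right_mono) auto
  have "\<bar>Lg dx - q_hat P x 1 \<Delta>n dt\<bar> \<le> 2 * C ^ 3 * m ^ 3 + 2 * C * g * m\<^sup>2"
  proof (cases "second_order_consistent P (constr P x)")
    case True
    have q: "q_hat P x 1 \<Delta>n dt = f 0 + df P x dx + H dx dx / 2"
      using True by (simp add: q_hat_def q_o_def dx_def)
    have "Lg 0 + dL P x p dx = f 0 + df P x dx" by (simp add: pull_L_def dL_def Adx p.neg)
    then have "Lg dx - q_hat P x 1 \<Delta>n dt =
       (Lg dx - Lg 0 - dL P x p dx - D2 Lg 0 dx dx / 2) + (D2 Lg 0 dx dx - H dx dx) / 2"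
      by (simp add: q field_simps)
    moreover have "\<bar>D2 Lg 0 dx dx - H dx dx\<bar> \<le> C * g * m\<^sup>2"
      using True by (intro diff) (auto simp: m_def)
    moreover have "\<bar>Lg dx - Lg 0 - dL P x p dx - D2 Lg 0 dx dx / 2\<bar> \<le> C * m ^ 3"
      using taylor_L[OF dxr(1)] by (simp add: m_def)
    ultimately have "\<bar>Lg dx - q_hat P x 1 \<Delta>n dt\<bar> \<le> C * m ^ 3 + C * g * m\<^sup>2 / 2"
      by (rule abs_remainder_bounds(1))
    moreover have "C * m ^ 3 \<ge> 0" using C0 m by simp
    ultimately show ?thesis using Cm3 Cgm by linarith
  next
    case False
    \<comment> \<open>Without consistency the Hessians may disagree on normal pairs. This model
      contains the exact value at \<open>\<Delta>n\<close>, so subtracting the expansion there from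
      the one at \<open>dx\<close> cancels that block, and the remaining pairs have a tangential
      argument.\<close>
    have q: "q_hat P x 1 \<Delta>n dt = Lg \<Delta>n + (df P x dt + H \<Delta>n dt) + H dt dt / 2"
      using False by (simp add: q_hat_def q_tilde_def)
    interpret D2: bounded_bilinear "D2 Lg 0"
      by (rule twice_diff_bounded_bilinear_D2[OF twice_diff_L]) (simp add: r)
    have sym: "D2 Lg 0 v w = D2 Lg 0 w v" for v w
      by (rule D2_symmetric[OF twice_diff_L]) (simp add: r)
    have "dL P x p dx = dL P x p \<Delta>n + df P x dt"
      by (simp add: dx_def dL_def A.add df.add p.add tangent)
    moreover have "D2 Lg 0 dx dx = D2 Lg 0 \<Delta>n \<Delta>n + 2 * D2 Lg 0 \<Delta>n dt + D2 Lg 0 dt dt"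
      by (simp add: dx_def D2.add_left D2.add_right sym[of dt \<Delta>n])
    ultimately have "Lg dx - q_hat P x 1 \<Delta>n dt =
       (Lg dx - Lg 0 - dL P x p dx - D2 Lg 0 dx dx / 2) - (Lg \<Delta>n - Lg 0 - dL P x p \<Delta>n - D2 Lg 0 \<Delta>n \<Delta>n / 2)
       + (D2 Lg 0 \<Delta>n dt - H \<Delta>n dt) + (D2 Lg 0 dt dt - H dt dt) / 2"
      by (simp only: q add_divide_distrib diff_divide_distrib)
    then have "\<bar>Lg dx - q_hat P x 1 \<Delta>n dt\<bar> \<le> 2 * (C * m ^ 3) + 3 / 2 * (C * g * m\<^sup>2)"
    proof (rule abs_remainder_bounds(2))
      show "\<bar>Lg dx - Lg 0 - dL P x p dx - D2 Lg 0 dx dx / 2\<bar> \<le> C * m ^ 3"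
        using taylor_L[OF dxr(1)] by (simp add: m_def)
      have "n \<Delta>n < r" using parts m by simp
      from taylor_L[OF this]
      show "\<bar>Lg \<Delta>n - Lg 0 - dL P x p \<Delta>n - D2 Lg 0 \<Delta>n \<Delta>n / 2\<bar> \<le> C * m ^ 3"
        by (rule order_trans[OF _ mult_left_mono[OF power_mono[OF parts(1)] C0(1)]]) simp
    qed (intro diff parts disjI2 tangent)+
    then show ?thesis using Cm3 Cgm by linarith
  qed
  then show ?thesis using 1 unfolding m_def by linarith
qed

end

section \<open>Trial steps\<close>

text \<open>Since \<open>eta_hat\<close> is below 1, \<eta> \<ge> 1 triggers the rule that forbids
  an increase.\<close>

lemma update_\<omega>f_bounds:
  assumes "update_\<omega>f q \<eta> raw old new" "valid_params q" "old > 0"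
  shows "new > 0" "new \<le> b_up q * old" "\<eta> \<ge> 1 \<Longrightarrow> new \<le> old"
proof -
  have q: "0 < b_low q" "b_low q < 1" "1 < b_up q" "1 < b_hat q" "eta_low q < 1" "eta_hat q < 1"
    using assms(2) by (simp_all add: valid_params_def)
  define k where "k = min (b_up q * old) (max (b_low q * old) raw)"
  have pos: "0 < b_low q * old" "0 < b_hat q * old" using q assms(3) by simp_all
  have bnd: "b_low q * old \<le> old" "old \<le> b_up q * old" using q assms(3) by simp_all
  have k: "k > 0" "k \<le> b_up q * old" using pos bnd assms(3) by (auto simp: k_def)
  have u: "if \<eta> < eta_low q then b_hat q * old \<le> new \<and> k \<le> new \<and> new \<le> b_up q * old
         else if \<eta> \<ge> eta_hat q then new = min old k else new = k"
    using assms(1) unfolding update_\<omega>f_def k_def Let_def .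
  show "new > 0" "new \<le> b_up q * old" "\<eta> \<ge> 1 \<Longrightarrow> new \<le> old"
    using u k pos bnd q assms(3) by (auto split: if_splits)
qed

context newton_point
begin

text \<open>The tangent step equation puts the vertex at s = 1. The step length minimizes with
  \<open>q_o\<close> while acceptance is judged with \<open>q_hat\<close>; along the line both
  differ only by a constant, so the minimizer is the same.\<close>

lemma q_line:
  assumes "tangent_step P x dn Dt"
  shows "q_o P x (dn + s *\<^sub>R Dt) = q_o P x dn + (H Dt Dt / 2 * (1 - s)\<^sup>2 - H Dt Dt / 2)"
    and "q_hat P x \<nu> dn (s *\<^sub>R Dt) = q_hat P x \<nu> dn 0 + (H Dt Dt / 2 * (1 - s)\<^sup>2 - H Dt Dt / 2)"
proof -
  note t = tangent_stepD[OF assms]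
  define k where "k = H Dt Dt / 2 * (1 - s)\<^sup>2 - H Dt Dt / 2"
  have h: "df P x Dt = - H Dt Dt - H dn Dt" using t(2)[OF t(1)] by simp
  have k: "s * df P x Dt + s * H dn Dt + s\<^sup>2 * H Dt Dt / 2 = k"
    unfolding h k_def by (simp add: power2_eq_square field_simps)
  have "H (dn + s *\<^sub>R Dt) (dn + s *\<^sub>R Dt) = H dn dn + 2 * (s * H dn Dt) + s\<^sup>2 * H Dt Dt"
    by (simp add: H.add_left H.add_right H.scaleR_left H.scaleR_right H_sym[of Dt dn] power2_eq_square algebra_simps)
  then have q_o: "q_o P x (dn + s *\<^sub>R Dt) = q_o P x dn + k"
    unfolding q_o_def df.add df.scaleR real_scaleR_def k[symmetric] by (simp add: add_divide_distrib)
  then show "q_o P x (dn + s *\<^sub>R Dt) = q_o P x dn + (H Dt Dt / 2 * (1 - s)\<^sup>2 - H Dt Dt / 2)"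
    unfolding k_def .
  have "q_tilde P x \<nu> dn (s *\<^sub>R Dt) = q_tilde P x \<nu> dn 0 + k"
    unfolding k[symmetric]
    by (simp add: q_tilde_def df.scaleR df.zero H.zero_right H.scaleR_left H.scaleR_right power2_eq_square)
  then show "q_hat P x \<nu> dn (s *\<^sub>R Dt) = q_hat P x \<nu> dn 0 + (H Dt Dt / 2 * (1 - s)\<^sup>2 - H Dt Dt / 2)"
    using q_o by (simp add: q_hat_def k_def)
qed

lemma H_pos:
  assumes "A w = 0" "w \<noteq> 0"
  shows "H w w > 0"
proof -
  have "0 < (n w)\<^sup>2" using assms(2) by simp
  also have "\<dots> \<le> C * H w w" by (rule elliptic[OF assms(1)])
  finally show ?thesis using C0 by (simp add: zero_less_mult_iff)
qed

lemma cs_trialE: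
  assumes "cs_trial P q acc (x, \<omega>c, \<omega>f) (x', \<omega>c', \<omega>f')"
  obtains \<nu> dn Dt \<tau> dx ds \<sigma> \<eta> where "damping_factor P q x \<omega>c \<nu>" "dn = \<nu> *\<^sub>R \<Delta>n"
    "tangent_step P x dn Dt" "step_length P q x \<omega>c \<omega>f \<nu> dn Dt \<tau>"
    "dx = dn + \<tau> *\<^sub>R Dt" "ds = correction P x dx"
    "greatest_in {s. 0 \<le> s \<and> s \<le> 1 \<and> dx + s *\<^sub>R ds \<in> retr_dom P x} \<sigma>"
    "\<eta> = (f (dx + \<sigma> *\<^sub>R ds) - cubic_model P x \<omega>f \<nu> dn 0) /
         (cubic_model P x \<omega>f \<nu> dn (\<tau> *\<^sub>R Dt) - cubic_model P x \<omega>f \<nu> dn 0)"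
    "acc \<longrightarrow> \<eta> \<ge> eta_low q" "\<omega>c' = 2 * n ds / (n dx)\<^sup>2"
    "update_\<omega>f q \<eta> (6 / n dx ^ 3 * (f (dx + \<sigma> *\<^sub>R ds) - q_hat P x \<nu> dn (\<tau> *\<^sub>R Dt))) \<omega>f \<omega>f'"
    "x' = (if acc then retr P x (dx + \<sigma> *\<^sub>R ds) else x)"
  using assms unfolding cs_trial_def prod.case by blast

lemma damping_bound:
  assumes "damping_factor P q x \<omega>c \<nu>"
  shows "0 < \<nu>" "\<nu> \<le> 1" "n (\<nu> *\<^sub>R \<Delta>n) \<le> 2 * C * e"
proof -
  show \<nu>: "0 < \<nu>" "\<nu> \<le> 1" using assms by (auto simp: damping_factor_def greatest_in_def)
  have "n (\<nu> *\<^sub>R \<Delta>n) \<le> n \<Delta>n" using \<nu> by (simp add: mult_left_le_one_le)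
  then show "n (\<nu> *\<^sub>R \<Delta>n) \<le> 2 * C * e" using normal_step_bound by simp
qed

lemma scaled_tangent_bound:
  assumes "damping_factor P q x \<omega>c \<nu>" "tangent_step P x (\<nu> *\<^sub>R \<Delta>n) Dt"
  shows "n Dt \<le> 5 * C ^ 3 * e"
proof -
  have "C\<^sup>2 * n (\<nu> *\<^sub>R \<Delta>n) \<le> C\<^sup>2 * (2 * C * e)"
    using damping_bound(3)[OF assms(1)] by (intro mult_left_mono) auto
  also have "\<dots> = 2 * C ^ 3 * e" by (simp add: power2_eq_square power3_eq_cube)
  finally show ?thesis using tangent_step_bound[OF assms(2)] by simp
qed

lemma step_orth: "A w = 0 \<Longrightarrow> ip P x (\<nu> *\<^sub>R \<Delta>n) w = 0"
  using normal_step_orth[of w] by (simp add: ip.B.scaleR_left)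

lemma step_feasible: "A w = 0 \<Longrightarrow> \<nu> *\<^sub>R c 0 + A (\<nu> *\<^sub>R \<Delta>n + s *\<^sub>R w) = 0"
  by (simp add: A.add A.scaleR A_normal_step)

text \<open>Valid for arbitrary \<omega>c: the parameter 0 is always admissible because
  \<open>rho_ellbow\<close> is at most 1, and comparison with it gives \<tau> \<le> 2. The 12 is 2
  for the normal part and 2 * 5 for the tangential part.\<close>

lemma rough_step_bound:
  assumes q: "valid_params q" and "\<omega>f > 0"
    and d: "damping_factor P q x \<omega>c \<nu>" and t: "tangent_step P x (\<nu> *\<^sub>R \<Delta>n) Dt"
    and s: "step_length P q x \<omega>c \<omega>f \<nu> (\<nu> *\<^sub>R \<Delta>n) Dt \<tau>"
  shows "n (\<nu> *\<^sub>R \<Delta>n + \<tau> *\<^sub>R Dt) \<le> 12 * C ^ 3 * e"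
proof -
  note At = tangent_stepD(1)[OF t]
  let ?dn = "\<nu> *\<^sub>R \<Delta>n"
  have dn: "n ?dn \<le> 2 * C ^ 3 * e"
    using damping_bound(3)[OF d] mult_right_mono[OF C_powers(3) e_ge_0] by simp
  have "n (\<tau> *\<^sub>R Dt) \<le> 10 * C ^ 3 * e"
  proof (cases "Dt = 0")
    case False
    have h: "H Dt Dt > 0" by (rule H_pos[OF At False])
    have "rho_ellbow q * theta_aim q \<le> theta_aim q"
      using q by (simp add: valid_params_def mult_left_le_one_le)
    then have "0 \<in> step_lengths P q x \<omega>c \<nu> ?dn Dt"
      using d step_feasible[OF At, of \<nu> 0]
      by (auto simp: step_lengths_def damping_factor_def greatest_in_def)
    then have "q_o P x (?dn + \<tau> *\<^sub>R Dt) + \<omega>f / 6 * n (?dn + \<tau> *\<^sub>R Dt) ^ 3 \<le>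
        q_o P x (?dn + 0 *\<^sub>R Dt) + \<omega>f / 6 * n (?dn + 0 *\<^sub>R Dt) ^ 3"
      using s unfolding step_length_def Let_def by blast
    then have "H Dt Dt / 2 * (1 - \<tau>)\<^sup>2 + \<omega>f / 6 * n (?dn + \<tau> *\<^sub>R Dt) ^ 3 \<le> H Dt Dt / 2 + \<omega>f / 6 * n ?dn ^ 3"
      unfolding q_line(1)[OF t] by (simp del: ip.n_scaleR)
    from ip.line_minimum_weak[OF step_orth[OF At] h _ this] \<open>\<omega>f > 0\<close>
    have "0 \<le> \<tau>" "\<tau> \<le> 2" by auto
    then have "n (\<tau> *\<^sub>R Dt) \<le> 2 * n Dt" by (simp add: mult_right_mono)
    then show ?thesis using scaled_tangent_bound[OF d t] by simp
  qed (use C0 e_ge_0 in simp)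
  then show ?thesis using dn ip.n_triangle[of x ?dn "\<tau> *\<^sub>R Dt"] by simp
qed

text \<open>However large \<omega>c was, one trial near the solution resets it to at most 2C, as the
  correction is quadratic in the step. If \<open>dx\<close> vanishes, the new value is 0 by the
  division convention.\<close>

lemma trial_rough:
  assumes trial: "cs_trial P q acc (x, \<omega>c, \<omega>f) (x', \<omega>c', \<omega>f')"
    and q: "valid_params q" and "\<omega>f > 0" and small: "12 * C ^ 3 * e < r"
  shows "0 \<le> \<omega>c'" "\<omega>c' \<le> 2 * C" "0 < \<omega>f'" "\<not> acc \<Longrightarrow> x' = x"
proof -
  from trial obtain \<nu> dn Dt \<tau> dx ds \<sigma> \<eta> where
    d: "damping_factor P q x \<omega>c \<nu>" and dn: "dn = \<nu> *\<^sub>R \<Delta>n"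
    and t: "tangent_step P x dn Dt" and s: "step_length P q x \<omega>c \<omega>f \<nu> dn Dt \<tau>"
    and dx: "dx = dn + \<tau> *\<^sub>R Dt" "ds = correction P x dx"
    and \<omega>c': "\<omega>c' = 2 * n ds / (n dx)\<^sup>2"
    and u: "update_\<omega>f q \<eta> (6 / n dx ^ 3 * (f (dx + \<sigma> *\<^sub>R ds) - q_hat P x \<nu> dn (\<tau> *\<^sub>R Dt))) \<omega>f \<omega>f'"
    and x': "x' = (if acc then retr P x (dx + \<sigma> *\<^sub>R ds) else x)"
    by (rule cs_trialE) blast
  show "\<not> acc \<Longrightarrow> x' = x" by (simp add: x')
  show "0 < \<omega>f'" using update_\<omega>f_bounds(1)[OF u q \<open>\<omega>f > 0\<close>] .
  show "0 \<le> \<omega>c'" by (simp add: \<omega>c')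
  have "n dx < r"
    using rough_step_bound[OF q \<open>\<omega>f > 0\<close> d t[unfolded dn] s[unfolded dn]] small by (simp add: dx dn)
  from correction_bound[OF this] show "\<omega>c' \<le> 2 * C"
    using C0 by (cases "n dx = 0") (auto simp: \<omega>c' dx(2) field_simps)
qed

text \<open>With \<omega>c bounded, maximality gives \<nu> = 1 and \<sigma> = 1, and all of [0, 1]
  is admissible for \<tau>. The bound for \<omega>f' is restricted to a nonzero tangent step, and
  the first claim shows that an accepted trial always has one.\<close>

lemma trial_local:
  assumes trial: "cs_trial P q acc (x, \<omega>c, \<omega>f) (x', \<omega>c', \<omega>f')"
    and q: "valid_params q" and \<omega>c: "0 \<le> \<omega>c" "\<omega>c \<le> 2 * C" and \<omega>f: "\<omega>f > 0"
    and small: "144 * C ^ 6 * e < r" "144 * C ^ 6 * e \<le> rho_ellbow q * theta_aim q"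
  shows "acc \<Longrightarrow> \<not> tangent_step P x \<Delta>n 0"
    and "\<not> tangent_step P x \<Delta>n 0 \<Longrightarrow> \<omega>f' \<le> max \<omega>f (b_up q * (144 * C ^ 3))"
    and "acc \<Longrightarrow> \<exists>y. x' = retr P x y \<and> n y < r \<and> n (y - xs) \<le> (155 + 30 * \<omega>f) * C ^ 7 * e\<^sup>2"
proof -
  have qp: "0 < eta_low q" "0 < theta_aim q" "theta_aim q < 1" "rho_ellbow q * theta_aim q \<le> theta_aim q" "b_up q > 1"
    using q by (auto simp: valid_params_def mult_left_le_one_le)
  from trial obtain \<nu> dn Dt \<tau> dx ds \<sigma> \<eta> where
    d: "damping_factor P q x \<omega>c \<nu>" and dn: "dn = \<nu> *\<^sub>R \<Delta>n"
    and t\<nu>: "tangent_step P x dn Dt" and s\<nu>: "step_length P q x \<omega>c \<omega>f \<nu> dn Dt \<tau>"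
    and dx\<nu>: "dx = dn + \<tau> *\<^sub>R Dt" and ds_def: "ds = correction P x dx"
    and \<sigma>\<nu>: "greatest_in {s. 0 \<le> s \<and> s \<le> 1 \<and> dx + s *\<^sub>R ds \<in> retr_dom P x} \<sigma>"
    and \<eta>\<nu>: "\<eta> = (f (dx + \<sigma> *\<^sub>R ds) - cubic_model P x \<omega>f \<nu> dn 0) /
         (cubic_model P x \<omega>f \<nu> dn (\<tau> *\<^sub>R Dt) - cubic_model P x \<omega>f \<nu> dn 0)"
    and acc: "acc \<longrightarrow> \<eta> \<ge> eta_low q"
    and u\<nu>: "update_\<omega>f q \<eta> (6 / n dx ^ 3 * (f (dx + \<sigma> *\<^sub>R ds) - q_hat P x \<nu> dn (\<tau> *\<^sub>R Dt))) \<omega>f \<omega>f'"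
    and x'\<nu>: "x' = (if acc then retr P x (dx + \<sigma> *\<^sub>R ds) else x)"
    by (rule cs_trialE) blast
  \<comment> \<open>The single small quantity: every product C^k e with k \<le> 6 is at most
    \<open>E\<close>, which settles all smallness conditions below.\<close>
  define E where "E = C ^ 6 * e"
  have E: "0 \<le> E" "144 * E < r" "144 * E \<le> rho_ellbow q * theta_aim q"
    using small C0 e_ge_0 by (simp_all add: E_def mult.assoc)
  have Ck: "C ^ k * e \<le> E" if "k \<le> 6" for k
    unfolding E_def using power_increasing[OF that C] e_ge_0 by (rule mult_right_mono)
  have Ck': "C * (C ^ k * e) \<le> E" if "k \<le> 5" for k
    using Ck[of "Suc k"] that by (simp add: mult.assoc)
  have C1: "C * e = C ^ 1 * e" by simp
  have n\<Delta>n: "n \<Delta>n \<le> 2 * (C ^ 1 * e)" using normal_step_bound by simp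
  have in_dom: "n y < r \<Longrightarrow> y \<in> retr_dom P x" for y
    using dom interior_subset by blast
  have "\<omega>c / 2 * n \<Delta>n \<le> C * (2 * (C ^ 1 * e))"
    using \<omega>c n\<Delta>n C0 by (intro mult_mono) auto
  also have "\<dots> \<le> 2 * E" using Ck'[of 1] by simp
  finally have "\<omega>c / 2 * n \<Delta>n \<le> rho_ellbow q * theta_aim q" using E by linarith
  moreover have "\<Delta>n \<in> retr_dom P x" using n\<Delta>n Ck[of 1] E by (intro in_dom) linarith
  ultimately have "1 \<le> \<nu>" using d by (simp add: damping_factor_def greatest_in_def)
  then have \<nu>: "\<nu> = 1" using damping_bound(2)[OF d] by simp
  then have dn: "dn = \<Delta>n" by (simp add: dn)
  note t = t\<nu>[unfolded dn] and dx_def = dx\<nu>[unfolded dn]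
  note At = tangent_stepD(1)[OF t]
  have nDt: "n Dt \<le> 5 * (C ^ 3 * e)" using scaled_tangent_bound[OF d, of Dt] t by (simp add: \<nu>)
  have stuck: "Dt = 0" if "tangent_step P x \<Delta>n 0" using tangent_step_unique[OF t that] .
  show "\<not> tangent_step P x \<Delta>n 0" if acc
  proof
    assume "tangent_step P x \<Delta>n 0"
    then have "Dt = 0" by (rule stuck)
    \<comment> \<open>Numerator over predicted decrease 0, hence 0, which is below
      \<open>eta_low\<close>.\<close>
    then have "\<eta> = 0" by (simp add: \<eta>\<nu>)
    then show False using acc that qp by simp
  qed
  define m where "m = n dx"
  have m12: "m \<le> 12 * (C ^ 3 * e)"
    using rough_step_bound[OF q \<omega>f d, of Dt \<tau>] t s\<nu> by (simp add: \<nu> m_def dx_def dn)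
  have m0: "0 \<le> m" by (simp add: m_def)
  have mr: "2 * m < r" using m12 Ck[of 3] E by linarith
  have "C * m \<le> C * (12 * (C ^ 3 * e))" using m12 C0 by (intro mult_left_mono) auto
  then have Cm: "C * m \<le> 1" using Ck'[of 3] E r by simp
  have ds: "n ds \<le> C * m\<^sup>2" unfolding ds_def m_def by (rule correction_bound) (use mr m0 in \<open>unfold m_def, linarith\<close>)
  have "C * m\<^sup>2 \<le> m" using mult_right_mono[OF Cm m0] by (simp add: power2_eq_square mult.assoc)
  then have y: "n (dx + ds) < r" using ds ip.n_triangle[of x dx ds] mr by (simp add: m_def)
  have "1 \<le> \<sigma>" "\<sigma> \<le> 1"
    using \<sigma>\<nu> in_dom[OF y] by (simp_all add: greatest_in_def)
  then have \<sigma>: "\<sigma> = 1" by simp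
  have J: "H Dt Dt / 2 * (1 - \<tau>)\<^sup>2 + \<omega>f / 6 * n (\<Delta>n + \<tau> *\<^sub>R Dt) ^ 3
      \<le> H Dt Dt / 2 * (1 - s)\<^sup>2 + \<omega>f / 6 * n (\<Delta>n + s *\<^sub>R Dt) ^ 3"
    if s01: "0 \<le> s" "s \<le> 1" for s
  proof -
    have "n (s *\<^sub>R Dt) \<le> n Dt" using s01 by (simp add: mult_left_le_one_le)
    then have b: "n (\<Delta>n + s *\<^sub>R Dt) \<le> 2 * (C ^ 1 * e) + 5 * (C ^ 3 * e)"
      using ip.n_triangle[of x \<Delta>n "s *\<^sub>R Dt"] n\<Delta>n nDt by linarith
    have "\<omega>c / 2 * n (\<Delta>n + s *\<^sub>R Dt) \<le> C * (2 * (C ^ 1 * e) + 5 * (C ^ 3 * e))"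
      using \<omega>c b C0 by (intro mult_mono) auto
    also have "\<dots> \<le> 7 * E" using Ck'[of 1] Ck'[of 3] by (simp add: distrib_left)
    finally have "\<omega>c / 2 * n (\<Delta>n + s *\<^sub>R Dt) \<le> theta_aim q" using E qp by linarith
    moreover have "\<Delta>n + s *\<^sub>R Dt \<in> retr_dom P x"
      using b Ck[of 1] Ck[of 3] E by (intro in_dom) linarith
    ultimately have "s \<in> step_lengths P q x \<omega>c \<nu> dn Dt"
      using step_feasible[OF At, of 1 s] by (simp add: step_lengths_def \<nu> dn)
    then have "q_o P x (\<Delta>n + \<tau> *\<^sub>R Dt) + \<omega>f / 6 * n (\<Delta>n + \<tau> *\<^sub>R Dt) ^ 3 \<le>
        q_o P x (\<Delta>n + s *\<^sub>R Dt) + \<omega>f / 6 * n (\<Delta>n + s *\<^sub>R Dt) ^ 3"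
      using s\<nu> unfolding step_length_def Let_def dn by simp
    then show ?thesis unfolding q_line(1)[OF t] by simp
  qed
  have \<tau>: "0 < \<tau>" "\<tau> \<le> 1" "2 * (1 - \<tau>) \<le> C * \<omega>f * \<tau> * m"
    "H Dt Dt / 2 * (1 - \<tau>)\<^sup>2 + \<omega>f / 6 * m ^ 3 < H Dt Dt / 2 + \<omega>f / 6 * n \<Delta>n ^ 3" "m > 0"
    if "Dt \<noteq> 0"
  proof -
    have h: "H Dt Dt > 0" by (rule H_pos[OF At that])
    note lm = ip.line_minimum[OF normal_step_orth[OF At] h less_imp_le[OF \<omega>f] J]
    show "0 < \<tau>" "\<tau> \<le> 1" by (rule lm; assumption)+
    show "H Dt Dt / 2 * (1 - \<tau>)\<^sup>2 + \<omega>f / 6 * m ^ 3 < H Dt Dt / 2 + \<omega>f / 6 * n \<Delta>n ^ 3"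
      unfolding m_def dx_def by (rule lm(4))
    have "2 * H Dt Dt * (1 - \<tau>) \<le> \<omega>f * (n Dt)\<^sup>2 * \<tau> * m" unfolding m_def dx_def by (rule lm(3))
    also have "\<dots> \<le> \<omega>f * (C * H Dt Dt) * \<tau> * m"
      using elliptic[OF At] \<omega>f m0 \<open>0 < \<tau>\<close> by (intro mult_right_mono mult_left_mono) auto
    finally have "H Dt Dt * (2 * (1 - \<tau>)) \<le> H Dt Dt * (C * \<omega>f * \<tau> * m)" by (simp only: mult_ac)
    then show "2 * (1 - \<tau>) \<le> C * \<omega>f * \<tau> * m" using h by simp
    have "n (\<tau> *\<^sub>R Dt) \<le> m"
      unfolding m_def dx_def using ip.orthogonal_le2[of x \<Delta>n "\<tau> *\<^sub>R Dt"] normal_step_orth[OF At]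
      by (simp add: ip.B.scaleR_right)
    moreover have "n (\<tau> *\<^sub>R Dt) > 0" using that \<open>0 < \<tau>\<close> ip.n_eq_0[of x Dt] ip.n_nonneg[of x Dt]
      by (simp add: order_less_le)
    ultimately show "m > 0" by linarith
  qed
  show "\<omega>f' \<le> max \<omega>f (b_up q * (144 * C ^ 3))" if ns: "\<not> tangent_step P x \<Delta>n 0"
  proof -
    have "Dt \<noteq> 0" using ns t by blast
    note \<tau> = \<tau>[OF this]
    define raw where "raw = 6 / m ^ 3 * (f (dx + ds) - q_hat P x 1 \<Delta>n (\<tau> *\<^sub>R Dt))"
    have u: "update_\<omega>f q \<eta> raw \<omega>f \<omega>f'"
      using u\<nu> by (simp add: \<nu> \<sigma> raw_def m_def dn)
    have orth: "ip P x \<Delta>n (\<tau> *\<^sub>R Dt) = 0" using normal_step_orth[OF At] by (simp add: ip.B.scaleR_right)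
    have parts: "n \<Delta>n \<le> m" "\<tau> * n Dt \<le> m"
      using ip.orthogonal_le1[OF orth] ip.orthogonal_le2[OF orth] \<tau>(1) by (simp_all add: m_def dx_def)
    \<comment> \<open>Bounds the full step by the step actually taken. The factor \<tau> in the
      estimate of 1 - \<tau> combines with \<open>n Dt\<close> to the shortened step, so no division
      by \<tau> occurs.\<close>
    have full: "n (\<Delta>n + Dt) \<le> 2 * m + C * \<omega>f * m\<^sup>2 / 2"
    proof -
      have "(1 - \<tau>) * n Dt \<le> (C * \<omega>f * \<tau> * m / 2) * n Dt"
        using \<tau>(3) by (intro mult_right_mono) auto
      also have "\<dots> = (C * \<omega>f * m / 2) * (\<tau> * n Dt)" by simp
      also have "\<dots> \<le> (C * \<omega>f * m / 2) * m" using parts(2) C0 \<omega>f m0 by (intro mult_left_mono) auto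
      finally have "n Dt \<le> m + C * \<omega>f * m\<^sup>2 / 2" using parts(2) by (simp add: power2_eq_square algebra_simps)
      then show ?thesis using ip.n_triangle[of x \<Delta>n Dt] parts(1) by linarith
    qed
    define g where "g = C * (2 * m + C * \<omega>f * m\<^sup>2 / 2)"
    have g0: "0 \<le> g" using C0 \<omega>f m0 by (simp add: g_def)
    have g: "\<bar>df P x w\<bar> \<le> g * n w" if "A w = 0" for w
    proof -
      have "\<bar>df P x w\<bar> \<le> C * n (\<Delta>n + Dt) * n w" by (rule df_kernel_le_step[OF t that])
      also have "\<dots> \<le> g * n w" unfolding g_def using full C0 by (intro mult_right_mono mult_left_mono) auto
      finally show ?thesis .
    qed
    have "A (\<tau> *\<^sub>R Dt) = 0" by (simp add: A.scaleR At)
    from model_error[OF this _ _ g g0, folded dx_def, folded ds_def m_def, OF mr Cm]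
    have "f (dx + ds) - q_hat P x 1 \<Delta>n (\<tau> *\<^sub>R Dt) \<le> 8 * C ^ 3 * m ^ 3 + 2 * C * g * m\<^sup>2"
      by simp
    also have "\<dots> = (8 * C ^ 3 + 4 * C\<^sup>2 + C ^ 3 * m * \<omega>f) * m ^ 3"
      by (simp add: g_def power2_eq_square power3_eq_cube algebra_simps)
    finally have "6 / m ^ 3 * (f (dx + ds) - q_hat P x 1 \<Delta>n (\<tau> *\<^sub>R Dt))
        \<le> 6 / m ^ 3 * ((8 * C ^ 3 + 4 * C\<^sup>2 + C ^ 3 * m * \<omega>f) * m ^ 3)"
      using \<tau>(5) by (intro mult_left_mono) auto
    then have "raw \<le> 6 * (8 * C ^ 3 + 4 * C\<^sup>2 + C ^ 3 * m * \<omega>f)" using \<tau>(5) by (simp add: raw_def)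
    \<comment> \<open>The factor 144 in the smallness hypothesis yields 12/144 = 1/12; multiplied by
      6 it leaves half of \<omega>f in the bound for \<open>raw\<close>.\<close>
    moreover have "C ^ 3 * m * \<omega>f \<le> (1 / 12) * \<omega>f"
    proof -
      have "C ^ 3 * m \<le> C ^ 3 * (12 * (C ^ 3 * e))" using m12 C0 by (intro mult_left_mono) auto
      also have "\<dots> = 12 * E" by (simp add: E_def flip: power_add)
      finally show ?thesis using E r \<omega>f by (intro mult_right_mono) auto
    qed
    ultimately have raw: "raw \<le> 72 * C ^ 3 + \<omega>f / 2" using C_powers(2) by argo
    show ?thesis
    \<comment> \<open>If \<open>raw\<close> does not exceed \<omega>f, the cost lies below the cubic
      model and \<eta> \<ge> 1. Otherwise \<omega>f is below its fixed threshold 144 C^3, and one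
      update multiplies it by at most \<open>b_up\<close>.\<close>
    proof (cases "raw \<le> \<omega>f")
      case True
      let ?m1 = "cubic_model P x \<omega>f 1 \<Delta>n (\<tau> *\<^sub>R Dt)" and ?m0 = "cubic_model P x \<omega>f 1 \<Delta>n 0"
      have "?m1 - ?m0 = (H Dt Dt / 2 * (1 - \<tau>)\<^sup>2 + \<omega>f / 6 * m ^ 3) - (H Dt Dt / 2 + \<omega>f / 6 * n \<Delta>n ^ 3)"
        unfolding cubic_model_def q_line(2)[OF t] by (simp add: m_def dx_def)
      then have neg: "?m1 - ?m0 < 0" using \<tau>(4) by simp
      have "f (dx + ds) - q_hat P x 1 \<Delta>n (\<tau> *\<^sub>R Dt) \<le> \<omega>f / 6 * m ^ 3"
        using True \<tau>(5) by (simp add: raw_def field_simps)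
      then have "f (dx + ds) \<le> ?m1" by (simp add: cubic_model_def m_def dx_def)
      then have "1 \<le> (f (dx + ds) - ?m0) / (?m1 - ?m0)"
        using neg by (simp add: neg_le_divide_eq)
      then have "\<eta> \<ge> 1" using \<eta>\<nu> by (simp add: \<nu> \<sigma> dn)
      then show ?thesis using update_\<omega>f_bounds(3)[OF u q \<omega>f] by simp
    next
      case False
      then have "\<omega>f \<le> 144 * C ^ 3" using raw by linarith
      then have "b_up q * \<omega>f \<le> b_up q * (144 * C ^ 3)" using qp by (intro mult_left_mono) auto
      then show ?thesis using update_\<omega>f_bounds(2)[OF u q \<omega>f] by simp
    qed
  qed
  show "\<exists>y. x' = retr P x y \<and> n y < r \<and> n (y - xs) \<le> (155 + 30 * \<omega>f) * C ^ 7 * e\<^sup>2" if acc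
  proof (intro exI conjI)
    show "x' = retr P x (dx + ds)" using x'\<nu> that by (simp add: \<sigma>)
    show "n (dx + ds) < r" by (rule y)
    have le7: "C ^ 4 \<le> C ^ 7" using power_increasing[of 4 7 C] C by simp
    have 1: "n (\<Delta>n + Dt - xs) \<le> 11 * C ^ 7 * e\<^sup>2"
      using newton_step_error[OF t] mult_right_mono[OF le7, of "e\<^sup>2"] by simp
    have 2: "n ((1 - \<tau>) *\<^sub>R Dt) \<le> 30 * \<omega>f * C ^ 7 * e\<^sup>2"
    proof (cases "Dt = 0")
      case False
      note \<tau> = \<tau>[OF False]
      have "C * \<omega>f * \<tau> * m \<le> C * \<omega>f * 1 * m"
        using \<tau>(2) C0 \<omega>f m0 by (intro mult_right_mono mult_left_mono) auto
      then have "1 - \<tau> \<le> C * \<omega>f * m / 2" using \<tau>(3) by simp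
      then have "(1 - \<tau>) * n Dt \<le> (C * \<omega>f * m / 2) * n Dt" by (intro mult_right_mono) auto
      also have "\<dots> \<le> (C * \<omega>f * (12 * (C ^ 3 * e)) / 2) * (5 * (C ^ 3 * e))"
        using m12 nDt C0 \<omega>f m0 e_ge_0 by (intro mult_mono divide_right_mono mult_left_mono) auto
      also have "\<dots> = 30 * \<omega>f * C ^ 7 * e\<^sup>2" by (simp add: power2_eq_square power_numeral_reduce)
      finally show ?thesis using \<tau>(2) by simp
    qed (use C0 \<omega>f in simp)
    have 3: "n ds \<le> 144 * C ^ 7 * e\<^sup>2"
    proof -
      have "C * m\<^sup>2 \<le> C * (12 * (C ^ 3 * e))\<^sup>2" using m12 m0 C0 by (intro mult_left_mono power_mono) auto
      also have "\<dots> = 144 * C ^ 7 * e\<^sup>2" by (simp add: power2_eq_square power_numeral_reduce)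
      finally show ?thesis using ds by simp
    qed
    \<comment> \<open>Newton error, shortening of the tangent step and correction contribute 11, 30
      \<omega>f and 144; here 30 = 12 * 5 / 2 and 144 = 12^2.\<close>
    have eq: "dx + ds - xs = (\<Delta>n + Dt - xs) - (1 - \<tau>) *\<^sub>R Dt + ds" by (simp add: dx_def algebra_simps)
    have "n (dx + ds - xs) \<le> n (\<Delta>n + Dt - xs) + n ((1 - \<tau>) *\<^sub>R Dt) + n ds"
      unfolding eq using ip.n_triangle[of x "(\<Delta>n + Dt - xs) - (1 - \<tau>) *\<^sub>R Dt" ds]
        ip.n_triangle_diff[of x "\<Delta>n + Dt - xs" "(1 - \<tau>) *\<^sub>R Dt"] by linarith
    also have "\<dots> \<le> 11 * C ^ 7 * e\<^sup>2 + 30 * \<omega>f * C ^ 7 * e\<^sup>2 + 144 * C ^ 7 * e\<^sup>2"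
      using 1 2 3 by (intro add_mono)
    finally show "n (dx + ds - xs) \<le> (155 + 30 * \<omega>f) * C ^ 7 * e\<^sup>2" by (simp add: algebra_simps)
  qed
qed

section \<open>From trial steps to iterations\<close>

lemma rejected_trials:
  assumes "(cs_trial P q False)\<^sup>*\<^sup>* (x, \<omega>c, \<omega>f) s" "valid_params q" "\<omega>f > 0" "12 * C ^ 3 * e < r"
  obtains \<omega>c' \<omega>f' where "s = (x, \<omega>c', \<omega>f')" "\<omega>f' > 0"
  using assms(1)
proof (induction arbitrary: thesis rule: rtranclp_induct)
  case base
  then show ?case using assms(3) by blast
next
  case (step s s')
  obtain \<omega>c1 \<omega>f1 where s: "s = (x, \<omega>c1, \<omega>f1)" "\<omega>f1 > 0" using step.IH by blast
  obtain x' \<omega>c' \<omega>f' where s': "s' = (x', \<omega>c', \<omega>f')" by (cases s')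
  from trial_rough[OF step.hyps(2)[unfolded s s'] assms(2) s(2) assms(4)]
  show ?case using step.prems s' by auto
qed

text \<open>Only the last, accepted trial matters. It supplies the hypothesis on \<omega>c that
  \<open>iteration_local\<close> needs at the next iterate.\<close>

lemma iteration_rough:
  assumes "((cs_trial P q False)\<^sup>*\<^sup>* OO cs_trial P q True) (x, \<omega>c, \<omega>f) (x', \<omega>c', \<omega>f')"
    "valid_params q" "\<omega>f > 0" "12 * C ^ 3 * e < r"
  shows "0 \<le> \<omega>c'" "\<omega>c' \<le> 2 * C"
proof -
  from assms(1) obtain s where s: "(cs_trial P q False)\<^sup>*\<^sup>* (x, \<omega>c, \<omega>f) s" "cs_trial P q True s (x', \<omega>c', \<omega>f')"
    by blast
  obtain a b where ab: "s = (x, a, b)" "b > 0" using rejected_trials[OF s(1) assms(2-4)] by blast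
  show "0 \<le> \<omega>c'" "\<omega>c' \<le> 2 * C"
    using trial_rough(1,2)[OF s(2)[unfolded ab(1)] assms(2) ab(2) assms(4)] by auto
qed

lemma rejected_trials_local:
  assumes "(cs_trial P q False)\<^sup>*\<^sup>* (x, \<omega>c, \<omega>f) s" and q: "valid_params q"
    and \<omega>: "0 \<le> \<omega>c" "\<omega>c \<le> 2 * C" "\<omega>f > 0"
    and small: "12 * C ^ 3 * e < r" "144 * C ^ 6 * e < r" "144 * C ^ 6 * e \<le> rho_ellbow q * theta_aim q"
  obtains \<omega>c' \<omega>f' where "s = (x, \<omega>c', \<omega>f')" "0 \<le> \<omega>c'" "\<omega>c' \<le> 2 * C" "\<omega>f' > 0"
    "\<not> tangent_step P x \<Delta>n 0 \<Longrightarrow> \<omega>f' \<le> max \<omega>f (b_up q * (144 * C ^ 3))"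
  using assms(1)
proof (induction arbitrary: thesis rule: rtranclp_induct)
  case base
  then show ?case using \<omega> by simp
next
  case (step s s')
  obtain \<omega>c1 \<omega>f1 where s: "s = (x, \<omega>c1, \<omega>f1)" "0 \<le> \<omega>c1" "\<omega>c1 \<le> 2 * C" "\<omega>f1 > 0"
    "\<not> tangent_step P x \<Delta>n 0 \<Longrightarrow> \<omega>f1 \<le> max \<omega>f (b_up q * (144 * C ^ 3))"
    using step.IH by blast
  obtain x' \<omega>c' \<omega>f' where s': "s' = (x', \<omega>c', \<omega>f')" by (cases s')
  note trial = step.hyps(2)[unfolded s(1) s']
  show ?case
  proof (rule step.prems)
    show "s' = (x, \<omega>c', \<omega>f')" "0 \<le> \<omega>c'" "\<omega>c' \<le> 2 * C" "\<omega>f' > 0"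
      using trial_rough[OF trial q s(4) small(1)] s' by auto
    show "\<omega>f' \<le> max \<omega>f (b_up q * (144 * C ^ 3))" if "\<not> tangent_step P x \<Delta>n 0"
      using trial_local(2)[OF trial q s(2-4) small(2,3) that] s(5)[OF that] by simp
  qed
qed

text \<open>Acceptance of the last trial shows that the tangent step at \<open>x\<close> is nonzero.
  This depends on \<open>x\<close> only, so the bound for \<omega>f holds retroactively for all
  rejected trials there. \<open>W\<close> is an invariant because updates never exceed the maximum
  of the old value and the threshold.\<close>

lemma iteration_local:
  assumes it: "((cs_trial P q False)\<^sup>*\<^sup>* OO cs_trial P q True) (x, \<omega>c, \<omega>f) (x', \<omega>c', \<omega>f')"
    and q: "valid_params q" and \<omega>: "0 \<le> \<omega>c" "\<omega>c \<le> 2 * C" "\<omega>f > 0"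
    and small: "12 * C ^ 3 * e < r" "144 * C ^ 6 * e < r" "144 * C ^ 6 * e \<le> rho_ellbow q * theta_aim q"
    and W: "\<omega>f \<le> W" "b_up q * (144 * C ^ 3) \<le> W"
  shows "\<omega>f' \<le> W"
    and "\<exists>y. x' = retr P x y \<and> n y < r \<and> n (y - xs) \<le> (155 + 30 * W) * C ^ 7 * e\<^sup>2"
proof -
  from it obtain s where s: "(cs_trial P q False)\<^sup>*\<^sup>* (x, \<omega>c, \<omega>f) s" "cs_trial P q True s (x', \<omega>c', \<omega>f')"
    by blast
  obtain a b where ab: "s = (x, a, b)" "0 \<le> a" "a \<le> 2 * C" "b > 0"
    "\<not> tangent_step P x \<Delta>n 0 \<Longrightarrow> b \<le> max \<omega>f (b_up q * (144 * C ^ 3))"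
    using rejected_trials_local[OF s(1) q \<omega> small] by blast
  note l = trial_local[OF s(2)[unfolded ab(1)] q ab(2-4) small(2,3)]
  have ns: "\<not> tangent_step P x \<Delta>n 0" using l(1) by simp
  then have b: "b \<le> W" using ab(5) W by simp
  then show "\<omega>f' \<le> W" using l(2)[OF ns] W(2) by simp
  have "(155 + 30 * b) * C ^ 7 * e\<^sup>2 \<le> (155 + 30 * W) * C ^ 7 * e\<^sup>2"
    using b C0 by (intro mult_right_mono) auto
  then show "\<exists>y. x' = retr P x y \<and> n y < r \<and> n (y - xs) \<le> (155 + 30 * W) * C ^ 7 * e\<^sup>2"
    using l(3) by fastforce
qed

end

section \<open>Convergence\<close>

context problem
begin

text \<open>The supremum defining the dual norm carries information only if its range is bounded
  above, which the boundedness of \<open>l\<close> provides.\<close>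

lemma dual_nrm_bound:
  assumes l: "bounded_linear l" and le: "dual_nrm P x l \<le> b"
  shows "\<bar>l v\<bar> \<le> b * nrm P x v"
proof -
  interpret l: bounded_linear l by (rule l)
  obtain K where K: "K > 0" "\<And>v. norm (l v) \<le> norm v * K" using l.pos_bounded by blast
  obtain K1 where K1: "K1 > 0" "\<And>v. norm v \<le> K1 * nrm P x v" using ip.norm_le_n[of x] by blast
  have "l v / nrm P x v \<le> K1 * K" for v
  proof (cases "v = 0")
    case False
    then have pos: "nrm P x v > 0" using ip.n_eq_0[of x v] ip.n_nonneg[of x v] by (simp add: order_less_le)
    have "l v \<le> norm v * K" using K(2)[of v] by simp
    also have "\<dots> \<le> K1 * nrm P x v * K" using K1(2)[of v] K(1) by (intro mult_right_mono) auto
    finally show ?thesis using pos by (simp add: field_simps)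
  qed (use K K1 in \<open>simp add: l.zero\<close>)
  then have bdd: "bdd_above (range (\<lambda>v. l v / nrm P x v))" by (intro bdd_aboveI2)
  have "l v \<le> b * nrm P x v" for v
  proof (cases "v = 0")
    case False
    then have pos: "nrm P x v > 0" using ip.n_eq_0[of x v] ip.n_nonneg[of x v] by (simp add: order_less_le)
    have "l v / nrm P x v \<le> dual_nrm P x l" unfolding dual_nrm_def by (rule cSUP_upper[OF UNIV_I bdd])
    then have "l v / nrm P x v \<le> b" using le by simp
    then show ?thesis using pos by (simp add: field_simps)
  qed (simp add: l.zero)
  from this[of v] this[of "- v"] show ?thesis by (simp add: l.neg abs_le_iff)
qed

lemma eventually_nhds_nrm:
  assumes "eventually Q (nhds (0::'e))"
  obtains \<delta> where "\<delta> > 0" "\<And>v. nrm P x v < \<delta> \<Longrightarrow> Q v"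
proof -
  obtain d where d: "d > 0" "\<And>v. dist v 0 < d \<Longrightarrow> Q v" using assms unfolding eventually_nhds_metric by blast
  obtain K where K: "K > 0" "\<And>v. norm v \<le> K * nrm P x v" using ip.norm_le_n[of x] by blast
  show thesis
  proof (rule that[of "d / K"])
    show "d / K > 0" using d K by simp
    fix v assume "nrm P x v < d / K"
    then have "K * nrm P x v < d" using K(1) by (simp add: field_simps)
    then have "dist v 0 < d" using K(2)[of v] by simp
    then show "Q v" by (rule d(2))
  qed
qed

lemma rinv_self [simp]: "rinv P x x = 0"
proof -
  have "0 \<in> retr_inv_dom P x" "inj_on (retr P x) (retr_inv_dom P x)"
    using retr_diffeo[of x] interior_subset by (auto simp: local_diffeo_on_def)
  then show ?thesis unfolding rinv_def by (metis inv_into_f_f retr_0)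
qed

lemma retr_rinv: "y \<in> retr P x ` retr_inv_dom P x \<Longrightarrow> retr P x (rinv P x y) = y"
  unfolding rinv_def by (rule f_inv_into_f)

lemma rinv_tendsto: "(rinv P x \<longlongrightarrow> 0) (nhds x)"
proof -
  have "C2_map (atlas_X P) std_atlas (retr P x ` retr_inv_dom P x) (rinv P x)"
    "x \<in> interior (retr P x ` retr_inv_dom P x)"
    using retr_diffeo[of x] by (simp_all add: local_diffeo_on_def rinv_def)
  from C2_map_tendsto[OF this] show ?thesis by simp
qed

text \<open>Difference quotients along \<open>t v\<close> are bounded by the Lipschitz constant, and
  so is their limit.\<close>

lemma df_bound_of_lipschitz:
  assumes "r > 0" and lip: "\<And>v. nrm P x v < r \<Longrightarrow> \<bar>pull_f P x v - pull_f P x 0\<bar> \<le> N * nrm P x v"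
  shows "\<bar>df P x v\<bar> \<le> N * nrm P x v"
proof -
  interpret df: bounded_linear "df P x" by (rule df_bounded_linear)
  have "(pull_f P x has_derivative df P x) (at (0 + 0 *\<^sub>R v))"
    unfolding df_def using twice_diff_has_derivative[OF twice_diff_pull(1)[OF retr_dom_0]] by simp
  from line_has_derivative[OF this, of UNIV]
  have "((\<lambda>t. pull_f P x (t *\<^sub>R v)) has_field_derivative df P x v) (at 0)"
    by (simp add: has_field_derivative_def df.scaleR mult_commute_abs)
  then have "((\<lambda>t. (pull_f P x (t *\<^sub>R v) - pull_f P x 0) / t) \<longlongrightarrow> df P x v) (at 0)"
    by (simp add: DERIV_def)
  then have lim: "((\<lambda>t. \<bar>(pull_f P x (t *\<^sub>R v) - pull_f P x 0) / t\<bar>) \<longlongrightarrow> \<bar>df P x v\<bar>) (at 0)"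
    by (rule tendsto_rabs)
  have "((\<lambda>t. nrm P x (t *\<^sub>R v)) \<longlongrightarrow> 0 * nrm P x v) (at 0)"
    by (simp del: mult_zero_left) (intro tendsto_intros tendsto_rabs_zero tendsto_mult_left_zero)
  then have "\<forall>\<^sub>F t in at 0. nrm P x (t *\<^sub>R v) < r"
    by (rule order_tendstoD(2)) (use \<open>r > 0\<close> in simp)
  moreover have "\<forall>\<^sub>F t in at (0::real). t \<noteq> 0" by (simp add: eventually_at_filter)
  ultimately have "\<forall>\<^sub>F t in at 0. \<bar>(pull_f P x (t *\<^sub>R v) - pull_f P x 0) / t\<bar> \<le> N * nrm P x v"
  proof eventually_elim
    case (elim t)
    have "\<bar>pull_f P x (t *\<^sub>R v) - pull_f P x 0\<bar> \<le> N * (\<bar>t\<bar> * nrm P x v)"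
      using lip[OF elim(1)] by simp
    then show ?case using elim(2) by (simp add: field_simps)
  qed
  then show ?thesis using tendsto_upperbound[OF lim] by (simp add: trivial_limit_at)
qed

lemma pull_f_lipschitz:
  assumes dom: "\<And>d. nrm P x d < r \<Longrightarrow> d \<in> interior (retr_dom P x)"
    and bnd: "\<And>d v. nrm P x d < r \<Longrightarrow> \<bar>D1 (pull_f P x) d v\<bar> \<le> N * nrm P x v"
    and "nrm P x a < r" "nrm P x b < r"
  shows "\<bar>pull_f P x a - pull_f P x b\<bar> \<le> N * nrm P x (a - b)"
proof -
  have "((\<lambda>t. pull_f P x (b + t *\<^sub>R (a - b))) has_derivative
      (\<lambda>h. D1 (pull_f P x) (b + t *\<^sub>R (a - b)) (h *\<^sub>R (a - b)))) (at t within {0..1})"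
    if "0 \<le> t" "t \<le> 1" for t
    by (intro line_has_derivative twice_diff_has_derivative twice_diff_pull dom ip.segment assms that)
  from mvt_very_simple[OF _ this] obtain t where t: "0 \<le> t" "t \<le> 1"
    "pull_f P x a - pull_f P x b = D1 (pull_f P x) (b + t *\<^sub>R (a - b)) (a - b)" by auto
  show ?thesis unfolding t(3) by (intro bnd ip.segment assms t)
qed

text \<open>The points \<open>0\<close> and \<open>rinv P z x\<close> in the coordinates at
  \<open>z\<close> correspond to \<open>rinv P x z\<close> and \<open>0\<close> in those at
  \<open>x\<close>. The Lipschitz bound on coordinate changes therefore makes the solution close to
  0 in all nearby coordinates, with constants independent of \<open>x\<close>.\<close>

lemma uniform_newton_points:
  assumes min: "local_minimizer P z" and zU: "z \<in> U"
    and A: "assumption_A P z U" and B: "assumption_B P U"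
  obtains C r \<epsilon> where "0 < \<epsilon>" "U \<subseteq> retr P z ` retr_inv_dom P z"
    "\<And>x. x \<in> U \<Longrightarrow> nrm P z (rinv P z x) < \<epsilon> \<Longrightarrow> newton_point P x C r (rinv P x z)"
    "\<And>x. x \<in> U \<Longrightarrow> nrm P z (rinv P z x) < \<epsilon> \<Longrightarrow> nrm P x (rinv P x z) \<le> C * nrm P z (rinv P z x)"
    "\<And>x y. x \<in> U \<Longrightarrow> nrm P x y < r \<Longrightarrow> nrm P x (rinv P x z) < r \<Longrightarrow>
       nrm P z (rinv P z (retr P x y)) \<le> C * nrm P x (y - rinv P x z)"
proof -
  obtain Q \<rho> \<gamma> where nd: "open Q" "U \<subseteq> Q" "\<forall>x\<in>Q. Q \<subseteq> retr P x ` retr_inv_dom P x" "\<rho> > 0"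
    "\<forall>x\<in>U. \<forall>v. nrm P x v < \<rho> \<longrightarrow> v \<in> retr_dom P x \<and> retr P x v \<in> Q"
    "\<forall>x1\<in>U. \<forall>x2\<in>U. \<forall>v w. nrm P x1 v < \<rho> \<longrightarrow> nrm P x1 w < \<rho> \<longrightarrow>
       nrm P x2 (rinv P x2 (retr P x1 v) - rinv P x2 (retr P x1 w)) \<le> \<gamma> * nrm P x1 (v - w)"
    using A unfolding assumption_A_def non_degenerate_def by (elim exE conjE) (rule that)
  note Q = nd(2) nd(3)[rule_format] and \<rho> = nd(4) nd(5)[rule_format] and \<gamma> = nd(6)[rule_format]
  obtain \<rho>0 \<omega>f \<omega>c \<omega>cs where \<rho>0: "\<rho>0 > 0" and A': "\<forall>x\<in>U.
          (\<forall>d\<in>interior (retr_dom P x). nrm P x d \<le> \<rho>0 \<longrightarrow>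
             dual_nrm P x (\<lambda>v. D1 (pull_f P x) d v - df P x v) \<le> \<omega>f * nrm P x d) \<and>
          surj (dc P x) \<and>
          (\<forall>d\<in>interior (retr_dom P x). \<forall>v. nrm P x d \<le> \<rho>0 \<longrightarrow>
             nrm P x (pseudo_inv P x (dc P x) (D1 (pull_c P x) d v - dc P x v))
               \<le> \<omega>c * nrm P x d * nrm P x v) \<and>
          (rinv P x z \<in> interior (retr_dom P x) \<longrightarrow>
             surj (D1 (pull_c P x) (rinv P x z)) \<and>
             (\<forall>v. nrm P x (pseudo_inv P x (D1 (pull_c P x) (rinv P x z))
                     (D1 (pull_c P x) (rinv P x z) v - dc P x v))
                \<le> \<omega>cs * nrm P x (rinv P x z - 0) * nrm P x v))"
    using A unfolding assumption_A_def by (elim exE conjE) (rule that)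
  note A' = A'[THEN bspec]
  note f1 = A'[THEN conjunct1, rule_format] and surj = A'[THEN conjunct2, THEN conjunct1]
    and c1 = A'[THEN conjunct2, THEN conjunct2, THEN conjunct1, rule_format]
    and cs = A'[THEN conjunct2, THEN conjunct2, THEN conjunct2, THEN mp]
  obtain \<rho>1 \<omega>L \<alpha> MH M\<Phi> where \<rho>1: "\<rho>1 > 0" and \<alpha>: "\<alpha> > 0" and B': "\<forall>x\<in>U.
          (\<forall>d\<in>interior (retr_dom P x). \<forall>v w. nrm P x d \<le> \<rho>1 \<longrightarrow>
             \<bar>D2 (pull_L P x (multiplier P x)) d v w - D2 (pull_L P x (multiplier P x)) 0 v w\<bar>
               \<le> \<omega>L * nrm P x d * nrm P x v * nrm P x w) \<and>
          (\<forall>v. dc P x v = 0 \<longrightarrow> hess_o P x v v \<ge> \<alpha> * (nrm P x v)\<^sup>2) \<and>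
          (\<forall>v w. \<bar>hess_o P x v w\<bar> \<le> MH * nrm P x v * nrm P x w) \<and>
          (\<exists>\<Phi>. retr_transition P x \<Phi> \<and>
             (\<forall>v w. nrm P x (D2 \<Phi> 0 v w) \<le> M\<Phi> * nrm P x v * nrm P x w))"
    using B unfolding assumption_B_def by (elim exE conjE) (rule that)
  note B' = B'[THEN bspec]
  note L2 = B'[THEN conjunct1, rule_format] and ell = B'[THEN conjunct2, THEN conjunct1, rule_format]
    and hb = B'[THEN conjunct2, THEN conjunct2, THEN conjunct1, rule_format]
    and \<Phi> = B'[THEN conjunct2, THEN conjunct2, THEN conjunct2]
  have dom: "v \<in> interior (retr_dom P x)" if "x \<in> U" "nrm P x v < \<rho>" for x v
  proof -
    have "open {v. nrm P x v < \<rho>}" by (intro open_Collect_less ip.continuous_n continuous_on_const)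
    then have "{v. nrm P x v < \<rho>} \<subseteq> interior (retr_dom P x)" by (rule interior_maximal[rotated]) (use \<rho> that in auto)
    then show ?thesis using that by blast
  qed
  have inQ: "y \<in> retr P x ` retr_inv_dom P x" if "x \<in> U" "y \<in> Q" for x y using Q that by blast
  have transport: "retr P x (rinv P x y) = y" if "x \<in> U" "y \<in> Q" for x y by (rule retr_rinv[OF inQ[OF that]])
  have UQ: "x \<in> Q" if "x \<in> U" for x using Q that by blast
  define r where "r = Min {\<rho>, \<rho>0, \<rho>1, 1}"
  have r: "0 < r" "r \<le> \<rho>" "r \<le> \<rho>0" "r \<le> \<rho>1" "r \<le> 1" using \<rho> \<rho>0 \<rho>1 by (auto simp: r_def)
  interpret dfz: bounded_linear "df P z" by (rule df_bounded_linear)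
  obtain K where K: "K > 0" "\<And>v. norm (df P z v) \<le> norm v * K" using dfz.pos_bounded by blast
  obtain K1 where K1: "K1 > 0" "\<And>v. norm v \<le> K1 * nrm P z v" using ip.norm_le_n[of z] by blast
  \<comment> \<open>The sign of \<gamma> is not prescribed; the positive part allows inequalities to
    be multiplied by it.\<close>
  define g where "g = max \<gamma> 0"
  define N where "N = K1 * K + \<bar>\<omega>f\<bar>"
  have N: "N \<ge> 0" using K K1 by (simp add: N_def)
  define S where "S = {1, \<omega>f, \<omega>c, \<omega>cs, \<omega>L, 1 / \<alpha>, MH, M\<Phi>, N * g, \<gamma>}"
  define C where "C = Max S"
  have "a \<le> C" if "a \<in> S" for a
    unfolding C_def by (rule Max_ge[OF _ that]) (simp add: S_def)
  then have C: "1 \<le> C" "\<omega>f \<le> C" "\<omega>c \<le> C" "\<omega>cs \<le> C" "\<omega>L \<le> C" "1 / \<alpha> \<le> C" "MH \<le> C" "M\<Phi> \<le> C" "N * g \<le> C" "\<gamma> \<le> C"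
    by (simp_all add: S_def)
  have up1: "b \<le> C * s" if "b \<le> k * s" "k \<le> C" "0 \<le> s" for b k s
    using order_trans[OF that(1) mult_right_mono[OF that(2,3)]] .
  have up2: "b \<le> C * s * t" if "b \<le> k * s * t" "k \<le> C" "0 \<le> s" "0 \<le> t" for b k s t
    using up1[of b k "s * t"] that by (simp add: mult.assoc)
  have up3: "b \<le> C * s * t * u" if "b \<le> k * s * t * u" "k \<le> C" "0 \<le> s" "0 \<le> t" "0 \<le> u" for b k s t u
    using up1[of b k "s * t * u"] that by (simp add: mult.assoc)
  have f_lip: "\<bar>D1 (pull_f P x) d v - df P x v\<bar> \<le> \<omega>f * nrm P x d * nrm P x v"
    if "x \<in> U" "nrm P x d < r" for x d v
  proof (rule dual_nrm_bound)
    have d: "d \<in> interior (retr_dom P x)" using that r by (intro dom) auto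
    show "bounded_linear (\<lambda>v. D1 (pull_f P x) d v - df P x v)"
      by (intro bounded_linear_sub df_bounded_linear twice_diff_bounded_linear_D1 twice_diff_pull d)
    show "dual_nrm P x (\<lambda>v. D1 (pull_f P x) d v - df P x v) \<le> \<omega>f * nrm P x d"
      using that r by (intro f1 d) auto
  qed
  have fz: "\<bar>D1 (pull_f P z) d v\<bar> \<le> N * nrm P z v" if "nrm P z d < r" for d v
  proof -
    have "\<bar>df P z v\<bar> \<le> K1 * nrm P z v * K"
      using order_trans[OF K(2)[of v] mult_right_mono[OF K1(2)[of v], of K]] K(1) by simp
    moreover have "\<omega>f * nrm P z d * nrm P z v \<le> \<bar>\<omega>f\<bar> * 1 * nrm P z v"
      using that r by (intro mult_right_mono mult_mono) auto
    ultimately show ?thesis using f_lip[OF zU that, of v] by (simp add: N_def algebra_simps)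
  qed
  have \<gamma>g: "nrm P x2 (rinv P x2 (retr P x1 v) - rinv P x2 (retr P x1 w)) \<le> g * nrm P x1 (v - w)"
    if "x1 \<in> U" "x2 \<in> U" "nrm P x1 v < \<rho>" "nrm P x1 w < \<rho>" for x1 x2 v w
    using \<gamma>[OF that] mult_right_mono[of \<gamma> g "nrm P x1 (v - w)"] by (simp add: g_def)
  have "\<forall>\<^sub>F v in nhds 0. retr P z v \<in> fst (KX z) \<and> constr P (retr P z v) \<in> fst (KY (constr P z))"
    using eventually_retr[OF retr_dom_0, of "\<lambda>y. y \<in> fst (KX z) \<and> constr P y \<in> fst (KY (constr P z))" z]
      eventually_conj[OF eventually_in_chart_X[OF KX, of z] tendsto_eventually[OF constr_tendsto eventually_in_chart_Y[OF KY, of "constr P z"]]]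
    by simp
  from eventually_nhds_nrm[OF this, of z]
  obtain \<delta> where \<delta>: "\<delta> > 0" "\<And>v. nrm P z v < \<delta> \<Longrightarrow> retr P z v \<in> fst (KX z)"
    "\<And>v. nrm P z v < \<delta> \<Longrightarrow> constr P (retr P z v) \<in> fst (KY (constr P z))" by metis
  define G where "G = g + 1"
  have G: "G > 0" "g \<le> G" by (simp_all add: G_def g_def)
  \<comment> \<open>The bound \<open>r\<close> keeps the solution inside the good ball, \<delta> / G
    keeps the transported segment in the charts at \<open>z\<close>, and 1 / (2C) gives the
    perturbation bound 1/2 required by \<open>critical_in_pullback\<close>.\<close>
  define s where "s = Min {r, \<delta> / G, 1 / (2 * C)}"
  have s: "s > 0" "s \<le> r" "s \<le> \<delta> / G" "s \<le> 1 / (2 * C)"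
    using r \<delta> G C by (auto simp: s_def)
  define \<epsilon> where "\<epsilon> = min (r / 2) (s / G)"
  have \<epsilon>: "\<epsilon> > 0" "\<epsilon> \<le> r / 2" "\<epsilon> \<le> s / G" unfolding \<epsilon>_def using r s G by (simp, simp only: min.cobounded1, simp only: min.cobounded2)
  have e_le: "nrm P x (rinv P x z) \<le> k * nrm P z (rinv P z x)"
    if x: "x \<in> U" "nrm P z (rinv P z x) < \<epsilon>" and k: "\<gamma> \<le> k" for x k
  proof -
    have "nrm P x (rinv P x (retr P z 0) - rinv P x (retr P z (rinv P z x))) \<le> \<gamma> * nrm P z (0 - rinv P z x)"
      using x \<epsilon> r \<rho>(1) by (intro \<gamma> zU) auto
    then have "nrm P x (rinv P x z) \<le> \<gamma> * nrm P z (rinv P z x)"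
      by (simp add: transport[OF zU UQ[OF x(1)]])
    then show ?thesis using mult_right_mono[OF k, of "nrm P z (rinv P z x)"] by simp
  qed
  have np: "newton_point P x C r (rinv P x z)" if x: "x \<in> U" "nrm P z (rinv P z x) < \<epsilon>" for x
  proof -
    define xs where "xs = rinv P x z"
    have "nrm P x xs \<le> G * nrm P z (rinv P z x)"
      unfolding xs_def by (rule e_le[OF x]) (simp add: G_def g_def)
    also have "\<dots> < G * (s / G)" using x(2) \<epsilon> G by (intro mult_strict_left_mono) auto
    finally have es: "nrm P x xs < s" using G by simp
    have "G * nrm P x xs < G * (\<delta> / G)" "C * nrm P x xs \<le> C * (1 / (2 * C))"
      using es s G C by (intro mult_strict_left_mono mult_left_mono; simp)+
    then have e: "nrm P x xs < r" "nrm P x xs < \<rho>" "G * nrm P x xs < \<delta>" "C * nrm P x xs \<le> 1 / 2"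
      using es s r G C by simp_all
    have rz: "retr P x xs = z" unfolding xs_def by (rule transport[OF x(1) UQ[OF zU]])
    have txs: "nrm P x (t *\<^sub>R xs) \<le> nrm P x xs" if "t \<in> {0..1}" for t
      using that by (simp add: mult_left_le_one_le)
    \<comment> \<open>Seen from \<open>z\<close>, the whole segment stays within \<delta> of 0, as
      coordinate changes are Lipschitz and the endpoint \<open>xs\<close> is sent to 0.\<close>
    have near: "retr P x (t *\<^sub>R xs) \<in> fst (KX z)" "constr P (retr P x (t *\<^sub>R xs)) \<in> fst (KY (constr P z))"
      if t: "t \<in> {0..1}" for t
    proof -
      let ?y = "retr P x (t *\<^sub>R xs)"
      have tr: "nrm P x (t *\<^sub>R xs) < \<rho>" using txs[OF t] e by simp
      have "nrm P z (rinv P z ?y - rinv P z (retr P x xs)) \<le> g * nrm P x (t *\<^sub>R xs - xs)"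
        by (rule \<gamma>g[OF x(1) zU tr e(2)])
      then have "nrm P z (rinv P z ?y) \<le> g * nrm P x (t *\<^sub>R xs - xs)" by (simp add: rz)
      also have "t *\<^sub>R xs - xs = (t - 1) *\<^sub>R xs" by (simp add: algebra_simps)
      also have "g * nrm P x ((t - 1) *\<^sub>R xs) \<le> G * nrm P x xs"
        using t G(2) by (intro mult_mono) (auto simp: mult_left_le_one_le g_def)
      finally have "nrm P z (rinv P z ?y) < \<delta>" using e by simp
      moreover have "retr P z (rinv P z ?y) = ?y" using \<rho>(2)[OF x(1) tr] by (intro transport zU) auto
      ultimately show "?y \<in> fst (KX z)" "constr P ?y \<in> fst (KY (constr P z))"
        using \<delta>(2,3)[of "rinv P z ?y"] by simp_all
    qed
    have c_lip: "nrm P x (pseudo_inv P x (dc P x) (D1 (pull_c P x) d v - dc P x v)) \<le> C * nrm P x d * nrm P x v"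
      if "nrm P x d < r" for d v
      by (rule up2[OF c1]) (use that x r C dom in auto)
    have crit: "D1 (pull_f P x) xs u = 0" if "D1 (pull_c P x) xs u = 0" for u
    proof (rule critical_in_pullback[OF min surj[OF zU] surj[OF x(1)] rz _ near _ that])
      show "t *\<^sub>R xs \<in> interior (retr_dom P x)" if "t \<in> {0..1}" for t
        using txs[OF that] e by (intro dom x) simp
      show "nrm P x (pseudo_inv P x (dc P x) (D1 (pull_c P x) (t *\<^sub>R xs) v - dc P x v)) \<le> nrm P x v / 2"
        if "t \<in> {0..1}" for t v
      proof -
        have "C * nrm P x (t *\<^sub>R xs) \<le> 1 / 2"
          using order_trans[OF mult_left_mono[OF txs[OF that], of C] e(4)] C(1) by simp
        from mult_right_mono[OF this, of "nrm P x v"] c_lip[of "t *\<^sub>R xs" v] txs[OF that] e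
        show ?thesis by simp
      qed
    qed auto
    show ?thesis
      unfolding xs_def[symmetric]
    proof (unfold_locales)
      show "1 \<le> C" "0 < r" "r \<le> 1" by fact+
      show "surj (dc P x)" by (rule surj[OF x(1)])
      show "nrm P x xs < r" by fact
      show "pull_c P x xs = 0"
        using min by (simp add: pull_c_def rz local_minimizer_def)
      show "d \<in> interior (retr_dom P x)" if "nrm P x d < r" for d
        using that r by (intro dom x) auto
      show "\<bar>D1 (pull_f P x) d v - df P x v\<bar> \<le> C * nrm P x d * nrm P x v" if "nrm P x d < r" for d v
        by (rule up2[OF f_lip[OF x(1) that]]) (use C in auto)
      \<comment> \<open>Assumption (A) bounds only differences of f'. At \<open>z\<close> the
        functional itself is bounded, so the cost has Lipschitz constant \<open>N\<close> in the
        coordinates there; the coordinate change carries this over to \<open>x\<close> with constant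
        \<open>N * g\<close>.\<close>
      show "\<bar>df P x v\<bar> \<le> C * nrm P x v" for v
      proof -
        \<comment> \<open>Vectors shorter than this are moved by at most r/2 in the coordinates at
          \<open>z\<close>; the base point is within r/2 of 0 there, so the ball of radius
          \<open>r\<close> is not left.\<close>
        define d where "d = r / (2 * G)"
        have "d > 0" using r G by (simp add: d_def)
        have "\<bar>pull_f P x v - pull_f P x 0\<bar> \<le> (N * g) * nrm P x v" if v: "nrm P x v < min \<rho> d" for v
        proof -
          let ?a = "rinv P z (retr P x v)" and ?b = "rinv P z (retr P x 0)"
          have ab: "nrm P z (?a - ?b) \<le> g * nrm P x (v - 0)"
            using v \<rho>(1) by (intro \<gamma>g x zU) auto
          have b: "nrm P z ?b < r / 2" using x(2) \<epsilon> by simp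
          have "g * nrm P x v \<le> G * d" using v G by (intro mult_mono) auto
          then have "nrm P z (?a - ?b) \<le> r / 2" using ab G by (simp add: d_def)
          then have a: "nrm P z ?a < r" using ip.n_triangle[of z "?a - ?b" ?b] b by simp
          have "\<bar>pull_f P z ?a - pull_f P z ?b\<bar> \<le> N * nrm P z (?a - ?b)"
          proof (rule pull_f_lipschitz[where r = r])
            show "d \<in> interior (retr_dom P z)" if "nrm P z d < r" for d using that r by (intro dom zU) auto
          qed (use fz a b r in auto)
          also have "\<dots> \<le> N * (g * nrm P x v)" using ab N by (intro mult_left_mono) auto
          moreover have "pull_f P z ?a = pull_f P x v" "pull_f P z ?b = pull_f P x 0"
            using transport[OF zU, of "retr P x v"] transport[OF zU, of x] UQ[OF x(1)] \<rho>(2)[OF x(1), of v] v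
            by (simp_all add: pull_f_def)
          ultimately show ?thesis by (simp only: mult.assoc)
        qed
        moreover have "min \<rho> d > 0" using \<rho>(1) \<open>d > 0\<close> by simp
        ultimately have "\<bar>df P x v\<bar> \<le> (N * g) * nrm P x v" by (intro df_bound_of_lipschitz)
        then show ?thesis by (rule up1) (use C in auto)
      qed
      show "nrm P x (pseudo_inv P x (dc P x) (D1 (pull_c P x) d v - dc P x v)) \<le> C * nrm P x d * nrm P x v"
        if "nrm P x d < r" for d v by (rule c_lip[OF that])
      show "\<bar>D2 (pull_L P x (multiplier P x)) d v w - D2 (pull_L P x (multiplier P x)) 0 v w\<bar>
          \<le> C * nrm P x d * nrm P x v * nrm P x w" if "nrm P x d < r" for d v w
        by (rule up3[OF L2]) (use that x r C dom in auto)
      show "(nrm P x v)\<^sup>2 \<le> C * hess_o P x v v" if "dc P x v = 0" for v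
      proof -
        have h: "\<alpha> * (nrm P x v)\<^sup>2 \<le> hess_o P x v v" by (rule ell[OF x(1) that])
        then have "(nrm P x v)\<^sup>2 \<le> (1 / \<alpha>) * hess_o P x v v" using \<alpha> by (simp add: field_simps)
        moreover have "0 \<le> hess_o P x v v" using h \<alpha> by (meson mult_nonneg_nonneg less_imp_le order_trans zero_le_power2)
        ultimately show ?thesis using C by (intro up1)
      qed
      show "\<bar>hess_o P x v w\<bar> \<le> C * nrm P x v * nrm P x w" for v w
        by (rule up2[OF hb[OF x(1)]]) (use C in auto)
      show "\<exists>u. D2 (pull_L P x (multiplier P x)) 0 v w - hess_o P x v w = dL P x (multiplier P x) u \<and>
          nrm P x u \<le> C * nrm P x v * nrm P x w"
        if "second_order_consistent P (constr P x) \<or> dc P x v = 0 \<or> dc P x w = 0" for v w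
      proof -
        obtain \<Phi> where \<Phi>: "retr_transition P x \<Phi>"
          "\<And>v w. nrm P x (D2 \<Phi> 0 v w) \<le> M\<Phi> * nrm P x v * nrm P x w" using \<Phi>[OF x(1)] by blast
        show ?thesis
        proof (intro exI conjI)
          show "D2 (pull_L P x (multiplier P x)) 0 v w - hess_o P x v w = dL P x (multiplier P x) (D2 \<Phi> 0 v w)"
            unfolding hess_o_def
            by (rule hessian_difference[OF multiplier_bounded_linear[OF surj[OF x(1)]] \<Phi>(1) that])
          show "nrm P x (D2 \<Phi> 0 v w) \<le> C * nrm P x v * nrm P x w"
            by (rule up2[OF \<Phi>(2)]) (use C in auto)
        qed
      qed
      show "\<exists>\<zeta>. nrm P x \<zeta> \<le> C * nrm P x xs * nrm P x w \<and>
          D1 (pull_c P x) xs \<zeta> = D1 (pull_c P x) xs w \<and> D1 (pull_f P x) xs \<zeta> = D1 (pull_f P x) xs w"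
        if "dc P x w = 0" for w
      proof -
        have xsd: "xs \<in> interior (retr_dom P x)" using e by (intro dom x) auto
        let ?B = "D1 (pull_c P x) xs"
        note cs' = cs[OF x(1), folded xs_def, OF xsd]
        have B: "bounded_linear ?B" "surj ?B" 
          using cs' twice_diff_bounded_linear_D1[OF twice_diff_pull(2)[OF xsd]] by auto
        interpret B: bounded_linear ?B by (rule B)
        interpret f: bounded_linear "D1 (pull_f P x) xs"
          by (rule twice_diff_bounded_linear_D1[OF twice_diff_pull(1)[OF xsd]])
        \<comment> \<open>The shortest vector with the same image as \<open>w\<close>. As
          \<open>dc P x w = 0\<close>, the third bound of Assumption (A) is a bound for its
          length.\<close>
        define \<zeta> where "\<zeta> = pseudo_inv P x ?B (?B w)"
        have 1: "?B \<zeta> = ?B w" unfolding \<zeta>_def by (rule A_pseudo_inv[OF B])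
        have "nrm P x \<zeta> \<le> \<omega>cs * nrm P x xs * nrm P x w"
          using conjunct2[OF cs', rule_format, of w] that by (simp add: \<zeta>_def)
        then have 2: "nrm P x \<zeta> \<le> C * nrm P x xs * nrm P x w" by (rule up2) (use C in auto)
        \<comment> \<open>The difference lies in the kernel of the constraint derivative at
          \<open>xs\<close>, where criticality applies.\<close>
        have "D1 (pull_f P x) xs (\<zeta> - w) = 0" by (rule crit) (simp add: B.diff 1)
        then have "D1 (pull_f P x) xs \<zeta> = D1 (pull_f P x) xs w" by (simp add: f.diff)
        then show ?thesis using 1 2 by blast
      qed
    qed
  qed
  show thesis
  proof (rule that[of \<epsilon> C r])
    show "U \<subseteq> retr P z ` retr_inv_dom P z" using inQ[OF zU] UQ by blast
    show "nrm P x (rinv P x z) \<le> C * nrm P z (rinv P z x)" if "x \<in> U" "nrm P z (rinv P z x) < \<epsilon>" for x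
      by (rule e_le[OF that]) (use C in auto)
    show "nrm P z (rinv P z (retr P x y)) \<le> C * nrm P x (y - rinv P x z)"
      if "x \<in> U" "nrm P x y < r" "nrm P x (rinv P x z) < r" for x y
    proof -
      have "nrm P z (rinv P z (retr P x y) - rinv P z (retr P x (rinv P x z))) \<le> \<gamma> * nrm P x (y - rinv P x z)"
        using that r by (intro \<gamma> zU) auto
      then have "nrm P z (rinv P z (retr P x y)) \<le> \<gamma> * nrm P x (y - rinv P x z)"
        by (simp add: transport[OF that(1) UQ[OF zU]])
      then show ?thesis by (rule up1) (use C in auto)
    qed
  qed (use \<epsilon> np in auto)
qed

end

lemma cs_trial_\<omega>f_pos:
  assumes "cs_trial P q acc s s'" "valid_params q" "snd (snd s) > 0"
  shows "snd (snd s') > 0"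
proof -
  obtain x \<omega>c \<omega>f x' \<omega>c' \<omega>f' where s: "s = (x, \<omega>c, \<omega>f)" "s' = (x', \<omega>c', \<omega>f')" by (metis prod_cases3)
  obtain \<eta> raw where "update_\<omega>f q \<eta> raw \<omega>f \<omega>f'"
    using assms(1) unfolding s cs_trial_def prod.case by blast
  from update_\<omega>f_bounds(1)[OF this assms(2)] show ?thesis using assms(3) by (simp add: s)
qed

lemma cs_iteration_\<omega>f_pos:
  assumes "((cs_trial P q False)\<^sup>*\<^sup>* OO cs_trial P q True) s s'" "valid_params q" "snd (snd s) > 0"
  shows "snd (snd s') > 0"
proof -
  obtain t where t: "(cs_trial P q False)\<^sup>*\<^sup>* s t" "cs_trial P q True t s'" using assms(1) by blast
  from t(1) have "snd (snd t) > 0"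
    by (induction rule: rtranclp_induct) (use assms cs_trial_\<omega>f_pos in blast)+
  then show ?thesis using cs_trial_\<omega>f_pos[OF t(2) assms(2)] by blast
qed

theorem theorem5p1:
  fixes P :: "('x::topological_space, 'y::topological_space,
               'e::{real_inner, banach}, 'h::{real_inner, banach}) eq_problem"
    and q :: cs_params and x_star :: 'x and U :: "'x set" and x :: "nat \<Rightarrow> 'x"
  assumes "eq_setting P"
    and "valid_params q"
    and "local_minimizer P x_star"
    and "x_star \<in> interior U"
    and "assumption_A P x_star U"
    and "assumption_B P U"
    and "composite_step_sequence P q x"
    and "x \<longlonglongrightarrow> x_star"
  shows "\<exists>\<beta>. \<forall>\<^sub>F k in sequentially.
           x k \<in> retr P x_star ` retr_inv_dom P x_star \<and>
           nrm P x_star (rinv P x_star (x (Suc k)) - 0)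
             \<le> \<beta> * (nrm P x_star (rinv P x_star (x k) - 0))\<^sup>2"
proof -
  interpret problem P by unfold_locales fact
  note q = assms(2)
  have zU: "x_star \<in> U" using assms(4) interior_subset by blast
  obtain C r \<epsilon> where \<epsilon>: "0 < \<epsilon>" and sub: "U \<subseteq> retr P x_star ` retr_inv_dom P x_star"
    and np: "\<And>x. x \<in> U \<Longrightarrow> nrm P x_star (rinv P x_star x) < \<epsilon> \<Longrightarrow> newton_point P x C r (rinv P x x_star)"
    and e_le: "\<And>x. x \<in> U \<Longrightarrow> nrm P x_star (rinv P x_star x) < \<epsilon> \<Longrightarrow>
      nrm P x (rinv P x x_star) \<le> C * nrm P x_star (rinv P x_star x)"
    and transport: "\<And>x y. x \<in> U \<Longrightarrow> nrm P x y < r \<Longrightarrow> nrm P x (rinv P x x_star) < r \<Longrightarrow>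
       nrm P x_star (rinv P x_star (retr P x y)) \<le> C * nrm P x (y - rinv P x x_star)"
    by (rule uniform_newton_points[OF assms(3) zU assms(5,6)]) blast
  define d where "d k = nrm P x_star (rinv P x_star (x k))" for k
  interpret z: newton_point P x_star C r "rinv P x_star x_star"
    by (rule np[OF zU]) (simp add: \<epsilon>)
  have C: "1 \<le> C" "0 < r" by (fact z.C z.r)+
  have qp: "0 < rho_ellbow q * theta_aim q" "0 < b_up q" using q by (auto simp: valid_params_def)
  have lim: "((\<lambda>k. rinv P x_star (x k)) \<longlongrightarrow> 0) sequentially"
    by (rule filterlim_compose[OF rinv_tendsto assms(8)])
  have "isCont (nrm P x_star) 0"
    using ip.continuous_n[of UNIV x_star] by (simp add: continuous_on_eq_continuous_at)
  from isCont_tendsto_compose[OF this lim] have d0: "d \<longlonglongrightarrow> 0" by (simp add: d_def[abs_def])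
  \<comment> \<open>The extra factor C in the denominators translates the distance seen from the
    limit into the one seen from the iterate, by \<open>e k \<le> C * d k\<close>.\<close>
  define \<epsilon>' where "\<epsilon>' = Min {\<epsilon>, r / (C * (144 * C ^ 6)), rho_ellbow q * theta_aim q / (C * (144 * C ^ 6)), r / (C * (12 * C ^ 3))}"
  have "\<epsilon>' > 0" using \<epsilon> C qp by (auto simp: \<epsilon>'_def)
  have "\<forall>\<^sub>F k in sequentially. x k \<in> U \<and> d k < \<epsilon>'"
  proof (rule eventually_conj)
    have "\<forall>\<^sub>F k in sequentially. x k \<in> interior U"
      using tendsto_eventually[OF assms(8) eventually_nhds_in_open[OF open_interior assms(4)]] .
    then show "\<forall>\<^sub>F k in sequentially. x k \<in> U" by (rule eventually_mono) (use interior_subset in blast)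
    show "\<forall>\<^sub>F k in sequentially. d k < \<epsilon>'" using order_tendstoD(2)[OF d0 \<open>\<epsilon>' > 0\<close>] .
  qed
  then obtain k0 where k0: "\<And>k. k \<ge> k0 \<Longrightarrow> x k \<in> U" "\<And>k. k \<ge> k0 \<Longrightarrow> d k < \<epsilon>'"
    unfolding eventually_sequentially by blast
  define e where "e k = nrm P (x k) (rinv P (x k) x_star)" for k
  have near: "newton_point P (x k) C r (rinv P (x k) x_star)" "e k \<le> C * d k"
    "144 * C ^ 6 * e k < r" "144 * C ^ 6 * e k \<le> rho_ellbow q * theta_aim q" "12 * C ^ 3 * e k < r"
    if "k \<ge> k0" for k
  proof -
    have dk: "d k < \<epsilon>" "d k < r / (C * (144 * C ^ 6))"
      "d k < rho_ellbow q * theta_aim q / (C * (144 * C ^ 6))" "d k < r / (C * (12 * C ^ 3))"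
      using k0(2)[OF that] by (auto simp: \<epsilon>'_def)
    show "newton_point P (x k) C r (rinv P (x k) x_star)"
      by (rule np[OF k0(1)[OF that]]) (use dk in \<open>simp add: d_def\<close>)
    show ek: "e k \<le> C * d k"
      unfolding e_def d_def by (rule e_le[OF k0(1)[OF that]]) (use dk in \<open>simp add: d_def\<close>)
    have *: "K * e k < b" if "d k < b / (C * K)" "K > 0" for K b
    proof -
      have "K * e k \<le> K * (C * d k)" using ek that by (intro mult_left_mono) auto
      also have "\<dots> < b" using that C by (simp add: field_simps)
      finally show ?thesis .
    qed
    have "C ^ 6 > 0" "C ^ 3 > 0" using C by simp_all
    then show "144 * C ^ 6 * e k < r" "144 * C ^ 6 * e k \<le> rho_ellbow q * theta_aim q" "12 * C ^ 3 * e k < r"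
      using *[OF dk(2)] *[OF dk(3)] *[OF dk(4)] by simp_all
  qed
  from assms(7) obtain \<omega>c \<omega>f where \<omega>0: "\<omega>f 0 > 0"
    and it: "\<And>k. ((cs_trial P q False)\<^sup>*\<^sup>* OO cs_trial P q True)
               (x k, \<omega>c k, \<omega>f k) (x (Suc k), \<omega>c (Suc k), \<omega>f (Suc k))"
    unfolding composite_step_sequence_def by blast
  have \<omega>f: "\<omega>f k > 0" for k
    by (induction k) (use \<omega>0 cs_iteration_\<omega>f_pos[OF it q] in auto)
  \<comment> \<open>The index starts at \<open>Suc k0\<close>: the value at \<open>k0\<close> may
    stem from a trial far away, and one iteration near the solution is needed to bound it.\<close>
  have \<omega>c: "0 \<le> \<omega>c k" "\<omega>c k \<le> 2 * C" if "k \<ge> Suc k0" for k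
  proof -
    obtain j where j: "k = Suc j" "j \<ge> k0" using \<open>k \<ge> Suc k0\<close> by (cases k) auto
    show "0 \<le> \<omega>c k" "\<omega>c k \<le> 2 * C"
      using newton_point.iteration_rough[OF near(1)[OF j(2)] it q \<omega>f] near(5)[OF j(2)] by (simp_all add: j e_def)
  qed
  \<comment> \<open>Either the value at the first controlled index or the threshold of
    \<open>iteration_local\<close>, below which \<omega>f may still grow.\<close>
  define W where "W = max (\<omega>f (Suc k0)) (b_up q * (144 * C ^ 3))"
  have W: "b_up q * (144 * C ^ 3) \<le> W" "0 \<le> W" using \<omega>f[of "Suc k0"] by (auto simp: W_def)
  note local = newton_point.iteration_local[OF near(1) it q \<omega>c(1,2) \<omega>f near(5)[unfolded e_def]
      near(3)[unfolded e_def] near(4)[unfolded e_def]]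
  have \<omega>fW: "\<omega>f k \<le> W" if "k \<ge> Suc k0" for k
    using that
  proof (induction k rule: dec_induct)
    case (step k)
    then show ?case by (intro local(1)[of k W] W) auto
  qed (simp add: W_def)
  have step: "d (Suc k) \<le> (C * ((155 + 30 * W) * C ^ 7) * C\<^sup>2) * (d k)\<^sup>2" if k: "k \<ge> Suc k0" for k
  proof -
    have kk: "k \<ge> k0" using k by simp
    obtain y where y: "x (Suc k) = retr P (x k) y" "nrm P (x k) y < r"
      "nrm P (x k) (y - rinv P (x k) x_star) \<le> (155 + 30 * W) * C ^ 7 * (e k)\<^sup>2"
      using local(2)[OF kk k k kk kk kk \<omega>fW[OF k] W(1)] unfolding e_def by blast
    have "d (Suc k) \<le> C * nrm P (x k) (y - rinv P (x k) x_star)"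
      unfolding d_def y(1) using newton_point.xs(1)[OF near(1)[OF kk]]
      by (intro transport k0(1)[OF kk] y(2))
    also have "\<dots> \<le> C * ((155 + 30 * W) * C ^ 7 * (e k)\<^sup>2)" using y(3) C by (intro mult_left_mono) auto
    also have "\<dots> \<le> C * ((155 + 30 * W) * C ^ 7 * (C * d k)\<^sup>2)"
      using near(2)[OF kk] C W(2) by (intro mult_left_mono power_mono) (auto simp: e_def)
    finally show ?thesis by (simp add: power_mult_distrib mult.assoc)
  qed
  show ?thesis
  proof (intro exI)
    show "\<forall>\<^sub>F k in sequentially. x k \<in> retr P x_star ` retr_inv_dom P x_star \<and>
        nrm P x_star (rinv P x_star (x (Suc k)) - 0)
          \<le> (C * ((155 + 30 * W) * C ^ 7) * C\<^sup>2) * (nrm P x_star (rinv P x_star (x k) - 0))\<^sup>2"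
      unfolding eventually_sequentially
      using step sub k0(1) by (intro exI[of _ "Suc k0"]) (auto simp: d_def)
  qed
qed

end
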